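(* Let $n\ge 1$. The family $\{[G_\pi] : \pi\in\Phi(n)\}$ is a basis of the complex vector space $FDR_n$, where $[f]$ denotes the equivalence class in $FDR_n$ of $f\in\wedge\{\Theta_{n-1},\Xi'_{n-1}\}$.
   Context: $\wedge\{\Theta_{n-1},\Xi'_{n-1}\}$ is the exterior algebra over $\mathbb{C}$ on the $2(n-1)$ anticommuting generators $\theta_1,\dots,\theta_{n-1},\xi'_1,\dots,\xi'_{n-1}$. The fermionic diagonal coinvariant ring $FDR_n$ is the quotient of the exterior algebra $\wedge\{\theta_1,\dots,\theta_n,\xi_1,\dots,\xi_n\}$ over $\mathbb{C}$ by the two-sided ideal generated by the $\mathfrak{S}_n$-invariants with zero constant term, for the diagonal action $w\cdot\theta_i=\theta_{w(i)}$, $w\cdot\xi_i=\xi_{w(i)}$. It is identified with $$FDR_n\cong\wedge\{\Theta_{n-1},\Xi'_{n-1}\}/\langle\theta_1\xi'_1+\cdots+\theta_{n-1}\xi'_{n-1}\rangle$$ through the isomorphism induced by $\theta_i\mapsto\theta_i$ and $\xi_i\mapsto\xi'_i-\frac1n(\xi'_1+\cdots+\xi'_{n-1})$ for $1\le i\le n-1$, $\theta_n\mapsto-(\theta_1+\cdots+\theta_{n-1})$, $\xi_n\mapsto-\frac1n(\xi'_1+\cdots+\xi'_{n-1})$. Classes $[f]$ are taken in this quotient. Exterior differentiation: for a generator $\omega$ of an exterior algebra and distinct generators $\omega_{s_1},\dots,\omega_{s_k}$, $\omega\odot(\omega_{s_1}\cdots\omega_{s_k})=(-1)^{j-1}\omega_{s_1}\cdots\widehat{\omega_{s_j}}\cdots\omega_{s_k}$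 if $\omega=\omega_{s_j}$, and $0$ if $\omega$ is none of the $\omega_{s_j}$; this extends to an action of the algebra on itself by $(ab)\odot f=a\odot(b\odot f)$, $1\odot f=f$. $\Psi(n)$ is the set of set partitions of $[n]=\{1,\dots,n\}$ in which every block not containing $n$ has size 1 or 2, and each block of size 1 not containing $n$ carries a label, either $\theta$ or $\xi'$. $\Phi(n)\subseteq\Psi(n)$ is the subset of noncrossing ones: there are no $a<b<c<d$ with $a,c$ in one block and $b,d$ in a different block. For a block $B$ of some $\pi\in\Psi(n)$ the block operator $\tau_B$ on $\wedge\{\Theta_{n-1},\Xi'_{n-1}\}$ is: $\tau_B(f)=\left(\prod_{i\in B\setminus\{n\}}\theta_i\right)\odot f$ (product in increasing order of indices) if $n\in B$; $\tau_B(f)=\xi'_i\cdot(\theta_j\odot f)+\xi'_j\cdot(\theta_i\odot f)$ if $B=\{i,j\}$, $n\notin B$; $\tau_B(f)=f$ if $B=\{i\}$, $i\neq n$, is labelled $\theta$; $\tau_B(f)=\xi'_i\cdot(\theta_i\odot f)$ if $B=\{i\}$, $i\ne n$, is labelled $\xi'$. For $\pi\in\Psi(n)$ with blocks $B_1,\dots,B_k$ and $n\in B_k$, $G_\pi:=\tau_{B_1}\cdots\tau_{B_k}(\theta_1\theta_2\cdots\theta_{n-1})$ (block operators of blocks not containing $n$ commute, so this is well defined). *)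

theory Defs
  imports Complex_Main "HOL-Library.Disjoint_Sets" "HOL-Library.FuncSet"
    "HOL-Combinatorics.Permutations" "HOL-Algebra.Module" "HOL-Algebra.QuotRing"
begin

section \<open>Exterior algebras over the complex numbers\<close>

text \<open>
  An element of the exterior algebra on a finite, linearly ordered set \<open>S\<close> of anticommuting
  generators is given by its coefficients with respect to the basis of monomials
  \<open>\<omega>\<^sub>A = \<omega>\<^sub>1 \<cdots> \<omega>\<^sub>k\<close>, one for each \<open>A = {\<omega>\<^sub>1 < \<cdots> < \<omega>\<^sub>k} \<subseteq> S\<close>.
  For disjoint \<open>A\<close> and \<open>B\<close> one has \<open>\<omega>\<^sub>A \<omega>\<^sub>B = ext_sign A B \<omega>\<^bsub>A \<union> B\<^esub>\<close>, and
  \<open>\<omega>\<^sub>A \<omega>\<^sub>B = 0\<close> if \<open>A\<close> and \<open>B\<close> meet.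
\<close>

definition ext_sign :: "'g::linorder set \<Rightarrow> 'g set \<Rightarrow> complex" where
  "ext_sign A B = (-1) ^ card {(a, b). a \<in> A \<and> b \<in> B \<and> b < a}"

definition ext_mult ::
    "('g::linorder set \<Rightarrow> complex) \<Rightarrow> ('g set \<Rightarrow> complex) \<Rightarrow> 'g set \<Rightarrow> complex" where
  "ext_mult f g = (\<lambda>C. \<Sum>A\<in>Pow C. ext_sign A (C - A) * f A * g (C - A))"

definition ext_one :: "'g set \<Rightarrow> complex" where
  "ext_one = (\<lambda>A. if A = {} then 1 else 0)"

definition exterior :: "'g::linorder set \<Rightarrow> (complex, 'g set \<Rightarrow> complex) module" where
  "exterior S =
    \<lparr>carrier = {f. \<forall>A. f A \<noteq> 0 \<longrightarrow> A \<subseteq> S},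
     mult = ext_mult, one = ext_one,
     zero = (\<lambda>A. 0), add = (\<lambda>f g A. f A + g A),
     smult = (\<lambda>c f A. c * f A)\<rparr>"

definition ext_gen :: "'g \<Rightarrow> 'g set \<Rightarrow> complex" where
  "ext_gen a = (\<lambda>A. if A = {a} then 1 else 0)"

definition ext_prod :: "('g::linorder set \<Rightarrow> complex) list \<Rightarrow> 'g set \<Rightarrow> complex" where
  "ext_prod fs = foldr ext_mult fs ext_one"

text \<open>
  The linear map sending \<open>\<omega>\<^sub>1 \<cdots> \<omega>\<^sub>k\<close>, with the generators in increasing order, to
  \<open>\<phi> \<omega>\<^sub>1 \<cdots> \<phi> \<omega>\<^sub>k\<close>.  When all \<open>\<phi> \<omega>\<close> are linear combinations of generators this is the
  unique homomorphism of algebras that extends \<open>\<phi>\<close>.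
\<close>

definition ext_hom ::
    "('g::linorder \<Rightarrow> 'h::linorder set \<Rightarrow> complex) \<Rightarrow> ('g set \<Rightarrow> complex) \<Rightarrow> 'h set \<Rightarrow> complex" where
  "ext_hom \<phi> f = (\<lambda>C. \<Sum>A | f A \<noteq> 0. f A * ext_prod (map \<phi> (sorted_list_of_set A)) C)"

text \<open>
  Exterior differentiation \<open>\<omega> \<odot> f\<close> by a generator: the monomial \<open>\<omega>\<^sub>C\<close> arises only from
  \<open>\<omega>\<^bsub>C \<union> {\<omega>}\<^esub>\<close> with \<open>\<omega> \<notin> C\<close>, in which \<open>\<omega>\<close> is preceded by the generators \<open>a \<in> C\<close> with
  \<open>a < \<omega>\<close>.
\<close>

definition ext_diff_gen :: "'g::linorder \<Rightarrow> ('g set \<Rightarrow> complex) \<Rightarrow> 'g set \<Rightarrow> complex" where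
  "ext_diff_gen w f =
    (\<lambda>C. if w \<in> C then 0 else (-1) ^ card {a \<in> C. a < w} * f (insert w C))"

definition ext_diff ::
    "('g::linorder set \<Rightarrow> complex) \<Rightarrow> ('g set \<Rightarrow> complex) \<Rightarrow> 'g set \<Rightarrow> complex" where
  "ext_diff a f =
    (\<lambda>C. \<Sum>A | a A \<noteq> 0. a A * foldr ext_diff_gen (sorted_list_of_set A) f C)"

subsection \<open>Exterior algebras are rings\<close>

lemma ext_sign_Un_left:
  assumes "finite A" "finite B" "finite E" "A \<inter> B = {}"
  shows "ext_sign (A \<union> B) E = ext_sign A E * ext_sign B E"
proof -
  have fin: "finite {(a, b). a \<in> X \<and> b \<in> E \<and> b < a}" if "finite X" for X
    by (rule finite_subset[of _ "X \<times> E"]) (use that assms in auto)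
  have "{(a, b). a \<in> A \<union> B \<and> b \<in> E \<and> b < a} =
    {(a, b). a \<in> A \<and> b \<in> E \<and> b < a} \<union> {(a, b). a \<in> B \<and> b \<in> E \<and> b < a}"
    by auto
  then have "card {(a, b). a \<in> A \<union> B \<and> b \<in> E \<and> b < a} =
    card {(a, b). a \<in> A \<and> b \<in> E \<and> b < a} + card {(a, b). a \<in> B \<and> b \<in> E \<and> b < a}"
    using assms fin by (auto intro!: card_Un_disjoint)
  then show ?thesis
    by (simp add: ext_sign_def power_add)
qed

lemma ext_sign_Un_right:
  assumes "finite A" "finite B" "finite E" "B \<inter> E = {}"
  shows "ext_sign A (B \<union> E) = ext_sign A B * ext_sign A E"
proof -
  have fin: "finite {(a, b). a \<in> A \<and> b \<in> X \<and> b < a}" if "finite X" for X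
    by (rule finite_subset[of _ "A \<times> X"]) (use that assms in auto)
  have "{(a, b). a \<in> A \<and> b \<in> B \<union> E \<and> b < a} =
    {(a, b). a \<in> A \<and> b \<in> B \<and> b < a} \<union> {(a, b). a \<in> A \<and> b \<in> E \<and> b < a}"
    by auto
  then have "card {(a, b). a \<in> A \<and> b \<in> B \<union> E \<and> b < a} =
    card {(a, b). a \<in> A \<and> b \<in> B \<and> b < a} + card {(a, b). a \<in> A \<and> b \<in> E \<and> b < a}"
    using assms fin by (auto intro!: card_Un_disjoint)
  then show ?thesis
    by (simp add: ext_sign_def power_add)
qed

lemma ext_sign_empty: "ext_sign {} B = 1" "ext_sign A {} = 1"
  by (simp_all add: ext_sign_def)

lemma ext_mult_infinite: "infinite C \<Longrightarrow> ext_mult f g C = 0"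
  by (simp add: ext_mult_def)

lemma ext_mult_assoc: "ext_mult (ext_mult f g) h = ext_mult f (ext_mult g h)"
proof
  fix C :: "'a set"
  show "ext_mult (ext_mult f g) h C = ext_mult f (ext_mult g h) C"
  proof (cases "finite C")
    case False
    then show ?thesis by (simp add: ext_mult_infinite)
  next
    case fin: True
    then have fin_sub: "finite A" if "A \<subseteq> C" for A
      using that finite_subset by blast
    have "ext_mult (ext_mult f g) h C =
      (\<Sum>(A, B)\<in>Sigma (Pow C) Pow.
        ext_sign A (C - A) * (ext_sign B (A - B) * f B * g (A - B)) * h (C - A))"
      unfolding ext_mult_def using fin fin_sub
      by (subst sum.Sigma[symmetric]) (auto simp: sum_distrib_left sum_distrib_right)
    also have "\<dots> = (\<Sum>(B, D)\<in>Sigma (Pow C) (\<lambda>B. Pow (C - B)).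
        ext_sign B (C - B) * f B * (ext_sign D (C - B - D) * g D * h (C - B - D)))"
    proof (rule sum.reindex_bij_witness[where i = "\<lambda>(B, D). (B \<union> D, B)"
          and j = "\<lambda>(A, B). (B, A - B)"], goal_cases)
      case (5 p)
      then obtain A B where p: "p = (A, B)" "B \<subseteq> A" "A \<subseteq> C"
        by auto
      define D where "D = A - B"
      define E where "E = C - A"
      have *: "A = B \<union> D" "C - A = E" "C - B = D \<union> E" "C - B - D = E" "A - B = D"
        "B \<inter> D = {}" "D \<inter> E = {}"
        using p by (auto simp: D_def E_def)
      have "finite B" "finite D" "finite E"
        using p fin_sub by (auto simp: D_def E_def intro: finite_subset)
      then have "ext_sign B (D \<union> E) = ext_sign B D * ext_sign B E"
        "ext_sign (B \<union> D) E = ext_sign B E * ext_sign D E"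
        using * by (auto intro: ext_sign_Un_left ext_sign_Un_right)
      moreover have "D \<union> E - D = E" using * by auto
      ultimately show ?case
        using * by (simp add: p(1) flip: D_def E_def)
    qed auto
    also have "\<dots> = ext_mult f (ext_mult g h) C"
      unfolding ext_mult_def using fin fin_sub
      by (subst sum.Sigma[symmetric]) (auto simp: sum_distrib_left sum_distrib_right)
    finally show ?thesis .
  qed
qed

lemma ext_one_mult: "(\<And>A. f A \<noteq> 0 \<Longrightarrow> finite A) \<Longrightarrow> ext_mult ext_one f = f"
proof
  fix C :: "'a set" assume *: "\<And>A. f A \<noteq> 0 \<Longrightarrow> finite A"
  show "ext_mult ext_one f C = f C"
  proof (cases "finite C")
    case True
    have "ext_mult ext_one f C = (\<Sum>A\<in>Pow C. if A = {} then f C else 0)"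
      unfolding ext_mult_def by (rule sum.cong) (auto simp: ext_one_def ext_sign_empty)
    then show ?thesis using True by simp
  qed (use * in \<open>auto simp: ext_mult_infinite\<close>)
qed

lemma ext_mult_one: "(\<And>A. f A \<noteq> 0 \<Longrightarrow> finite A) \<Longrightarrow> ext_mult f ext_one = f"
proof
  fix C :: "'a set" assume *: "\<And>A. f A \<noteq> 0 \<Longrightarrow> finite A"
  show "ext_mult f ext_one C = f C"
  proof (cases "finite C")
    case True
    have "ext_mult f ext_one C = (\<Sum>A\<in>Pow C. if A = C then f C else 0)"
      unfolding ext_mult_def by (rule sum.cong) (auto simp: ext_one_def ext_sign_empty)
    then show ?thesis using True by simp
  qed (use * in \<open>auto simp: ext_mult_infinite\<close>)
qed

lemma ring_exterior:
  assumes "finite S"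
  shows "ring (exterior S)"
proof (rule ringI)
  show "abelian_group (exterior S)"
  proof (rule abelian_groupI)
    fix x assume "x \<in> carrier (exterior S)"
    then show "\<exists>y\<in>carrier (exterior S). y \<oplus>\<^bsub>exterior S\<^esub> x = \<zero>\<^bsub>exterior S\<^esub>"
      by (intro bexI[of _ "\<lambda>A. - x A"]) (auto simp: exterior_def)
  qed (auto simp: exterior_def algebra_simps, (metis add.right_neutral subsetD)+)
  have fin: "finite A" if "f \<in> carrier (exterior S)" "f A \<noteq> 0" for f A
    using that assms by (auto simp: exterior_def intro: finite_subset)
  show "monoid (exterior S)"
  proof (rule monoidI)
    fix x y assume xy: "x \<in> carrier (exterior S)" "y \<in> carrier (exterior S)"
    have "C \<subseteq> S" if nz: "ext_mult x y C \<noteq> 0" for C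
    proof -
      obtain A where A: "A \<subseteq> C" "ext_sign A (C - A) * x A * y (C - A) \<noteq> 0"
        using nz unfolding ext_mult_def by (metis (lifting) PowD sum.not_neutral_contains_not_neutral)
      then have "x A \<noteq> 0" "y (C - A) \<noteq> 0"
        by auto
      then have "A \<subseteq> S" "C - A \<subseteq> S"
        using xy unfolding exterior_def by fastforce+
      then show ?thesis
        using A by blast
    qed
    then show "x \<otimes>\<^bsub>exterior S\<^esub> y \<in> carrier (exterior S)"
      by (simp add: exterior_def)
  next
    fix x assume "x \<in> carrier (exterior S)"
    note f = fin[OF this]
    show "\<one>\<^bsub>exterior S\<^esub> \<otimes>\<^bsub>exterior S\<^esub> x = x" "x \<otimes>\<^bsub>exterior S\<^esub> \<one>\<^bsub>exterior S\<^esub> = x"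
      using f by (simp_all add: exterior_def ext_one_mult ext_mult_one)
  qed (auto simp: exterior_def ext_mult_assoc ext_one_def)
qed (auto simp: exterior_def ext_mult_def algebra_simps sum.distrib)

section \<open>Quotient algebras and bases\<close>

text \<open>\<^term>\<open>A Quot I\<close> together with its scalar multiplication.\<close>

definition quot_algebra :: "(complex, 'b) module \<Rightarrow> 'b set \<Rightarrow> (complex, 'b set) module" where
  "quot_algebra A I = ring.extend (A Quot I)
    \<lparr>smult = (\<lambda>c X. \<Union>x\<in>X. I +>\<^bsub>A\<^esub> (c \<odot>\<^bsub>A\<^esub> x))\<rparr>"

definition is_basis_family :: "(complex, 'b) module \<Rightarrow> 'i set \<Rightarrow> ('i \<Rightarrow> 'b) \<Rightarrow> bool" where
  "is_basis_family V I b \<longleftrightarrow>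
    b \<in> I \<rightarrow> carrier V \<and>
    (\<forall>J c. finite J \<and> J \<subseteq> I \<and> (\<Oplus>\<^bsub>V\<^esub>i\<in>J. c i \<odot>\<^bsub>V\<^esub> b i) = \<zero>\<^bsub>V\<^esub> \<longrightarrow> (\<forall>i\<in>J. c i = 0)) \<and>
    (\<forall>x\<in>carrier V. \<exists>J c. finite J \<and> J \<subseteq> I \<and> x = (\<Oplus>\<^bsub>V\<^esub>i\<in>J. c i \<odot>\<^bsub>V\<^esub> b i))"

section \<open>The fermionic diagonal coinvariant ring\<close>

datatype gen = Theta nat | Xi nat | Xi' nat

text \<open>Any linear order would do.  This one puts all \<open>\<theta>\<^sub>i\<close> first, then all \<open>\<xi>\<^sub>i\<close>, then all \<open>\<xi>'\<^sub>i\<close>.\<close>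

fun gen_kind :: "gen \<Rightarrow> nat" where
  "gen_kind (Theta i) = 0"
| "gen_kind (Xi i) = 1"
| "gen_kind (Xi' i) = 2"

fun gen_index :: "gen \<Rightarrow> nat" where
  "gen_index (Theta i) = i"
| "gen_index (Xi i) = i"
| "gen_index (Xi' i) = i"

instantiation gen :: linorder
begin

definition less_eq_gen :: "gen \<Rightarrow> gen \<Rightarrow> bool" where
  "x \<le> y \<longleftrightarrow> gen_kind x < gen_kind y \<or> gen_kind x = gen_kind y \<and> gen_index x \<le> gen_index y"

definition less_gen :: "gen \<Rightarrow> gen \<Rightarrow> bool" where
  "x < y \<longleftrightarrow> gen_kind x < gen_kind y \<or> gen_kind x = gen_kind y \<and> gen_index x < gen_index y"

instance
proof
  fix x y :: gen
  show "x \<le> y \<Longrightarrow> y \<le> x \<Longrightarrow> x = y"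
    by (cases x; cases y) (auto simp: less_eq_gen_def)
qed (auto simp: less_eq_gen_def less_gen_def)

end

type_synonym ext = "gen set \<Rightarrow> complex"

abbreviation \<theta> :: "nat \<Rightarrow> ext" where "\<theta> i \<equiv> ext_gen (Theta i)"
abbreviation \<xi> :: "nat \<Rightarrow> ext" where "\<xi> i \<equiv> ext_gen (Xi i)"
abbreviation \<xi>' :: "nat \<Rightarrow> ext" where "\<xi>' i \<equiv> ext_gen (Xi' i)"

definition ext_full :: "nat \<Rightarrow> (complex, ext) module" where
  "ext_full n = exterior (Theta ` {1..n} \<union> Xi ` {1..n})"

definition ext_red :: "nat \<Rightarrow> (complex, ext) module" where
  "ext_red n = exterior (Theta ` {1..<n} \<union> Xi' ` {1..<n})"

text \<open>The values on \<open>\<xi>'\<^sub>i\<close> are irrelevant: these generators do not occur in \<^term>\<open>ext_full n\<close>.\<close>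

definition perm_act :: "(nat \<Rightarrow> nat) \<Rightarrow> ext \<Rightarrow> ext" where
  "perm_act w = ext_hom
    (\<lambda>g. case g of Theta i \<Rightarrow> \<theta> (w i) | Xi i \<Rightarrow> \<xi> (w i) | Xi' i \<Rightarrow> \<xi>' i)"

definition pos_invariants :: "nat \<Rightarrow> ext set" where
  "pos_invariants n =
    {f \<in> carrier (ext_full n). (\<forall>w. w permutes {1..n} \<longrightarrow> perm_act w f = f) \<and> f {} = 0}"

definition FDR_ideal :: "nat \<Rightarrow> ext set" where
  "FDR_ideal n = Idl\<^bsub>ext_full n\<^esub> (pos_invariants n)"

definition FDR :: "nat \<Rightarrow> (complex, ext set) module" where
  "FDR n = quot_algebra (ext_full n) (FDR_ideal n)"

definition red_ideal :: "nat \<Rightarrow> ext set" where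
  "red_ideal n = Idl\<^bsub>ext_red n\<^esub> {\<lambda>A. \<Sum>i\<in>{1..<n}. ext_mult (\<theta> i) (\<xi>' i) A}"

text \<open>
  The homomorphism \<open>\<and>{\<Theta>\<^sub>n, \<Xi>\<^sub>n} \<rightarrow> \<and>{\<Theta>\<^bsub>n-1\<^esub>, \<Xi>'\<^bsub>n-1\<^esub>}\<close>, and the map that it induces from
  \<^term>\<open>FDR n\<close> to the quotient of \<^term>\<open>ext_red n\<close> by \<^term>\<open>red_ideal n\<close>.  The latter
  is an isomorphism, by which the two quotients are identified.
\<close>

definition red_map :: "nat \<Rightarrow> ext \<Rightarrow> ext" where
  "red_map n = ext_hom
    (\<lambda>g. case g of
       Theta i \<Rightarrow> if i < n then \<theta> i else (\<lambda>A. - (\<Sum>j\<in>{1..<n}. \<theta> j A))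
     | Xi i \<Rightarrow>
         if i < n then (\<lambda>A. \<xi>' i A - 1 / of_nat n * (\<Sum>j\<in>{1..<n}. \<xi>' j A))
         else (\<lambda>A. - (1 / of_nat n) * (\<Sum>j\<in>{1..<n}. \<xi>' j A))
     | Xi' i \<Rightarrow> \<xi>' i)"

definition FDR_iso :: "nat \<Rightarrow> ext set \<Rightarrow> ext set" where
  "FDR_iso n X = (\<Union>f\<in>X. red_ideal n +>\<^bsub>ext_red n\<^esub> red_map n f)"

text \<open>
  The class \<open>[f]\<close> of \<open>f \<in> \<and>{\<Theta>\<^bsub>n-1\<^esub>, \<Xi>'\<^bsub>n-1\<^esub>}\<close>, as an element of \<^term>\<open>FDR n\<close>.
\<close>

definition FDR_class :: "nat \<Rightarrow> ext \<Rightarrow> ext set" where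
  "FDR_class n f =
    the_inv_into (carrier (FDR n)) (FDR_iso n) (red_ideal n +>\<^bsub>ext_red n\<^esub> f)"

section \<open>Labelled set partitions and block operators\<close>

datatype label = LTheta | LXi'

type_synonym lpart = "nat set set \<times> (nat set \<Rightarrow> label)"

text \<open>
  A labelled set partition is a pair of its set of blocks and of the labelling of its singleton
  blocks other than \<open>{n}\<close>; the labelling is \<open>undefined\<close> on all other sets, so that
  each partition is represented only once.
\<close>

definition Psi :: "nat \<Rightarrow> lpart set" where
  "Psi n = {(P, l). partition_on {1..n} P \<and>
     (\<forall>B\<in>P. n \<notin> B \<longrightarrow> card B \<in> {1, 2}) \<and>
     l \<in> {B \<in> P. n \<notin> B \<and> card B = 1} \<rightarrow>\<^sub>E UNIV}"

definition noncrossing :: "nat set set \<Rightarrow> bool" where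
  "noncrossing P \<longleftrightarrow>
    \<not> (\<exists>a b c d. a < b \<and> b < c \<and> c < d \<and>
        (\<exists>B\<in>P. \<exists>B'\<in>P. B \<noteq> B' \<and> a \<in> B \<and> c \<in> B \<and> b \<in> B' \<and> d \<in> B'))"

definition Phi :: "nat \<Rightarrow> lpart set" where
  "Phi n = {(P, l) \<in> Psi n. noncrossing P}"

definition block_op :: "nat \<Rightarrow> (nat set \<Rightarrow> label) \<Rightarrow> nat set \<Rightarrow> ext \<Rightarrow> ext" where
  "block_op n l B f =
    (if n \<in> B then ext_diff (ext_prod (map \<theta> (sorted_list_of_set (B - {n})))) f
     else if card B = 2 then
       (let i = Min B; j = Max B
        in (\<lambda>A. ext_mult (\<xi>' i) (ext_diff (\<theta> j) f) A + ext_mult (\<xi>' j) (ext_diff (\<theta> i) f) A))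
     else
       (let i = the_elem B
        in case l B of LTheta \<Rightarrow> f | LXi' \<Rightarrow> ext_mult (\<xi>' i) (ext_diff (\<theta> i) f)))"

text \<open>
  The operator of the block containing \<open>n\<close> is applied first; those of the other blocks commute,
  so \<^const>\<open>Finite_Set.fold\<close> composes them in an arbitrary order.
\<close>

definition G :: "nat \<Rightarrow> lpart \<Rightarrow> ext" where
  "G n \<pi> = (case \<pi> of (P, l) \<Rightarrow>
     let L = (THE B. B \<in> P \<and> n \<in> B)
     in Finite_Set.fold (block_op n l)
          (block_op n l L (ext_prod (map \<theta> [1..<n]))) (P - {L}))"

end

theory Submission
  imports Defs
begin

text \<open>
  Multiplication by \<open>\<theta>\<^sub>1 \<xi>'\<^sub>1 + \<cdots>\<close> (\<open>lefschetz\<close>) and the operator \<open>\<Sum> \<xi>'\<^sub>i \<odot> (\<theta>\<^sub>i \<odot> \<cdot>)\<close>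
  (\<open>colefschetz\<close>) are adjoint for the inner product in which monomials are orthonormal, so the
  reduced exterior algebra is the orthogonal sum of the kernel of the latter and the image of the
  former, and the kernel represents the quotient. Every \<open>G\<^sub>\<pi>\<close> lies in this kernel,
  because \<open>colefschetz\<close> commutes with the block operators. Its leading monomial, for the sum of
  the indices, takes \<open>\<theta>\<^sub>j \<xi>'\<^sub>j\<close> from the right end \<open>j\<close> of each pair and nothing from the left end.
  By bracket matching, these leading monomials correspond bijectively to \<open>\<Phi>(n)\<close> and include every
  ballot monomial, one with at most \<open>k\<close> generators of index at most \<open>k\<close> for all \<open>k\<close>;
  so the \<open>G\<^sub>\<pi>\<close> are independent. Conversely, an element of the kernel that vanishes on all ballot
  monomials is \<open>0\<close>, by induction on \<open>n\<close> and the \<open>sl\<^sub>2\<close> relation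
  \<open>colefschetz_lefschetz\<close>; so the \<open>G\<^sub>\<pi>\<close> span.

  The map from \<open>FDR\<^sub>n\<close> to the reduced quotient is inverted by \<open>\<theta>\<^sub>i \<mapsto> \<theta>\<^sub>i\<close>, \<open>\<xi>'\<^sub>i \<mapsto> \<xi>\<^sub>i - \<xi>\<^sub>n\<close>, once
  the invariants are known to lie in the ideal of the power sums of \<open>\<theta>\<^sub>k\<close>, \<open>\<xi>\<^sub>k\<close> and \<open>\<theta>\<^sub>k \<xi>\<^sub>k\<close>.
\<close>

subsection \<open>Signs and graded commutativity\<close>

text \<open>The operators form an \<open>sl_2\<close> acting on n-1 pairs of generators, with weight
  n-1-d in degree d. The weight is negative above the middle degree n-1, and comparing norms shows
  that \<open>colefschetz\<close> kills nothing there; this is why ballot monomials, whose degree is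
  at most n-1, can control the kernel. The index sum is the right statistic because replacing
  \<open>\<theta>\<^sub>i\<close> by \<open>\<xi>'\<^sub>j\<close> raises it by j - i: of the two
  terms of a pair operator, the one that creates \<open>\<xi>'\<close> at the right end wins. The
  obstacle is that a leading monomial does not tell a left end from an index of the block of n,
  since both contribute nothing; for noncrossing partitions the arcs are nevertheless determined,
  from the smallest right end upwards. Spanning comes by elimination: the triangular family attached
  to the ballot monomials matches any kernel element on these monomials, and the difference is 0 by
  the ballot criterion. For the invariants, averaging over the symmetric group reduces to
  symmetrized monomials, treated by induction on the number of indices involved.\<close>

lemma ext_sign_swap:
  assumes "finite A" "finite B" "A \<inter> B = {}"
  shows "ext_sign A B = (-1) ^ (card A * card B) * ext_sign B A"
proof -
  define X where "X = {(a, b). a \<in> A \<and> b \<in> B \<and> b < a}"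
  define Y where "Y = {(b, a). b \<in> B \<and> a \<in> A \<and> a < b}"
  have "a < b \<or> b < a" if "a \<in> A" "b \<in> B" for a b
    using that assms(3) by (metis disjoint_iff linorder_less_linear)
  then have un: "X \<union> prod.swap ` Y = A \<times> B"
    unfolding X_def Y_def by (force simp: image_iff)
  have disj: "X \<inter> prod.swap ` Y = {}"
    unfolding X_def Y_def by auto
  have fin: "finite X" "finite (prod.swap ` Y)"
    using assms(1,2) un by (metis finite_Un finite_cartesian_product)+
  have "card (prod.swap ` Y) = card Y"
    by (intro card_image) (auto simp: inj_on_def)
  then have "card X + card Y = card A * card B"
    using card_Un_disjoint[OF fin disj] by (simp add: un card_cartesian_product)
  \<comment> \<open>Only parities matter; adding \<open>card Y\<close> on both sides avoids a
    subtraction of exponents.\<close>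
  then have "card A * card B + card Y = card X + 2 * card Y" by simp
  then have "(-1 :: complex) ^ (card A * card B + card Y) = (-1) ^ card X"
    by (simp add: power_add)
  then show ?thesis
    by (simp add: ext_sign_def power_add flip: X_def Y_def)
qed

text \<open>Graded commutativity, splitting by splitting: passing to the complement exchanges the
  two factors and costs the sign of their degrees.\<close>

lemma ext_mult_swap:
  assumes "finite C"
  shows "ext_mult f g C =
    (\<Sum>A\<in>Pow C. (-1) ^ (card A * card (C - A)) * (ext_sign A (C - A) * g A * f (C - A)))"
  unfolding ext_mult_def
proof (rule sum.reindex_bij_witness[where i = "\<lambda>A. C - A" and j = "\<lambda>A. C - A"], goal_cases)
  case (5 A)
  then have *: "C - (C - A) = A" "finite A" "finite (C - A)" "A \<inter> (C - A) = {}"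
    using assms finite_subset by auto
  show ?case
    unfolding *(1) by (subst ext_sign_swap[OF *(2-4)]) (simp add: mult_ac)
qed auto

text \<open>Zero is homogeneous of every degree. Since \<open>card\<close> is 0 on infinite sets,
  positive degree also forces the support to consist of finite sets, which is what makes
  \<open>ext_one\<close> neutral for such elements.\<close>

definition homogeneous :: "nat \<Rightarrow> ('g set \<Rightarrow> complex) \<Rightarrow> bool" where
  "homogeneous d f \<longleftrightarrow> (\<forall>A. f A \<noteq> 0 \<longrightarrow> card A = d)"

lemma ext_mult_anticomm:
  assumes "homogeneous 1 f" "homogeneous 1 g"
  shows "ext_mult f g C = - ext_mult g f C"
proof (cases "finite C")
  case True
  show ?thesis
    unfolding ext_mult_swap[OF True, of f g] ext_mult_def[of g f] sum_negf[symmetric]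
  proof (rule sum.cong, goal_cases)
    case (2 A)
    then show ?case
      using assms unfolding homogeneous_def by (cases "g A = 0 \<or> f (C - A) = 0") auto
  qed simp
qed (simp add: ext_mult_infinite)

lemma ext_mult_even_comm:
  assumes "homogeneous 2 f"
  shows "ext_mult f g = ext_mult g f"
proof
  fix C
  show "ext_mult f g C = ext_mult g f C"
  proof (cases "finite C")
    case True
    show ?thesis
      unfolding ext_mult_swap[OF True, of f g] ext_mult_def[of g f]
    proof (rule sum.cong, goal_cases)
      case (2 A)
      then show ?case
        using assms unfolding homogeneous_def by (cases "f (C - A) = 0") auto
    qed simp
  qed (simp add: ext_mult_infinite)
qed

text \<open>Linearity is stated with coefficients throughout the development; plain sums are the
  instances with \<open>\<lambda>_. 1\<close>.\<close>

lemma ext_mult_sum_right: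
  "ext_mult f (\<lambda>A. \<Sum>i\<in>I. c i * g i A) C = (\<Sum>i\<in>I. c i * ext_mult f (g i) C)"
proof -
  have "ext_mult f (\<lambda>A. \<Sum>i\<in>I. c i * g i A) C =
      (\<Sum>A\<in>Pow C. \<Sum>i\<in>I. c i * (ext_sign A (C - A) * f A * g i (C - A)))"
    unfolding ext_mult_def by (simp add: sum_distrib_left mult_ac)
  then show ?thesis
    by (subst (asm) sum.swap) (simp add: ext_mult_def sum_distrib_left)
qed

lemma ext_mult_sum_left:
  "ext_mult (\<lambda>A. \<Sum>i\<in>I. c i * f i A) g C = (\<Sum>i\<in>I. c i * ext_mult (f i) g C)"
proof -
  have "ext_mult (\<lambda>A. \<Sum>i\<in>I. c i * f i A) g C =
      (\<Sum>A\<in>Pow C. \<Sum>i\<in>I. c i * (ext_sign A (C - A) * f i A * g (C - A)))"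
    unfolding ext_mult_def by (simp add: sum_distrib_left sum_distrib_right mult_ac)
  then show ?thesis
    by (subst (asm) sum.swap) (simp add: ext_mult_def sum_distrib_left)
qed

lemma ext_mult_scale_left: "ext_mult (\<lambda>A. c * f A) g = (\<lambda>C. c * ext_mult f g C)"
  by (simp add: ext_mult_def sum_distrib_left mult_ac)

lemma ext_mult_scale_right: "ext_mult f (\<lambda>A. c * g A) = (\<lambda>C. c * ext_mult f g C)"
  by (simp add: ext_mult_def sum_distrib_left mult_ac)

lemma ext_mult_minus_right: "ext_mult f (\<lambda>A. - g A) = (\<lambda>C. - ext_mult f g C)"
  using ext_mult_scale_right[of f "-1" g] by simp

lemma ext_mult_minus_left: "ext_mult (\<lambda>A. - f A) g = (\<lambda>C. - ext_mult f g C)"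
  using ext_mult_scale_left[of "-1" f g] by simp

lemma ext_mult_add_right: "ext_mult h (\<lambda>A. f A + g A) = (\<lambda>C. ext_mult h f C + ext_mult h g C)"
  by (simp add: ext_mult_def algebra_simps sum.distrib)

lemma ext_mult_zero: "ext_mult (\<lambda>A. 0) f = (\<lambda>A. 0)" "ext_mult f (\<lambda>A. 0) = (\<lambda>A. 0)"
  by (simp_all add: ext_mult_def)

subsection \<open>Multiplication and differentiation by generators\<close>

lemma homogeneous_gen: "homogeneous 1 (ext_gen a)"
  by (simp add: homogeneous_def ext_gen_def)

text \<open>The cost of moving \<open>a\<close> to its place in the monomial of C. Multiplication
  and differentiation by \<open>a\<close> carry the same sign, and this is what makes them
  adjoint.\<close>

definition gen_sign :: "'g::linorder \<Rightarrow> 'g set \<Rightarrow> complex" where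
  "gen_sign a C = (-1) ^ card {b \<in> C. b < a}"

lemma gen_sign_insert:
  assumes "finite {x \<in> C. x < b}" "a \<notin> C"
  shows "gen_sign b (insert a C) = (if a < b then - gen_sign b C else gen_sign b C)"
proof -
  have "{x \<in> insert a C. x < b} =
      (if a < b then insert a {x \<in> C. x < b} else {x \<in> C. x < b})"
    by auto
  then show ?thesis
    using assms by (simp add: gen_sign_def)
qed

lemma gen_sign_insert_self: "gen_sign a (insert a C) = gen_sign a C"
proof -
  have "{b \<in> insert a C. b < a} = {b \<in> C. b < a}" by auto
  then show ?thesis by (simp add: gen_sign_def)
qed

lemma gen_sign_remove_self: "gen_sign a (C - {a}) = gen_sign a C"
  by (metis gen_sign_insert_self insert_Diff_single)

lemma gen_sign_minimal:
  assumes "\<And>b. b \<in> C \<Longrightarrow> a < b" shows "gen_sign a C = 1"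
proof -
  have "{b \<in> C. b < a} = {}" using assms by force
  then show ?thesis unfolding gen_sign_def by (simp only: card.empty power_0)
qed

lemma gen_sign_square: "gen_sign a C * gen_sign a C = 1" "gen_sign a C * (gen_sign a C * x) = x"
  by (simp_all add: gen_sign_def flip: mult.assoc power_mult_distrib)

lemma gen_sign_neq_0: "gen_sign a C \<noteq> 0"
  by (simp add: gen_sign_def)

lemma cnj_gen_sign: "cnj (gen_sign a C) = gen_sign a C"
  by (simp add: gen_sign_def)

lemma ext_sign_singleton:
  assumes "a \<notin> B" shows "ext_sign {a} B = gen_sign a B"
proof -
  have "{(x, y). x \<in> {a} \<and> y \<in> B \<and> y < x} = Pair a ` {b \<in> B. b < a}" by auto
  moreover have "card (Pair a ` {b \<in> B. b < a}) = card {b \<in> B. b < a}"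
    by (intro card_image) (auto simp: inj_on_def)
  ultimately show ?thesis
    by (simp only: ext_sign_def gen_sign_def)
qed

lemma ext_gen_mult:
  "ext_mult (ext_gen a) f C = (if finite C \<and> a \<in> C then gen_sign a C * f (C - {a}) else 0)"
proof (cases "finite C")
  case True
  have "ext_mult (ext_gen a) f C =
      (\<Sum>A\<in>Pow C. if A = {a} then gen_sign a C * f (C - {a}) else 0)"
    unfolding ext_mult_def ext_gen_def
    by (intro sum.cong) (auto simp: ext_sign_singleton gen_sign_remove_self)
  then show ?thesis
    using True by simp
qed (simp add: ext_mult_infinite)

lemma ext_gen_mult_anticomm:
  "ext_mult (ext_gen a) (ext_mult (ext_gen b) f) C =
    - ext_mult (ext_gen b) (ext_mult (ext_gen a) f) C"
proof -
  have "ext_mult (ext_gen a) (ext_gen b) = (\<lambda>C. - ext_mult (ext_gen b) (ext_gen a) C)"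
    using ext_mult_anticomm[OF homogeneous_gen homogeneous_gen, of a b] by (rule ext)
  then show ?thesis
    by (simp add: ext_mult_minus_left flip: ext_mult_assoc)
qed

lemma ext_diff_gen_eq:
  "ext_diff_gen a f C = (if a \<in> C then 0 else gen_sign a C * f (insert a C))"
  by (simp add: ext_diff_gen_def gen_sign_def)

text \<open>Finiteness is asked only below \<open>a\<close> and \<open>b\<close>, where the signs
  look. In \<open>hop_commute\<close> the set C is arbitrary, yet only finitely many generators lie
  below a given \<open>Theta i\<close>.\<close>

lemma ext_diff_gen_anticomm:
  assumes "finite {x \<in> C. x < a}" "finite {x \<in> C. x < b}"
  shows "ext_diff_gen a (ext_diff_gen b f) C = - ext_diff_gen b (ext_diff_gen a f) C"
proof (cases "a \<in> C \<or> b \<in> C \<or> a = b")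
  case False
  then have "a < b \<and> \<not> b < a \<and> b \<noteq> a \<or> b < a \<and> \<not> a < b \<and> b \<noteq> a" by force
  then show ?thesis
    using False assms
    by (elim disjE) (simp_all add: ext_diff_gen_eq gen_sign_insert insert_commute)
qed (auto simp: ext_diff_gen_eq)

lemma ext_diff_gen_mult_anticomm:
  assumes "a \<noteq> b"
  shows "ext_diff_gen a (ext_mult (ext_gen b) f) C = - ext_mult (ext_gen b) (ext_diff_gen a f) C"
proof (cases "finite C \<and> a \<notin> C \<and> b \<in> C")
  case True
  define D where "D = C - {b}"
  have C: "C = insert b D" "insert a (insert b D) - {b} = insert a D" "insert b D - {b} = D"
    and D: "b \<notin> D" "finite D" "a \<notin> D" "a \<noteq> b" "b \<noteq> a"
    using True assms by (auto simp: D_def)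
  have "a < b \<and> \<not> b < a \<or> b < a \<and> \<not> a < b" using assms by force
  moreover have "gen_sign b (insert a C) = gen_sign b (insert a D)"
    by (metis C(1,2) gen_sign_remove_self)
  ultimately show ?thesis
    using D by (elim disjE) (simp_all add: ext_diff_gen_eq ext_gen_mult C gen_sign_insert
        gen_sign_insert_self True[unfolded C(1)])
next
  case False
  then show ?thesis
    using assms by (auto simp: ext_diff_gen_eq ext_gen_mult)
qed

lemma ext_mult_diff_gen:
  "ext_mult (ext_gen a) (ext_diff_gen a f) C = (if finite C \<and> a \<in> C then f C else 0)"
  by (simp add: ext_diff_gen_eq ext_gen_mult insert_absorb gen_sign_remove_self gen_sign_square)

lemma ext_diff_gen_mult:
  "ext_diff_gen a (ext_mult (ext_gen a) f) C = (if finite C \<and> a \<notin> C then f C else 0)"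
  by (simp add: ext_diff_gen_eq ext_gen_mult gen_sign_insert_self gen_sign_square)

lemma ext_diff_gen_eq_0_iff: "ext_diff_gen a f C = 0 \<longleftrightarrow> a \<in> C \<or> f (insert a C) = 0"
  by (simp add: ext_diff_gen_eq gen_sign_neq_0)

lemma ext_diff_gen_minus: "ext_diff_gen a (\<lambda>A. - f A) C = - ext_diff_gen a f C"
  by (simp add: ext_diff_gen_eq)

lemma ext_diff_gen_add: "ext_diff_gen a (\<lambda>A. f A + g A) C = ext_diff_gen a f C + ext_diff_gen a g C"
  by (simp add: ext_diff_gen_eq algebra_simps)

lemma ext_diff_gen_zero: "ext_diff_gen a (\<lambda>A. 0) = (\<lambda>A. 0)"
  by (auto simp: ext_diff_gen_eq)

lemma ext_diff_gen_sum:
  "ext_diff_gen a (\<lambda>A. \<Sum>i\<in>I. c i * f i A) C = (\<Sum>i\<in>I. c i * ext_diff_gen a (f i) C)"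
  by (simp add: ext_diff_gen_eq sum_distrib_left) (simp add: mult_ac)

definition ext_monom :: "'g set \<Rightarrow> 'g set \<Rightarrow> complex" where
  "ext_monom A = (\<lambda>C. if C = A then 1 else 0)"

lemma ext_one_eq_monom: "ext_one = ext_monom {}"
  by (simp add: ext_one_def ext_monom_def)

lemma ext_gen_mult_monom:
  assumes "finite A"
  shows "ext_mult (ext_gen a) (ext_monom A) =
    (if a \<in> A then (\<lambda>C. 0) else (\<lambda>C. gen_sign a A * ext_monom (insert a A) C))"
  using assms by (auto simp: ext_gen_mult ext_monom_def gen_sign_insert_self)

subsection \<open>The universal property of exterior algebras\<close>

text \<open>The value of \<open>ext_hom \<phi>\<close> on the monomial of A. Multiplicativity of
  \<open>ext_hom\<close> amounts to these products obeying the sign rule of monomials.\<close>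

definition ext_image :: "('g::linorder \<Rightarrow> 'h::linorder set \<Rightarrow> complex) \<Rightarrow> 'g set \<Rightarrow> 'h set \<Rightarrow> complex" where
  "ext_image \<phi> A = ext_prod (map \<phi> (sorted_list_of_set A))"

lemma ext_image_empty: "ext_image \<phi> {} = ext_one"
  by (simp add: ext_image_def ext_prod_def)

lemma ext_image_insert_less:
  assumes "finite A" "\<And>b. b \<in> A \<Longrightarrow> a < b"
  shows "ext_image \<phi> (insert a A) = ext_mult (\<phi> a) (ext_image \<phi> A)"
proof -
  have "a \<notin> A" using assms by auto
  moreover have "insort a (sorted_list_of_set A) = a # sorted_list_of_set A"
    using assms by (intro insort_is_Cons) (auto simp: less_imp_le)
  ultimately show ?thesis
    using assms by (simp add: ext_image_def ext_prod_def sorted_list_of_set_insert)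
qed

lemma ext_image_gen: "finite A \<Longrightarrow> ext_image ext_gen A = ext_monom A"
proof (induction A rule: finite_linorder_min_induct)
  case (insert a A)
  then show ?case
    by (auto simp: ext_image_insert_less ext_gen_mult_monom gen_sign_minimal)
qed (simp add: ext_image_empty ext_one_eq_monom)

text \<open>Linear forms anticommute, so \<open>\<phi> a\<close> can be sorted into its place.\<close>

lemma ext_mult_image_gen:
  assumes "finite B" "\<And>b. b \<in> insert a B \<Longrightarrow> homogeneous 1 (\<phi> b)"
  shows "ext_mult (\<phi> a) (ext_image \<phi> B) =
    (if a \<in> B then (\<lambda>C. 0) else (\<lambda>C. gen_sign a B * ext_image \<phi> (insert a B) C))"
  using assms
proof (induction B rule: finite_linorder_min_induct)
  case empty
  show ?case
    using ext_image_insert_less[of "{}" a \<phi>] gen_sign_minimal[of "{}" a] by simp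
next
  case (insert b B)
  have IH: "ext_mult (\<phi> a) (ext_image \<phi> B) =
      (if a \<in> B then (\<lambda>C. 0) else (\<lambda>C. gen_sign a B * ext_image \<phi> (insert a B) C))"
    by (rule insert.IH) (use insert.prems in auto)
  have eq: "ext_image \<phi> (insert b B) = ext_mult (\<phi> b) (ext_image \<phi> B)"
    using insert by (intro ext_image_insert_less) auto
  consider "a < b" | "a = b" | "b < a" by force
  then show ?case
  proof cases
    case 1
    then have "\<And>c. c \<in> insert b B \<Longrightarrow> a < c" using insert by force
    moreover from this have "a \<notin> insert b B" by force
    ultimately show ?thesis
      using insert ext_image_insert_less[of "insert b B" a \<phi>] gen_sign_minimal[of "insert b B" a]
      by simp
  next
    case 2
    have "ext_mult (\<phi> b) (\<phi> b) = (\<lambda>C. 0)"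
      using insert ext_mult_anticomm[of "\<phi> b" "\<phi> b"] by (auto simp: fun_eq_iff)
    then show ?thesis
      using 2 by (simp add: eq ext_mult_zero flip: ext_mult_assoc)
  next
    case 3
    have "ext_mult (\<phi> a) (\<phi> b) = (\<lambda>C. - ext_mult (\<phi> b) (\<phi> a) C)"
      using insert ext_mult_anticomm[of "\<phi> a" "\<phi> b"] by (auto simp: fun_eq_iff)
    then have "ext_mult (\<phi> a) (ext_image \<phi> (insert b B)) =
        (\<lambda>C. - ext_mult (\<phi> b) (ext_mult (\<phi> a) (ext_image \<phi> B)) C)"
      by (simp add: eq ext_mult_minus_left flip: ext_mult_assoc)
    also have "\<dots> = (if a \<in> insert b B then (\<lambda>C. 0)
        else (\<lambda>C. gen_sign a (insert b B) * ext_image \<phi> (insert a (insert b B)) C))"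
    proof (cases "a \<in> B")
      case True
      then show ?thesis
        using IH insert by (simp add: ext_mult_zero)
    next
      case False
      have "ext_image \<phi> (insert b (insert a B)) = ext_mult (\<phi> b) (ext_image \<phi> (insert a B))"
        using insert 3 by (intro ext_image_insert_less) auto
      moreover have "b \<notin> B" using insert by auto
      ultimately show ?thesis
        using IH insert 3 False
        by (auto simp: ext_mult_scale_right insert_commute gen_sign_insert)
    qed
    finally show ?thesis .
  qed
qed

lemma ext_mult_image:
  assumes "finite A" "finite B" "\<And>b. b \<in> A \<union> B \<Longrightarrow> homogeneous 1 (\<phi> b)"
  shows "ext_mult (ext_image \<phi> A) (ext_image \<phi> B) =
    (if A \<inter> B = {} then (\<lambda>C. ext_sign A B * ext_image \<phi> (A \<union> B) C) else (\<lambda>C. 0))"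
  using assms
proof (induction A rule: finite_linorder_min_induct)
  case empty
  \<comment> \<open>Needed for \<open>ext_one\<close> to act as a neutral element. A nonempty
    product inherits finite support from its outermost \<open>ext_mult\<close>, which vanishes on
    infinite sets.\<close>
  have "finite C" if "ext_image \<phi> B C \<noteq> 0" for C
  proof (cases "B = {}")
    case False
    then have "Min B \<in> B" "\<And>b. b \<in> B - {Min B} \<Longrightarrow> Min B < b"
      using empty by (auto simp: order.strict_iff_order)
    then have "ext_image \<phi> B = ext_mult (\<phi> (Min B)) (ext_image \<phi> (B - {Min B}))"
      using empty ext_image_insert_less[of "B - {Min B}" "Min B" \<phi>]
      by (simp add: insert_absorb)
    then show ?thesis
      using that by (metis ext_mult_infinite)
  qed (use that in \<open>simp add: ext_image_empty ext_one_def split: if_splits\<close>)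
  then show ?case
    by (simp add: ext_image_empty ext_sign_empty ext_one_mult)
next
  case (insert a A)
  have IH: "ext_mult (ext_image \<phi> A) (ext_image \<phi> B) =
    (if A \<inter> B = {} then (\<lambda>C. ext_sign A B * ext_image \<phi> (A \<union> B) C) else (\<lambda>C. 0))"
    using insert by auto
  have [simp]: "a \<notin> A" using insert by auto
  have eq: "ext_image \<phi> (insert a A) = ext_mult (\<phi> a) (ext_image \<phi> A)"
    using insert by (intro ext_image_insert_less) auto
  have eq2: "ext_mult (\<phi> a) (ext_image \<phi> (A \<union> B)) = (if a \<in> B then (\<lambda>C. 0) else
      (\<lambda>C. gen_sign a B * ext_image \<phi> (insert a (A \<union> B)) C))"
  proof -
    have "{b \<in> A \<union> B. b < a} = {b \<in> B. b < a}" using insert by force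
    then have "gen_sign a (A \<union> B) = gen_sign a B" by (simp add: gen_sign_def)
    then show ?thesis
      using insert by (subst ext_mult_image_gen) auto
  qed
  show ?case
  proof (cases "insert a A \<inter> B = {}")
    case True
    have "ext_sign {a} B = gen_sign a B"
      using True by (intro ext_sign_singleton) auto
    moreover have "ext_sign (insert a A) B = ext_sign {a} B * ext_sign A B"
      using insert ext_sign_Un_left[of "{a}" A B] by simp
    ultimately show ?thesis
      using True by (simp add: eq ext_mult_assoc IH eq2 ext_mult_scale_right mult_ac)
  next
    case False
    then show ?thesis
      by (auto simp: eq ext_mult_assoc IH eq2 ext_mult_scale_right ext_mult_zero)
  qed
qed

lemma ext_hom_eq:
  assumes "finite S" "f \<in> carrier (exterior S)"
  shows "ext_hom \<phi> f C = (\<Sum>A\<in>Pow S. f A * ext_image \<phi> A C)"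
  unfolding ext_hom_def ext_image_def using assms
  by (intro sum.mono_neutral_left) (auto simp: exterior_def)

lemma ext_sum_closed:
  assumes "\<And>i. i \<in> I \<Longrightarrow> f i \<in> carrier (exterior S)"
  shows "(\<lambda>A. \<Sum>i\<in>I. c i * f i A) \<in> carrier (exterior S)"
proof -
  have "(\<Sum>i\<in>I. c i * f i A) = 0" if "\<not> A \<subseteq> S" for A
    using assms that by (intro sum.neutral) (auto simp: exterior_def)
  then show ?thesis by (auto simp: exterior_def)
qed

lemma ext_hom_sum:
  assumes "finite S" "\<And>i. i \<in> I \<Longrightarrow> f i \<in> carrier (exterior S)"
  shows "ext_hom \<phi> (\<lambda>A. \<Sum>i\<in>I. c i * f i A) = (\<lambda>C. \<Sum>i\<in>I. c i * ext_hom \<phi> (f i) C)"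
proof
  fix C
  have "(\<lambda>A. \<Sum>i\<in>I. c i * f i A) \<in> carrier (exterior S)"
    using assms by (intro ext_sum_closed)
  then have "ext_hom \<phi> (\<lambda>A. \<Sum>i\<in>I. c i * f i A) C =
      (\<Sum>A\<in>Pow S. \<Sum>i\<in>I. c i * (f i A * ext_image \<phi> A C))"
    using assms by (simp add: ext_hom_eq sum_distrib_left mult_ac)
  also have "\<dots> = (\<Sum>i\<in>I. c i * ext_hom \<phi> (f i) C)"
    using assms by (subst sum.swap) (simp add: ext_hom_eq sum_distrib_left)
  finally show "ext_hom \<phi> (\<lambda>A. \<Sum>i\<in>I. c i * f i A) C = (\<Sum>i\<in>I. c i * ext_hom \<phi> (f i) C)" .
qed

lemma ext_hom_monom: "finite A \<Longrightarrow> ext_hom \<phi> (ext_monom A) = ext_image \<phi> A"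
  by (simp add: ext_hom_def ext_monom_def ext_image_def)

lemma ext_image_singleton:
  assumes "homogeneous 1 (\<phi> a)" shows "ext_image \<phi> {a} = \<phi> a"
proof -
  have "finite A" if "\<phi> a A \<noteq> 0" for A
    using assms that by (metis card.infinite homogeneous_def zero_neq_one)
  then show ?thesis
    by (simp add: ext_image_insert_less[of "{}", simplified] ext_image_empty ext_mult_one)
qed

lemma ext_gen_eq_monom: "ext_gen a = ext_monom {a}"
  by (simp add: ext_gen_def ext_monom_def)

lemma ext_hom_gen: "homogeneous 1 (\<phi> a) \<Longrightarrow> ext_hom \<phi> (ext_gen a) = \<phi> a"
  by (simp add: ext_gen_eq_monom ext_hom_monom ext_image_singleton)

lemma ext_hom_mult:
  assumes "finite S" "f \<in> carrier (exterior S)" "g \<in> carrier (exterior S)"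
    and "\<And>a. a \<in> S \<Longrightarrow> homogeneous 1 (\<phi> a)"
  shows "ext_hom \<phi> (ext_mult f g) = ext_mult (ext_hom \<phi> f) (ext_hom \<phi> g)"
proof
  fix C
  interpret ring "exterior S" using assms(1) by (rule ring_exterior)
  have fin: "finite A" if "A \<subseteq> S" for A using that assms finite_subset by blast
  have eq: "ext_hom \<phi> h = (\<lambda>C. \<Sum>A\<in>Pow S. h A * ext_image \<phi> A C)"
    if "h \<in> carrier (exterior S)" for h
    using that assms ext_hom_eq by blast
  have "ext_mult (ext_hom \<phi> f) (ext_hom \<phi> g) C =
      (\<Sum>A\<in>Pow S. \<Sum>B\<in>Pow S. f A * (g B * ext_mult (ext_image \<phi> A) (ext_image \<phi> B) C))"
    using assms by (simp add: eq ext_mult_sum_left ext_mult_sum_right sum_distrib_left)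
  also have "\<dots> = (\<Sum>A\<in>Pow S. \<Sum>B\<in>Pow S.
      if A \<inter> B = {} then f A * g B * ext_sign A B * ext_image \<phi> (A \<union> B) C else 0)"
    using assms fin by (intro sum.cong refl) (subst ext_mult_image, auto)
  also have "\<dots> = (\<Sum>(A, B)\<in>{(A, B). A \<subseteq> S \<and> B \<subseteq> S \<and> A \<inter> B = {}}.
      f A * g B * ext_sign A B * ext_image \<phi> (A \<union> B) C)"
    using assms(1) by (subst sum.cartesian_product) (rule sum.mono_neutral_cong_right, auto split: if_splits)
  \<comment> \<open>Disjoint pairs (A, B) are recorded by their union D together with the part A of
    D; the inner sum is then the product in \<open>ext_mult\<close>.\<close>
  also have "\<dots> = (\<Sum>(D, A)\<in>Sigma (Pow S) Pow.
      f A * g (D - A) * ext_sign A (D - A) * ext_image \<phi> D C)"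
    by (rule sum.reindex_bij_witness[where i = "\<lambda>(D, A). (A, D - A)" and j = "\<lambda>(A, B). (A \<union> B, A)"])
      (auto simp: Un_Diff Diff_triv Int_commute)
  also have "\<dots> = (\<Sum>D\<in>Pow S. ext_mult f g D * ext_image \<phi> D C)"
    using assms(1) fin by (subst sum.Sigma[symmetric])
      (auto simp: ext_mult_def sum_distrib_left mult_ac)
  also have "\<dots> = ext_hom \<phi> (ext_mult f g) C"
    using assms m_closed[of f g] by (subst ext_hom_eq[of S]) (auto simp: exterior_def)
  finally show "ext_hom \<phi> (ext_mult f g) C = ext_mult (ext_hom \<phi> f) (ext_hom \<phi> g) C" ..
qed

subsection \<open>The Lefschetz operator and its adjoint\<close>

definition red_gens :: "nat \<Rightarrow> gen set" where
  "red_gens n = Theta ` {1..<n} \<union> Xi' ` {1..<n}"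

lemma finite_red_gens: "finite (red_gens n)"
  by (simp add: red_gens_def)

lemma ext_red_eq: "ext_red n = exterior (red_gens n)"
  by (simp add: ext_red_def red_gens_def)

lemma mem_carrier_exterior: "f \<in> carrier (exterior S) \<longleftrightarrow> (\<forall>A. f A \<noteq> 0 \<longrightarrow> A \<subseteq> S)"
  by (simp add: exterior_def)

definition lefschetz :: "nat \<Rightarrow> ext \<Rightarrow> ext" where
  "lefschetz n f = (\<lambda>C. \<Sum>i\<in>{1..<n}. ext_mult (\<theta> i) (ext_mult (\<xi>' i) f) C)"

text \<open>The derivatives come in the order that adjointness dictates: \<open>lefschetz\<close>
  multiplies by \<open>\<theta>\<^sub>i\<close> last, so the adjoint differentiates by it
  first.\<close>

definition colefschetz :: "nat \<Rightarrow> ext \<Rightarrow> ext" where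
  "colefschetz n f = (\<lambda>C. \<Sum>i\<in>{1..<n}. ext_diff_gen (Xi' i) (ext_diff_gen (Theta i) f) C)"

definition ext_inner :: "'g set \<Rightarrow> ('g set \<Rightarrow> complex) \<Rightarrow> ('g set \<Rightarrow> complex) \<Rightarrow> complex" where
  "ext_inner S f g = (\<Sum>A\<in>Pow S. f A * cnj (g A))"

lemma ext_inner_sum_left: "ext_inner S (\<lambda>A. \<Sum>i\<in>I. c i * f i A) g = (\<Sum>i\<in>I. c i * ext_inner S (f i) g)"
  unfolding ext_inner_def sum_distrib_left sum_distrib_right
  by (subst sum.swap) (simp add: mult_ac)

lemma ext_inner_self: "ext_inner S f f = of_real (\<Sum>A\<in>Pow S. (cmod (f A))\<^sup>2)"
  by (simp add: ext_inner_def complex_norm_square del: of_real_power)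

lemma ext_inner_self_eq_0D:
  assumes "finite S" "ext_inner S f f = 0" "A \<subseteq> S"
  shows "f A = 0"
proof -
  have "(\<Sum>A\<in>Pow S. (cmod (f A))\<^sup>2) = 0"
    using assms(2) by (simp only: ext_inner_self of_real_eq_0_iff)
  then show ?thesis
    using assms by (subst (asm) sum_nonneg_eq_0_iff) auto
qed

lemma ext_inner_cnj: "ext_inner S g f = cnj (ext_inner S f g)"
  by (simp add: ext_inner_def mult.commute)

lemma ext_inner_gen_mult:
  assumes "finite S" "a \<in> S"
  shows "ext_inner S (ext_mult (ext_gen a) f) g = ext_inner S f (ext_diff_gen a g)"
proof -
  have fin: "finite A" if "A \<subseteq> S" for A using that assms finite_subset by blast
  have "ext_inner S (ext_mult (ext_gen a) f) g =
      (\<Sum>A\<in>{A. A \<subseteq> S \<and> a \<in> A}. gen_sign a A * f (A - {a}) * cnj (g A))"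
    unfolding ext_inner_def using assms fin
    by (intro sum.mono_neutral_cong_right) (auto simp: ext_gen_mult)
  also have "\<dots> = (\<Sum>A\<in>{A. A \<subseteq> S \<and> a \<notin> A}. gen_sign a A * f A * cnj (g (insert a A)))"
    by (rule sum.reindex_bij_witness[where i = "insert a" and j = "\<lambda>A. A - {a}"])
      (use assms in \<open>auto simp: gen_sign_remove_self insert_absorb\<close>)
  also have "\<dots> = ext_inner S f (ext_diff_gen a g)"
    unfolding ext_inner_def using assms
    by (intro sum.mono_neutral_cong_left) (auto simp: ext_diff_gen_eq cnj_gen_sign)
  finally show ?thesis .
qed

lemma ext_inner_lefschetz:
  "ext_inner (red_gens n) (lefschetz n f) g = ext_inner (red_gens n) f (colefschetz n g)"
proof -
  have "ext_inner (red_gens n) (lefschetz n f) g =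
      (\<Sum>i\<in>{1..<n}. ext_inner (red_gens n) (ext_mult (\<theta> i) (ext_mult (\<xi>' i) f)) g)"
    using ext_inner_sum_left[of "red_gens n" "\<lambda>_. 1"] by (simp add: lefschetz_def)
  also have "\<dots> = (\<Sum>i\<in>{1..<n}. ext_inner (red_gens n) f (ext_diff_gen (Xi' i) (ext_diff_gen (Theta i) g)))"
    by (intro sum.cong refl) (auto simp: ext_inner_gen_mult finite_red_gens, auto simp: red_gens_def ext_inner_gen_mult)
  also have "\<dots> = ext_inner (red_gens n) f (colefschetz n g)"
    unfolding ext_inner_def colefschetz_def
    by (subst sum.swap) (simp add: sum_distrib_left)
  finally show ?thesis .
qed

text \<open>\<^const>\<open>lefschetz\<close> and \<^const>\<open>colefschetz\<close> are adjoint, so kernel and image are orthogonal.\<close>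

lemma lefschetz_kernel_disjoint:
  assumes "colefschetz n (lefschetz n u) = (\<lambda>C. 0)" "C \<subseteq> red_gens n"
  shows "lefschetz n u C = 0"
proof -
  have "ext_inner (red_gens n) (lefschetz n u) (lefschetz n u) = 0"
    by (simp add: ext_inner_lefschetz assms(1)) (simp add: ext_inner_def)
  then show ?thesis
    using ext_inner_self_eq_0D[OF finite_red_gens] assms(2) by blast
qed

text \<open>Orthogonal projection onto the span of a possibly dependent finite family. For a new
  vector \<open>w k\<close>, both it and f are first projected away from the old span; then the
  component of one residue along the other is removed.\<close>

lemma gram_schmidt:
  fixes w :: "'i \<Rightarrow> 'x \<Rightarrow> complex"
  assumes "finite X" "finite I"
  shows "\<exists>c. \<forall>j\<in>I. (\<Sum>x\<in>X. (f x - (\<Sum>i\<in>I. c i * w i x)) * cnj (w j x)) = 0"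
  using assms(2)
proof (induction I arbitrary: f rule: finite_induct)
  case (insert k I)
  define ip where "ip f g = (\<Sum>x\<in>X. f x * cnj (g x))" for f g :: "'x \<Rightarrow> complex"
  have ip_diff: "ip (\<lambda>x. f x - g x) h = ip f h - ip g h" for f g h
    by (simp add: ip_def left_diff_distrib sum_subtractf)
  have ip_scale: "ip (\<lambda>x. c * f x) h = c * ip f h" for c f h
    by (simp add: ip_def sum_distrib_left mult_ac)
  have ip_cnj: "ip f g = cnj (ip g f)" for f g
    by (simp add: ip_def mult.commute)
  have ip_diff_sum: "ip h (\<lambda>x. f x - (\<Sum>i\<in>I. c i * w i x)) = ip h f"
    if "\<forall>i\<in>I. ip h (w i) = 0" for h f c
  proof -
    have "ip h (\<lambda>x. f x - (\<Sum>i\<in>I. c i * w i x)) = ip h f - (\<Sum>i\<in>I. cnj (c i) * ip h (w i))"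
      unfolding ip_def sum_distrib_left
      by (subst sum.swap) (simp add: right_diff_distrib sum_subtractf sum_distrib_left mult_ac)
    then show ?thesis using that by simp
  qed
  obtain b where b: "\<forall>j\<in>I. ip (\<lambda>x. w k x - (\<Sum>i\<in>I. b i * w i x)) (w j) = 0"
    using insert.IH[of "w k"] unfolding ip_def by blast
  obtain c where c: "\<forall>j\<in>I. ip (\<lambda>x. f x - (\<Sum>i\<in>I. c i * w i x)) (w j) = 0"
    using insert.IH[of f] unfolding ip_def by blast
  define w' where "w' = (\<lambda>x. w k x - (\<Sum>i\<in>I. b i * w i x))"
  define f' where "f' = (\<lambda>x. f x - (\<Sum>i\<in>I. c i * w i x))"
  \<comment> \<open>If \<open>w k\<close> lies in the old span, the residue w' vanishes on X and the
    division yields 0, so the equation that defines the coefficient still holds.\<close>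
  define a where "a = ip f' w' / ip w' w'"
  have a: "ip f' w' = a * ip w' w'"
  proof (cases "ip w' w' = 0")
    case True
    have "ip w' w' = of_real (\<Sum>x\<in>X. (cmod (w' x))\<^sup>2)"
      by (simp add: ip_def complex_norm_square del: of_real_power)
    then have "(\<Sum>x\<in>X. (cmod (w' x))\<^sup>2) = 0"
      using True by (metis of_real_eq_0_iff)
    then have "\<forall>x\<in>X. w' x = 0"
      using assms(1) by (subst (asm) sum_nonneg_eq_0_iff) auto
    then show ?thesis by (simp add: ip_def)
  qed (simp add: a_def)
  define r where "r = (\<lambda>x. f' x - a * w' x)"
  have r_eq: "r = (\<lambda>x. f x - (\<Sum>i\<in>insert k I. (if i = k then a else c i - a * b i) * w i x))"
  proof
    fix x
    have "(\<Sum>i\<in>I. (if i = k then a else c i - a * b i) * w i x) = (\<Sum>i\<in>I. (c i - a * b i) * w i x)"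
      using insert.hyps by (intro sum.cong) auto
    then show "r x = f x - (\<Sum>i\<in>insert k I. (if i = k then a else c i - a * b i) * w i x)"
      using insert.hyps
      by (simp add: r_def f'_def w'_def algebra_simps sum_subtractf sum_distrib_left)
  qed
  have r_I: "\<forall>j\<in>I. ip r (w j) = 0"
    using b c by (simp add: r_def ip_diff ip_scale flip: w'_def f'_def)
  have "ip r w' = 0"
    by (simp add: r_def ip_diff ip_scale a)
  \<comment> \<open>r is already orthogonal to the old family, hence cannot distinguish w' from
    \<open>w k\<close>.\<close>
  moreover have "ip r w' = ip r (w k)"
    unfolding w'_def using ip_diff_sum[OF r_I] by blast
  ultimately have "\<forall>j\<in>insert k I. ip r (w j) = 0"
    using r_I by simp
  then show ?case
    unfolding ip_def r_eq by (rule exI[of _ "\<lambda>i. if i = k then a else c i - a * b i"])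
qed simp

lemma diff_gens_eq_0_outside:
  assumes "f \<in> carrier (exterior S)" "\<not> C \<subseteq> S"
  shows "ext_diff_gen a (ext_diff_gen b f) C = 0"
proof -
  have "f (insert b (insert a C)) = 0"
    using assms by (auto simp: mem_carrier_exterior)
  then show ?thesis by (simp add: ext_diff_gen_eq)
qed

lemma colefschetz_eq_0_outside:
  assumes "f \<in> carrier (exterior S)" "\<not> C \<subseteq> S"
  shows "colefschetz n f C = 0"
  using diff_gens_eq_0_outside[OF assms] by (simp add: colefschetz_def)

lemma lefschetz_sum:
  "lefschetz n (\<lambda>A. \<Sum>i\<in>I. c i * f i A) C = (\<Sum>i\<in>I. c i * lefschetz n (f i) C)"
proof -
  have "ext_mult (\<xi>' k) (\<lambda>A. \<Sum>i\<in>I. c i * f i A) = (\<lambda>C. \<Sum>i\<in>I. c i * ext_mult (\<xi>' k) (f i) C)" for k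
    using ext_mult_sum_right by (rule ext)
  then have "lefschetz n (\<lambda>A. \<Sum>i\<in>I. c i * f i A) C =
      (\<Sum>k\<in>{1..<n}. \<Sum>i\<in>I. c i * ext_mult (\<theta> k) (ext_mult (\<xi>' k) (f i)) C)"
    by (simp add: lefschetz_def ext_mult_sum_right)
  then show ?thesis
    by (subst (asm) sum.swap) (simp add: lefschetz_def sum_distrib_left)
qed

lemma colefschetz_sum:
  "colefschetz n (\<lambda>A. \<Sum>i\<in>I. c i * f i A) C = (\<Sum>i\<in>I. c i * colefschetz n (f i) C)"
proof -
  have "ext_diff_gen a (\<lambda>A. \<Sum>i\<in>I. c i * f i A) = (\<lambda>C. \<Sum>i\<in>I. c i * ext_diff_gen a (f i) C)" for a
    using ext_diff_gen_sum by (rule ext)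
  then have "colefschetz n (\<lambda>A. \<Sum>i\<in>I. c i * f i A) C =
      (\<Sum>k\<in>{1..<n}. \<Sum>i\<in>I. c i * ext_diff_gen (Xi' k) (ext_diff_gen (Theta k) (f i)) C)"
    by (simp add: colefschetz_def ext_diff_gen_sum)
  then show ?thesis
    by (subst (asm) sum.swap) (simp add: colefschetz_def sum_distrib_left)
qed

lemma ext_mult_closed:
  assumes "finite S" "f \<in> carrier (exterior S)" "g \<in> carrier (exterior S)"
  shows "ext_mult f g \<in> carrier (exterior S)"
proof -
  interpret ring "exterior S" using assms(1) by (rule ring_exterior)
  show ?thesis using m_closed[OF assms(2,3)] by (simp add: exterior_def)
qed

lemma ext_gen_closed: "a \<in> S \<Longrightarrow> ext_gen a \<in> carrier (exterior S)"
  by (simp add: exterior_def ext_gen_def)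

lemma lefschetz_closed:
  assumes "f \<in> carrier (ext_red n)"
  shows "lefschetz n f \<in> carrier (ext_red n)"
proof -
  have "ext_mult (\<theta> i) (ext_mult (\<xi>' i) f) \<in> carrier (ext_red n)" if "i \<in> {1..<n}" for i
    using that assms unfolding ext_red_eq
    by (intro ext_mult_closed finite_red_gens ext_gen_closed) (auto simp: red_gens_def)
  then show ?thesis
    using ext_sum_closed[of "{1..<n}" "\<lambda>i. ext_mult (\<theta> i) (ext_mult (\<xi>' i) f)" "red_gens n" "\<lambda>_. 1"]
    by (simp add: lefschetz_def ext_red_eq)
qed

text \<open>f is projected onto the span of the images of all monomials. Orthogonality of the
  remainder v to these images says, by adjointness, that every coefficient of
  \<open>colefschetz n v\<close> is 0.\<close>

lemma lefschetz_decomposition: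
  assumes "f \<in> carrier (ext_red n)"
  obtains u where "u \<in> carrier (ext_red n)"
    "colefschetz n (\<lambda>C. f C - lefschetz n u C) = (\<lambda>C. 0)"
proof -
  let ?S = "red_gens n"
  have fin: "finite (Pow ?S)" by (simp add: finite_red_gens)
  obtain c where c: "\<forall>B\<in>Pow ?S. (\<Sum>A\<in>Pow ?S.
      (f A - (\<Sum>D\<in>Pow ?S. c D * lefschetz n (ext_monom D) A)) * cnj (lefschetz n (ext_monom B) A)) = 0"
    using gram_schmidt[OF fin fin, of f "\<lambda>D. lefschetz n (ext_monom D)"] by blast
  define u :: ext where "u = (\<lambda>A. \<Sum>D\<in>Pow ?S. c D * ext_monom D A)"
  define v where "v = (\<lambda>C. f C - lefschetz n u C)"
  have u: "u \<in> carrier (ext_red n)"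
    unfolding u_def ext_red_eq by (rule ext_sum_closed) (auto simp: exterior_def ext_monom_def)
  have v: "v \<in> carrier (exterior ?S)"
    using assms lefschetz_closed[OF u] unfolding v_def ext_red_eq
    by (auto simp: mem_carrier_exterior) (metis diff_self in_mono)
  have "colefschetz n v B = 0" if "B \<subseteq> ?S" for B
  proof -
    have "ext_inner ?S v (lefschetz n (ext_monom B)) = 0"
      using c that unfolding ext_inner_def v_def u_def lefschetz_sum by blast
    then have "ext_inner ?S (ext_monom B) (colefschetz n v) = 0"
      by (metis ext_inner_cnj complex_cnj_zero ext_inner_lefschetz)
    moreover have "ext_inner ?S (ext_monom B) (colefschetz n v) =
        (\<Sum>A\<in>Pow ?S. if A = B then cnj (colefschetz n v B) else 0)"
      unfolding ext_inner_def ext_monom_def by (intro sum.cong) auto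
    ultimately show ?thesis
      using that finite_red_gens by (simp split: if_splits)
  qed
  then have "colefschetz n v = (\<lambda>C. 0)"
    using colefschetz_eq_0_outside[OF v] by blast
  then show ?thesis
    using that u unfolding v_def by blast
qed

subsection \<open>The kernel of the adjoint is determined by ballot monomials\<close>

text \<open>The \<open>sl_2\<close> relation index by index: operators of even degree for distinct
  indices commute, and for a common index the commutator is diagonal on monomials, with weight 1, 0
  or -1 according as none, one or both generators of that index occur.\<close>

lemma diff_mult_commute:
  assumes "finite C"
  shows "ext_diff_gen (Xi' i) (ext_diff_gen (Theta i) (ext_mult (\<theta> k) (ext_mult (\<xi>' k) f))) C =
    ext_mult (\<theta> k) (ext_mult (\<xi>' k) (ext_diff_gen (Xi' i) (ext_diff_gen (Theta i) f))) C
    + (if i = k then (1 - (if Theta i \<in> C then 1 else 0) - (if Xi' i \<in> C then 1 else 0)) * f C else 0)"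
proof (cases "i = k")
  case False
  have anti: "ext_diff_gen a (ext_mult (ext_gen b) g) = (\<lambda>C. - ext_mult (ext_gen b) (ext_diff_gen a g) C)"
    if "a \<noteq> b" for a b and g :: ext
    using ext_diff_gen_mult_anticomm[OF that] by (rule ext)
  have 1: "ext_diff_gen a (ext_mult (\<theta> k) (ext_mult (\<xi>' k) g)) =
      ext_mult (\<theta> k) (ext_mult (\<xi>' k) (ext_diff_gen a g))"
    if "a \<noteq> Theta k" "a \<noteq> Xi' k" for a and g :: ext
    unfolding anti[OF that(1)] anti[OF that(2)] ext_mult_minus_right by simp
  show ?thesis
    using False by (simp add: 1)
next
  case True
  have le: "Theta k < Xi' k" "\<not> Xi' k < Theta k" by (simp_all add: less_gen_def)
  have "ext_diff_gen (Xi' k) (ext_diff_gen (Theta k) (ext_mult (\<theta> k) (ext_mult (\<xi>' k) f))) C =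
      (if Theta k \<notin> C \<and> Xi' k \<notin> C then f C else 0)"
    using assms by (simp add: ext_diff_gen_eq ext_gen_mult gen_sign_insert le gen_sign_insert_self
        gen_sign_square insert_commute[of "Theta k"]) (auto simp: insert_Diff_if gen_sign_insert_self gen_sign_square)
  moreover have "ext_mult (\<theta> k) (ext_mult (\<xi>' k) (ext_diff_gen (Xi' k) (ext_diff_gen (Theta k) f))) C =
      (if Theta k \<in> C \<and> Xi' k \<in> C then f C else 0)"
    using assms by (simp add: ext_gen_mult[of "Theta k"] ext_mult_diff_gen)
      (simp add: ext_diff_gen_eq insert_absorb gen_sign_remove_self gen_sign_square)
  ultimately show ?thesis
    using True by simp
qed

lemma card_red_gens:
  assumes "C \<subseteq> red_gens n"
  shows "(\<Sum>i\<in>{1..<n}. 1 - (if Theta i \<in> C then 1 else 0) - (if Xi' i \<in> C then 1 else 0)) =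
    (of_nat (n - 1) - of_nat (card C) :: complex)"
proof -
  have "C = Theta ` {i \<in> {1..<n}. Theta i \<in> C} \<union> Xi' ` {i \<in> {1..<n}. Xi' i \<in> C}" (is "C = ?A \<union> ?B")
    using assms by (auto simp: red_gens_def)
  then have "card C = card (?A \<union> ?B)" by (rule arg_cong)
  also have "\<dots> = card ?A + card ?B"
    by (rule card_Un_disjoint) auto
  also have "card ?A = card {i \<in> {1..<n}. Theta i \<in> C}"
    by (auto intro!: card_image simp: inj_on_def)
  also have "card ?B = card {i \<in> {1..<n}. Xi' i \<in> C}"
    by (auto intro!: card_image simp: inj_on_def)
  finally show ?thesis
    by (simp add: sum_subtractf sum.If_cases Int_def)
qed

lemma colefschetz_lefschetz:
  assumes "C \<subseteq> red_gens n"
  shows "colefschetz n (lefschetz n f) C =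
    lefschetz n (colefschetz n f) C + (of_nat (n - 1) - of_nat (card C)) * f C"
proof -
  have fin: "finite C" using assms finite_red_gens finite_subset by blast
  have 1: "ext_diff_gen a (ext_diff_gen b (lefschetz n f)) C =
      (\<Sum>k\<in>{1..<n}. ext_diff_gen a (ext_diff_gen b (ext_mult (\<theta> k) (ext_mult (\<xi>' k) f))) C)" for a b
    by (simp add: ext_diff_gen_eq lefschetz_def sum_distrib_left)
  have 2: "ext_mult (ext_gen a) (ext_mult (ext_gen b) (colefschetz n f)) C =
      (\<Sum>i\<in>{1..<n}. ext_mult (ext_gen a) (ext_mult (ext_gen b)
        (ext_diff_gen (Xi' i) (ext_diff_gen (Theta i) f))) C)" for a b
  proof -
    have "ext_mult (ext_gen b) (colefschetz n f) = (\<lambda>C. \<Sum>i\<in>{1..<n}. 1 * ext_mult (ext_gen b)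
        (ext_diff_gen (Xi' i) (ext_diff_gen (Theta i) f)) C)"
      unfolding colefschetz_def
      using ext_mult_sum_right[where c = "\<lambda>_. 1"] by (intro ext) simp
    then show ?thesis
      by (simp only: ext_mult_sum_right) simp
  qed
  have "colefschetz n (lefschetz n f) C = (\<Sum>i\<in>{1..<n}. \<Sum>k\<in>{1..<n}.
      ext_mult (\<theta> k) (ext_mult (\<xi>' k) (ext_diff_gen (Xi' i) (ext_diff_gen (Theta i) f))) C
    + (if i = k then (1 - (if Theta i \<in> C then 1 else 0) - (if Xi' i \<in> C then 1 else 0)) * f C else 0))"
    unfolding colefschetz_def 1 by (simp add: diff_mult_commute[OF fin])
  also have "\<dots> = lefschetz n (colefschetz n f) C + (\<Sum>i\<in>{1..<n}.
      (1 - (if Theta i \<in> C then 1 else 0) - (if Xi' i \<in> C then 1 else 0)) * f C)"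
    unfolding sum.distrib lefschetz_def 2 by (subst sum.swap) simp
  finally show ?thesis
    unfolding card_red_gens[OF assms, symmetric] by (simp add: sum_distrib_right)
qed

text \<open>Pairing the \<open>sl_2\<close> relation with v expresses the squared norm of
  \<open>lefschetz n v\<close> as n-1-d times that of v. The factor is at most -1, so both norms are
  0.\<close>

lemma colefschetz_inj_high_degree:
  assumes "v \<in> carrier (ext_red n)" "homogeneous d v" "colefschetz n v = (\<lambda>C. 0)" "n \<ge> 1" "d \<ge> n"
  shows "v = (\<lambda>C. 0)"
proof -
  let ?S = "red_gens n"
  have "lefschetz n (\<lambda>C. 0) = (\<lambda>C. 0)"
    by (simp add: lefschetz_def ext_mult_zero)
  then have "colefschetz n (lefschetz n v) C = (of_nat (n - 1) - of_nat d) * v C" if "C \<subseteq> ?S" for C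
    using colefschetz_lefschetz[OF that, of v] assms(2,3) by (auto simp: homogeneous_def)
  then have "ext_inner ?S v (colefschetz n (lefschetz n v)) = (of_nat (n - 1) - of_nat d) * ext_inner ?S v v"
    unfolding ext_inner_def sum_distrib_left by (intro sum.cong) auto
  then have *: "ext_inner ?S (lefschetz n v) (lefschetz n v) = (of_nat (n - 1) - of_nat d) * ext_inner ?S v v"
    by (simp add: ext_inner_lefschetz)
  define N where "N f = (\<Sum>A\<in>Pow ?S. (cmod (f A))\<^sup>2)" for f
  have "of_real (N (lefschetz n v)) = (of_real ((real (n - 1) - real d) * N v) :: complex)"
    using * by (simp add: ext_inner_self N_def)
  then have "N (lefschetz n v) = (real (n - 1) - real d) * N v"
    by (simp only: of_real_eq_iff)
  moreover have "N f \<ge> 0" for f by (simp add: N_def sum_nonneg)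
  moreover have "real (n - 1) - real d \<le> -1" using assms by linarith
  ultimately have "N v = 0"
    by (smt (verit) mult_le_cancel_right1 mult_minus_left)
  then have "ext_inner ?S v v = 0" by (simp add: ext_inner_self N_def)
  then have "v C = 0" if "C \<subseteq> ?S" for C
    using ext_inner_self_eq_0D[OF finite_red_gens] that by blast
  then show ?thesis
    using assms(1) unfolding ext_red_eq by (auto simp: mem_carrier_exterior)
qed

text \<open>For sets of reduced generators: let index i be a step 1, 0 or -1 according as none, one
  or both of its generators occur. The condition says that the partial sums of these steps never
  become negative.\<close>

definition ballot :: "gen set \<Rightarrow> bool" where
  "ballot C \<longleftrightarrow> (\<forall>k. card {g \<in> C. gen_index g \<le> k} \<le> k)"

lemma red_gens_Suc: "n \<ge> 1 \<Longrightarrow> red_gens (Suc n) = insert (Theta n) (insert (Xi' n) (red_gens n))"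
  by (auto simp: red_gens_def less_Suc_eq)

lemma red_gens_index: "g \<in> red_gens n \<Longrightarrow> gen_index g < n"
  by (auto simp: red_gens_def)

lemma colefschetz_Suc:
  "n \<ge> 1 \<Longrightarrow> colefschetz (Suc n) f C = colefschetz n f C + ext_diff_gen (Xi' n) (ext_diff_gen (Theta n) f) C"
  by (simp add: colefschetz_def)

lemma ext_diff_gen_cong: "f (insert a C) = g (insert a C) \<Longrightarrow> ext_diff_gen a f C = ext_diff_gen a g C"
  by (simp add: ext_diff_gen_eq)

lemma colefschetz_ext_diff_gen:
  assumes "finite C"
  shows "colefschetz n (ext_diff_gen a f) C = ext_diff_gen a (colefschetz n f) C"
proof -
  have anti: "ext_diff_gen x (ext_diff_gen y g) D = - ext_diff_gen y (ext_diff_gen x g) D"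
    if "finite D" for x y D and g :: ext
    using that by (intro ext_diff_gen_anticomm) auto
  have "ext_diff_gen (Xi' i) (ext_diff_gen (Theta i) (ext_diff_gen a f)) C =
      ext_diff_gen a (ext_diff_gen (Xi' i) (ext_diff_gen (Theta i) f)) C" for i
  proof -
    have "ext_diff_gen (Xi' i) (ext_diff_gen (Theta i) (ext_diff_gen a f)) C =
        ext_diff_gen (Xi' i) (\<lambda>A. - ext_diff_gen a (ext_diff_gen (Theta i) f) A) C"
      using assms by (intro ext_diff_gen_cong anti) simp
    then show ?thesis
      using anti[OF assms, of "Xi' i" a] by (simp add: ext_diff_gen_minus)
  qed
  then show ?thesis
    by (simp add: colefschetz_def) (simp add: ext_diff_gen_eq sum_distrib_left)
qed

text \<open>Generators of index n affect only the counts for k at least n, and those are bounded by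
  the total degree.\<close>

lemma ballot_insert:
  assumes "C \<subseteq> red_gens n" "ballot C" "\<And>g. g \<in> D \<Longrightarrow> gen_index g = n" "card (C \<union> D) \<le> n" "finite (C \<union> D)"
  shows "ballot (C \<union> D)"
  unfolding ballot_def
proof
  fix k
  show "card {g \<in> C \<union> D. gen_index g \<le> k} \<le> k"
  proof (cases "k < n")
    case True
    then have "{g \<in> C \<union> D. gen_index g \<le> k} = {g \<in> C. gen_index g \<le> k}"
      using assms(3) by force
    then show ?thesis using assms(2) by (simp add: ballot_def)
  next
    case False
    have "card {g \<in> C \<union> D. gen_index g \<le> k} \<le> card (C \<union> D)"
      using assms(5) by (intro card_mono) auto
    then show ?thesis using assms(4) False by linarith
  qed
qed

lemma ballot_card:
  assumes "C \<subseteq> red_gens n" "ballot C"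
  shows "card C \<le> n - 1"
proof -
  have "{g \<in> C. gen_index g \<le> n - 1} = C"
    using assms(1) red_gens_index by fastforce
  then show ?thesis using assms(2) unfolding ballot_def by metis
qed

text \<open>
  With \<open>\<theta>, \<xi>'\<close> the two generators of index \<open>n\<close>, the induction is applied first to the second
  derivative of \<open>v\<close> by both of them, then to the two first derivatives, and finally to \<open>v\<close> itself.
\<close>

lemma homogeneous_kernel_ballot:
  assumes "n \<ge> 1" "v \<in> carrier (ext_red n)" "homogeneous d v" "colefschetz n v = (\<lambda>C. 0)"
    and "\<And>C. C \<subseteq> red_gens n \<Longrightarrow> ballot C \<Longrightarrow> v C = 0"
  shows "v = (\<lambda>C. 0)"
  using assms
proof (induction n arbitrary: v d rule: nat_induct_at_least)
  case base
  have "ballot {}" by (simp add: ballot_def)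
  then have "v {} = 0" using base by simp
  moreover have "red_gens 1 = {}" by (simp add: red_gens_def)
  ultimately show ?case
    using base by (auto simp: ext_red_eq mem_carrier_exterior)
next
  case (Suc n)
  show ?case
  \<comment> \<open>Degrees above n are settled by the norm argument. Otherwise d is at most n,
    which is exactly what keeps a ballot monomial ballot when both generators of index n are
    adjoined to it.\<close>
  proof (cases "d \<ge> Suc n")
    case True
    then show ?thesis using colefschetz_inj_high_degree Suc by simp
  next
    case False
    have supp: "C \<subseteq> insert (Theta n) (insert (Xi' n) (red_gens n))" if "v C \<noteq> 0" for C
      using Suc.prems(1) that Suc.hyps by (auto simp: ext_red_eq mem_carrier_exterior red_gens_Suc)
    have fin: "finite C" if "v C \<noteq> 0" for C
      using supp[OF that] finite_red_gens finite_subset by blast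
    have deg: "card C = d" if "v C \<noteq> 0" for C
      using that Suc.prems(2) by (simp add: homogeneous_def)
    define x where "x = ext_diff_gen (Xi' n) (ext_diff_gen (Theta n) v)"
    have x_eq_0: "x C = 0 \<longleftrightarrow> Theta n \<in> C \<or> Xi' n \<in> C \<or> v (C \<union> {Theta n, Xi' n}) = 0" for C
      by (auto simp: x_def ext_diff_gen_eq_0_iff insert_commute)
    have "x = (\<lambda>C. 0)"
    proof (rule Suc.IH)
      show "x \<in> carrier (ext_red n)"
        using supp x_eq_0 by (fastforce simp: ext_red_eq mem_carrier_exterior)
      show "homogeneous (d - 2) x"
        unfolding homogeneous_def
      proof (intro allI impI)
        fix C assume "x C \<noteq> 0"
        then have C: "Theta n \<notin> C" "Xi' n \<notin> C" "v (C \<union> {Theta n, Xi' n}) \<noteq> 0"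
          using x_eq_0 by auto
        then show "card C = d - 2"
          using deg[OF C(3)] fin[OF C(3)] by (simp add: card_insert_if)
      qed
      show "colefschetz n x = (\<lambda>C. 0)"
      proof
        fix C
        show "colefschetz n x C = 0"
        proof (cases "C \<subseteq> red_gens n")
          case True
          then have "finite C" using finite_red_gens finite_subset by blast
          have "colefschetz n (ext_diff_gen (Theta n) v) (insert (Xi' n) C) =
              ext_diff_gen (Theta n) (colefschetz n v) (insert (Xi' n) C)"
            using \<open>finite C\<close> by (intro colefschetz_ext_diff_gen) simp
          then have "colefschetz n x C =
              ext_diff_gen (Xi' n) (ext_diff_gen (Theta n) (colefschetz n v)) C"
            unfolding x_def using \<open>finite C\<close>
            by (simp add: colefschetz_ext_diff_gen cong: ext_diff_gen_cong)
          \<comment> \<open>The equation \<open>colefschetz (Suc n) v = 0\<close> splits off the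
            last index as x. Since x involves no generator of index n, differentiating it by either
            of them gives 0.\<close>
          also have "\<dots> = 0"
          proof -
            have "colefschetz n v D = - x D" for D
              using fun_cong[OF Suc.prems(3), of D] Suc.hyps
              by (simp add: colefschetz_Suc x_def add_eq_0_iff2)
            then show ?thesis
              by (simp add: ext_diff_gen_eq_0_iff x_eq_0)
          qed
          finally show ?thesis .
        next
          case False
          then show ?thesis
            using colefschetz_eq_0_outside \<open>x \<in> carrier (ext_red n)\<close> by (simp add: ext_red_eq)
        qed
      qed
      fix C assume C: "C \<subseteq> red_gens n" "ballot C"
      show "x C = 0"
      proof (rule ccontr)
        assume "x C \<noteq> 0"
        then have nz: "v (C \<union> {Theta n, Xi' n}) \<noteq> 0" using x_eq_0 by auto
        then have "ballot (C \<union> {Theta n, Xi' n})"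
          using False deg[OF nz] fin[OF nz] by (intro ballot_insert[OF C]) auto
        then show False
          using Suc.prems(4)[of "C \<union> {Theta n, Xi' n}"] nz C(1) Suc.hyps by (auto simp: red_gens_Suc)
      qed
    qed
    \<comment> \<open>With x gone, the last summand of the operator contributes nothing, so v lies
      in the kernel for n as well.\<close>
    then have co: "colefschetz n v = (\<lambda>C. 0)"
      using fun_cong[OF Suc.prems(3)] Suc.hyps by (simp add: fun_eq_iff colefschetz_Suc x_def)
    have both: "v C = 0" if "Theta n \<in> C" "Xi' n \<in> C" for C
    proof -
      have "C - {Theta n, Xi' n} \<union> {Theta n, Xi' n} = C" using that by auto
      then show ?thesis
        using fun_cong[OF \<open>x = (\<lambda>C. 0)\<close>, of "C - {Theta n, Xi' n}"] unfolding x_eq_0 by auto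
    qed
    have one: "ext_diff_gen a v = (\<lambda>C. 0)" if a: "a = Theta n \<or> a = Xi' n" for a
    proof (rule Suc.IH)
      have y: "a \<notin> C \<and> Theta n \<notin> C \<and> Xi' n \<notin> C \<and> v (insert a C) \<noteq> 0" if "ext_diff_gen a v C \<noteq> 0" for C
        using that a both[of "insert a C"] by (auto simp: ext_diff_gen_eq_0_iff)
      show y_mem: "ext_diff_gen a v \<in> carrier (ext_red n)"
        using y supp by (fastforce simp: ext_red_eq mem_carrier_exterior)
      show "homogeneous (d - 1) (ext_diff_gen a v)"
        unfolding homogeneous_def using y deg fin by (metis card_Diff_singleton Diff_insert_absorb insertI1)
      show "colefschetz n (ext_diff_gen a v) = (\<lambda>C. 0)"
      proof
        fix C
        show "colefschetz n (ext_diff_gen a v) C = 0"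
        proof (cases "C \<subseteq> red_gens n")
          case True
          then have "finite C" using finite_red_gens finite_subset by blast
          then show ?thesis by (simp add: colefschetz_ext_diff_gen co ext_diff_gen_zero)
        next
          case False
          then show ?thesis
            using colefschetz_eq_0_outside y_mem by (simp add: ext_red_eq)
        qed
      qed
      fix C assume C: "C \<subseteq> red_gens n" "ballot C"
      have finC: "finite C" using C finite_red_gens finite_subset by blast
      have "card (C \<union> {a}) \<le> n"
        using ballot_card[OF C] Suc.hyps finC by (auto simp: card_insert_if)
      then have "ballot (C \<union> {a})"
        using a finC by (intro ballot_insert[OF C]) auto
      then have "v (insert a C) = 0"
        using Suc.prems(4)[of "insert a C"] C a Suc.hyps by (auto simp: red_gens_Suc)
      then show "ext_diff_gen a v C = 0"
        by (simp add: ext_diff_gen_eq)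
    qed
    show ?thesis
    proof (rule Suc.IH)
      have "a \<notin> C" if "v C \<noteq> 0" "a = Theta n \<or> a = Xi' n" for a C
      proof
        assume "a \<in> C"
        then have "ext_diff_gen a v (C - {a}) \<noteq> 0"
          using that by (simp add: ext_diff_gen_eq_0_iff insert_absorb)
        then show False using one that by simp
      qed
      then show "v \<in> carrier (ext_red n)"
        using supp by (fastforce simp: ext_red_eq mem_carrier_exterior)
    qed (use Suc.prems co Suc.hyps in \<open>auto simp: red_gens_Suc\<close>)
  qed
qed

text \<open>\<open>colefschetz\<close> lowers the degree by exactly 2, so its kernel is graded; the
  value at A is read off the component of degree \<open>card A\<close>.\<close>

lemma kernel_ballot:
  assumes "n \<ge> 1" "v \<in> carrier (ext_red n)" "colefschetz n v = (\<lambda>C. 0)"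
    and "\<And>C. C \<subseteq> red_gens n \<Longrightarrow> ballot C \<Longrightarrow> v C = 0"
  shows "v = (\<lambda>C. 0)"
proof
  fix A :: "gen set"
  define w where "w = (\<lambda>C. if card C = card A then v C else 0)"
  have "w = (\<lambda>C. 0)"
  proof (rule homogeneous_kernel_ballot[OF assms(1)])
    show w_mem: "w \<in> carrier (ext_red n)"
      using assms(2) by (auto simp: w_def ext_red_eq mem_carrier_exterior)
    show "homogeneous (card A) w" by (simp add: w_def homogeneous_def)
    show "colefschetz n w = (\<lambda>C. 0)"
    proof
      fix C
      show "colefschetz n w C = 0"
      proof (cases "C \<subseteq> red_gens n")
        case True
        then have fin: "finite C" using finite_red_gens finite_subset by blast
        have "ext_diff_gen (Xi' i) (ext_diff_gen (Theta i) w) C =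
          (if card C + 2 = card A then ext_diff_gen (Xi' i) (ext_diff_gen (Theta i) v) C else 0)" for i
          using fin by (auto simp: ext_diff_gen_eq w_def)
        then have "colefschetz n w C = (if card C + 2 = card A then colefschetz n v C else 0)"
          by (simp add: colefschetz_def)
        then show ?thesis using assms(3) by simp
      next
        case False
        then show ?thesis
          using colefschetz_eq_0_outside w_mem by (simp add: ext_red_eq)
      qed
    qed
  qed (use assms(4) in \<open>simp add: w_def\<close>)
  then show "v A = 0" by (metis w_def)
qed

subsection \<open>Block operators\<close>

text \<open>Trades \<open>\<theta>\<^sub>i\<close> for \<open>\<xi>'\<^sub>j\<close>, up to sign:
  the first index is created, the second removed. All operators of blocks without n are the
  identity, \<open>hop i i\<close>, or \<open>hop i j\<close> plus \<open>hop j i\<close>.\<close>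

definition hop :: "nat \<Rightarrow> nat \<Rightarrow> ext \<Rightarrow> ext" where
  "hop j i f = ext_mult (\<xi>' j) (ext_diff_gen (Theta i) f)"

lemma ext_diff_monom: "ext_diff (ext_monom A) f = foldr ext_diff_gen (sorted_list_of_set A) f"
  by (simp add: ext_diff_def ext_monom_def)

lemma ext_diff_ext_gen: "ext_diff (ext_gen a) f = ext_diff_gen a f"
  by (simp add: ext_gen_eq_monom ext_diff_monom)

lemma block_op_single:
  assumes "n \<notin> {i}"
  shows "block_op n l {i} f = (case l {i} of LTheta \<Rightarrow> f | LXi' \<Rightarrow> hop i i f)"
  using assms by (simp add: block_op_def hop_def ext_diff_ext_gen split: label.split)

lemma block_op_pair:
  assumes "n \<notin> {i, j}" "i < j"
  shows "block_op n l {i, j} f = (\<lambda>A. hop i j f A + hop j i f A)"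
  using assms by (simp add: block_op_def hop_def ext_diff_ext_gen)

lemma hop_commute: "hop i j (hop k m f) = hop k m (hop i j f)"
proof -
  have fin: "finite {x \<in> C. x < Theta i}" for C :: "gen set" and i
  proof (rule finite_subset)
    show "{x \<in> C. x < Theta i} \<subseteq> Theta ` {..<i}"
    proof
      fix x assume "x \<in> {x \<in> C. x < Theta i}"
      then show "x \<in> Theta ` {..<i}" by (cases x) (auto simp: less_gen_def)
    qed
  qed simp
  have dd: "ext_diff_gen (Theta i) (ext_diff_gen (Theta j) g) = (\<lambda>C. - ext_diff_gen (Theta j) (ext_diff_gen (Theta i) g) C)"
    for i j g by (intro ext ext_diff_gen_anticomm fin)
  have mm: "ext_mult (\<xi>' i) (ext_mult (\<xi>' j) g) = (\<lambda>C. - ext_mult (\<xi>' j) (ext_mult (\<xi>' i) g) C)"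
    for i j g by (intro ext ext_gen_mult_anticomm)
  have dm: "ext_diff_gen (Theta j) (ext_mult (\<xi>' i) g) = (\<lambda>C. - ext_mult (\<xi>' i) (ext_diff_gen (Theta j) g) C)"
    for i j g by (intro ext ext_diff_gen_mult_anticomm) simp
  show ?thesis
    unfolding hop_def dm ext_mult_minus_right
    by (subst mm, subst dd) (simp add: ext_mult_minus_right)
qed

lemma hop_add: "hop i j (\<lambda>A. f A + g A) C = hop i j f C + hop i j g C"
  by (simp add: hop_def ext_diff_gen_add[THEN ext] ext_mult_add_right)

lemma block_op_cases:
  obtains "block_op n l B = (\<lambda>f. f)" | i where "block_op n l B = hop i i"
  | i j where "block_op n l B = (\<lambda>f A. hop i j f A + hop j i f A)" | "n \<in> B"
proof (cases "n \<in> B")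
  case False
  then show ?thesis
  proof (cases "card B = 2")
    case True
    then show ?thesis
      using False that(3)[of "Min B" "Max B"] by (simp add: block_op_def hop_def ext_diff_ext_gen fun_eq_iff Let_def)
  next
    case F: False
    then show ?thesis
      using False that(1) that(2)[of "the_elem B"]
      by (cases "l B") (simp_all add: block_op_def hop_def ext_diff_ext_gen fun_eq_iff Let_def)
  qed
qed

lemma block_op_commute:
  assumes "n \<notin> B" "n \<notin> B'"
  shows "block_op n l B (block_op n l B' f) = block_op n l B' (block_op n l B f)"
proof -
  have hop2: "hop i j (\<lambda>A. hop k m f A + hop m k f A) = (\<lambda>A. hop k m (hop i j f) A + hop m k (hop i j f) A)"
    for i j k m f
    by (simp add: fun_eq_iff hop_add hop_commute[of i j])
  show ?thesis
    by (rule block_op_cases[of n l B]; rule block_op_cases[of n l B'])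
      (use assms in \<open>simp_all add: hop2 hop_commute hop_add[THEN ext] ac_simps\<close>)
qed

lemma comp_fun_commute_on_block_op: "comp_fun_commute_on {B. n \<notin> B} (block_op n l)"
  by unfold_locales (auto simp: block_op_commute)

lemma hop_neq_0:
  "hop j i f C \<noteq> 0 \<longleftrightarrow> finite C \<and> Xi' j \<in> C \<and> Theta i \<notin> C \<and> f (insert (Theta i) (C - {Xi' j})) \<noteq> 0"
  by (auto simp: hop_def ext_gen_mult ext_diff_gen_eq gen_sign_neq_0)

text \<open>The commutator is a product of two anticommuting derivatives, hence antisymmetric in i
  and j. It vanishes for i = j and cancels in the symmetric sum of a pair block, so the block
  operators preserve the kernel.\<close>

lemma colefschetz_hop:
  assumes "finite C" "i \<in> {1..<n}"
  shows "colefschetz n (hop i j f) C =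
    hop i j (colefschetz n f) C - ext_diff_gen (Theta i) (ext_diff_gen (Theta j) f) C"
proof -
  have anti: "ext_diff_gen x (ext_diff_gen y g) D = - ext_diff_gen y (ext_diff_gen x g) D"
    if "finite D" for x y D and g :: ext
    using that by (intro ext_diff_gen_anticomm) auto
  have mult_cong: "ext_mult (ext_gen a) g D = ext_mult (ext_gen a) h D"
    if "g (D - {a}) = h (D - {a})" for a D and g h :: ext
    using that by (simp add: ext_gen_mult)
  have dm: "ext_diff_gen a (ext_mult (ext_gen b) g) = (\<lambda>C. - ext_mult (ext_gen b) (ext_diff_gen a g) C)"
    if "a \<noteq> b" for a b and g :: ext
    using ext_diff_gen_mult_anticomm[OF that] by (rule ext)
  have "ext_diff_gen (Xi' k) (ext_diff_gen (Theta k) (hop i j f)) C =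
      hop i j (ext_diff_gen (Xi' k) (ext_diff_gen (Theta k) f)) C
      - (if k = i then ext_diff_gen (Theta i) (ext_diff_gen (Theta j) f) C else 0)" for k
  proof -
    define g where "g = ext_diff_gen (Theta k) (ext_diff_gen (Theta j) f)"
    have 1: "ext_diff_gen (Xi' k) (ext_diff_gen (Theta k) (hop i j f)) C = - ext_diff_gen (Xi' k) (ext_mult (\<xi>' i) g) C"
      by (simp add: hop_def dm ext_diff_gen_minus g_def)
    \<comment> \<open>The Clifford relation: differentiation and multiplication by the same
      generator have anticommutator 1, as exactly one of the two composites sees a given finite
      C.\<close>
    have 2: "ext_diff_gen (Xi' k) (ext_mult (\<xi>' i) g) C =
        - ext_mult (\<xi>' i) (ext_diff_gen (Xi' k) g) C + (if k = i then g C else 0)"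
    proof (cases "k = i")
      case True
      then show ?thesis
        using assms(1) ext_diff_gen_mult[of "Xi' k" g C] ext_mult_diff_gen[of "Xi' k" g C] by simp
    qed (simp add: ext_diff_gen_mult_anticomm)
    have "ext_diff_gen (Xi' k) g D = ext_diff_gen (Theta j) (ext_diff_gen (Xi' k) (ext_diff_gen (Theta k) f)) D"
      if "finite D" for D
    proof -
      have "ext_diff_gen (Xi' k) g D =
          ext_diff_gen (Xi' k) (\<lambda>A. - ext_diff_gen (Theta j) (ext_diff_gen (Theta k) f) A) D"
        unfolding g_def using that by (intro ext_diff_gen_cong anti) simp
      then show ?thesis
        using anti[OF that, of "Xi' k"] by (simp add: ext_diff_gen_minus)
    qed
    then have "ext_mult (\<xi>' i) (ext_diff_gen (Xi' k) g) C = hop i j (ext_diff_gen (Xi' k) (ext_diff_gen (Theta k) f)) C"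
      unfolding hop_def using assms(1) by (intro mult_cong) simp
    then show ?thesis
      using 1 2 by (auto simp: g_def)
  qed
  then have "colefschetz n (hop i j f) C =
      (\<Sum>k\<in>{1..<n}. hop i j (ext_diff_gen (Xi' k) (ext_diff_gen (Theta k) f)) C)
      - ext_diff_gen (Theta i) (ext_diff_gen (Theta j) f) C"
    using assms(2) by (simp add: colefschetz_def sum_subtractf)
  moreover have "hop i j (colefschetz n f) C =
      (\<Sum>k\<in>{1..<n}. hop i j (ext_diff_gen (Xi' k) (ext_diff_gen (Theta k) f)) C)"
    by (auto simp: hop_def ext_gen_mult ext_diff_gen_eq colefschetz_def sum_distrib_left intro!: sum.neutral)
  ultimately show ?thesis by simp
qed

lemma hop_closed:
  assumes "f \<in> carrier (ext_red n)" "j \<in> {1..<n}"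
  shows "hop j i f \<in> carrier (ext_red n)"
  unfolding ext_red_eq mem_carrier_exterior
proof (intro allI impI)
  fix C assume "hop j i f C \<noteq> 0"
  then have "Xi' j \<in> C" "insert (Theta i) (C - {Xi' j}) \<subseteq> red_gens n"
    using assms(1) unfolding hop_neq_0 ext_red_eq mem_carrier_exterior by blast+
  moreover have "Xi' j \<in> red_gens n" using assms(2) by (simp add: red_gens_def)
  ultimately show "C \<subseteq> red_gens n" by blast
qed

section \<open>Leading monomials for the index sum\<close>

definition index_sum :: "gen set \<Rightarrow> nat" where
  "index_sum C = (\<Sum>g\<in>C. gen_index g)"

lemma index_sum_exchange:
  assumes "finite C" "a \<in> C" "b \<notin> C"
  shows "index_sum (insert b (C - {a})) + gen_index a = index_sum C + gen_index b"
  using assms by (simp add: index_sum_def sum.remove[of C a])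

text \<open>
  The right end \<open>j\<close> of a pair contributes \<open>\<theta>\<^sub>j \<xi>'\<^sub>j\<close> and the left end nothing, provided that the
  pair lies in \<open>Q\<close>; blocks outside \<open>Q\<close> contribute all their \<open>\<theta>\<^sub>i\<close>.
\<close>

definition lead :: "nat \<Rightarrow> nat set set \<Rightarrow> (nat set \<Rightarrow> label) \<Rightarrow> nat set set \<Rightarrow> gen set" where
  "lead n P l Q =
    {Theta i |i. \<exists>B\<in>P. n \<notin> B \<and> i \<in> B \<and> (B \<in> Q \<longrightarrow> (if card B = 2 then i = Max B else l B = LTheta))} \<union>
    {Xi' i |i. \<exists>B\<in>Q. i \<in> B \<and> (if card B = 2 then i = Max B else l B = LXi')}"

text \<open>The invariant carried along while block operators are applied. U holds the indices not
  yet acted upon: there every monomial of f still has \<open>\<theta>\<^sub>i\<close> and lacks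
  \<open>\<xi>'\<^sub>i\<close>, so a new block meets no generator created before.\<close>

definition has_lead :: "nat \<Rightarrow> nat set \<Rightarrow> ext \<Rightarrow> gen set \<Rightarrow> bool" where
  "has_lead n U f D \<longleftrightarrow> f \<in> carrier (ext_red n) \<and> colefschetz n f = (\<lambda>C. 0) \<and> f D \<noteq> 0 \<and>
    (\<forall>C. f C \<noteq> 0 \<longrightarrow> (C = D \<or> index_sum C < index_sum D) \<and> (\<forall>i\<in>U. Theta i \<in> C \<and> Xi' i \<notin> C))"

text \<open>Each monomial of the image has a unique origin, whose index sum differs by j - i. Hence
  \<open>hop j i\<close> shifts all index sums alike and respects the leading monomial.\<close>

lemma hop_lead:
  assumes "has_lead n U f D" "i \<in> U" "j \<in> U" "hop j i f C \<noteq> 0"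
  obtains C' where "f C' \<noteq> 0" "C = insert (Xi' j) (C' - {Theta i})" "Theta i \<in> C'" "Xi' j \<notin> C'"
    "index_sum C + i = index_sum C' + j"
proof -
  define C' where "C' = insert (Theta i) (C - {Xi' j})"
  have C: "finite C" "Xi' j \<in> C" "Theta i \<notin> C" "f C' \<noteq> 0"
    using assms(4) by (auto simp: hop_neq_0 C'_def)
  then have *: "finite C'" "C = insert (Xi' j) (C' - {Theta i})" "Theta i \<in> C'" "Xi' j \<notin> C'"
    by (auto simp: C'_def)
  have "index_sum C + i = index_sum C' + j"
    using index_sum_exchange[OF *(1,3,4)] *(2) by simp
  then show ?thesis using that C(4) * by blast
qed

lemma has_lead_finite:
  assumes "has_lead n U f D" "f C \<noteq> 0" shows "finite C"
proof -
  have "C \<subseteq> red_gens n"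
    using assms by (simp add: has_lead_def ext_red_eq mem_carrier_exterior)
  then show ?thesis using finite_red_gens finite_subset by blast
qed

lemma has_lead_insert_single:
  assumes "has_lead n U f D" "i \<in> U" "U \<subseteq> {1..<n}"
  shows "has_lead n (U - {i}) (hop i i f) (insert (Xi' i) (D - {Theta i}))"
proof -
  let ?D = "insert (Xi' i) (D - {Theta i})"
  have D: "f D \<noteq> 0" "Theta i \<in> D" "Xi' i \<notin> D" "finite D"
    using assms has_lead_finite[OF assms(1)] unfolding has_lead_def by auto
  have mem: "hop i i f \<in> carrier (ext_red n)"
    using assms by (intro hop_closed) (auto simp: has_lead_def)
  have "?D - {Xi' i} = D - {Theta i}" using D by auto
  then have "hop i i f ?D \<noteq> 0"
    unfolding hop_neq_0 using D by (auto simp: insert_absorb)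
  moreover have "colefschetz n (hop i i f) = (\<lambda>C. 0)"
  proof
    fix C
    show "colefschetz n (hop i i f) C = 0"
    proof (cases "C \<subseteq> red_gens n")
      case True
      then have "finite C" using finite_red_gens finite_subset by blast
      then have "colefschetz n (hop i i f) C =
          hop i i (\<lambda>C. 0) C - ext_diff_gen (Theta i) (ext_diff_gen (Theta i) f) C"
        using colefschetz_hop[of C i n i f] assms by (auto simp: has_lead_def)
      also have "\<dots> = 0"
        by (simp add: hop_def ext_diff_gen_zero ext_mult_zero) (simp add: ext_diff_gen_eq)
      finally show ?thesis .
    next
      case False
      then show ?thesis using colefschetz_eq_0_outside mem by (simp add: ext_red_eq)
    qed
  qed
  moreover have "(C = ?D \<or> index_sum C < index_sum ?D) \<and> (\<forall>k\<in>U - {i}. Theta k \<in> C \<and> Xi' k \<notin> C)"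
    if nz: "hop i i f C \<noteq> 0" for C
  proof -
    obtain C' where C': "f C' \<noteq> 0" "C = insert (Xi' i) (C' - {Theta i})" "Theta i \<in> C'" "Xi' i \<notin> C'"
      "index_sum C + i = index_sum C' + i"
      using hop_lead[OF assms(1,2,2) nz] by blast
    have "index_sum ?D + i = index_sum D + i"
      using index_sum_exchange[of D "Theta i" "Xi' i"] D by simp
    then show ?thesis
      using C' assms(1) unfolding has_lead_def by auto
  qed
  ultimately show ?thesis
    using mem by (simp add: has_lead_def)
qed

lemma has_lead_insert_pair:
  assumes "has_lead n U f D" "i \<in> U" "j \<in> U" "i < j" "U \<subseteq> {1..<n}"
  shows "has_lead n (U - {i, j}) (\<lambda>A. hop i j f A + hop j i f A) (insert (Xi' j) (D - {Theta i}))"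
proof -
  let ?D = "insert (Xi' j) (D - {Theta i})" and ?f = "\<lambda>A. hop i j f A + hop j i f A"
  have D: "f D \<noteq> 0" "Theta i \<in> D" "Xi' j \<notin> D" "Xi' i \<notin> D" "finite D"
    using assms has_lead_finite[OF assms(1)] unfolding has_lead_def by auto
  have "hop i j f \<in> carrier (ext_red n)" "hop j i f \<in> carrier (ext_red n)"
    using assms by (auto intro!: hop_closed simp: has_lead_def)
  then have mem: "?f \<in> carrier (ext_red n)"
    unfolding ext_red_eq mem_carrier_exterior by (metis add.right_neutral)
  have "?D - {Xi' j} = D - {Theta i}" using D by auto
  then have "hop j i f ?D \<noteq> 0"
    unfolding hop_neq_0 using D by (auto simp: insert_absorb)
  \<comment> \<open>The other term creates \<open>\<xi>'\<^sub>i\<close>, which the new leading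
    monomial lacks because i is in U and differs from j; no cancellation can occur.\<close>
  moreover have "hop i j f ?D = 0"
    using hop_neq_0[of i j f ?D] D assms(4) by auto
  ultimately have "?f ?D \<noteq> 0" by simp
  moreover have "colefschetz n ?f = (\<lambda>C. 0)"
  proof
    fix C
    show "colefschetz n ?f C = 0"
    proof (cases "C \<subseteq> red_gens n")
      case True
      then have "finite C" using finite_red_gens finite_subset by blast
      have ij: "i \<in> {1..<n}" "j \<in> {1..<n}" using assms by auto
      have "colefschetz n ?f C = colefschetz n (hop i j f) C + colefschetz n (hop j i f) C"
        unfolding colefschetz_def sum.distrib[symmetric]
        by (intro sum.cong refl) (simp add: ext_diff_gen_eq algebra_simps)
      also have "\<dots> = hop i j (\<lambda>C. 0) C - ext_diff_gen (Theta i) (ext_diff_gen (Theta j) f) C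
          + (hop j i (\<lambda>C. 0) C - ext_diff_gen (Theta j) (ext_diff_gen (Theta i) f) C)"
        using colefschetz_hop[OF \<open>finite C\<close> ij(1), of j f] colefschetz_hop[OF \<open>finite C\<close> ij(2), of i f]
          assms(1) by (simp add: has_lead_def)
      also have "\<dots> = 0"
        using ext_diff_gen_anticomm[of C "Theta i" "Theta j" f] \<open>finite C\<close>
        by (simp add: hop_def ext_diff_gen_zero ext_mult_zero)
      finally show ?thesis .
    next
      case False
      then show ?thesis using colefschetz_eq_0_outside mem by (simp add: ext_red_eq)
    qed
  qed
  moreover have "(C = ?D \<or> index_sum C < index_sum ?D) \<and> (\<forall>k\<in>U - {i, j}. Theta k \<in> C \<and> Xi' k \<notin> C)"
    if nz: "?f C \<noteq> 0" for C
  proof -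
    have rD: "index_sum ?D + i = index_sum D + j"
      using index_sum_exchange[of D "Theta i" "Xi' j"] D by simp
    consider "hop j i f C \<noteq> 0" | "hop i j f C \<noteq> 0" using nz by fastforce
    then show ?thesis
    proof cases
      case 1
      obtain C' where C': "f C' \<noteq> 0" "C = insert (Xi' j) (C' - {Theta i})" "Theta i \<in> C'" "Xi' j \<notin> C'"
        "index_sum C + i = index_sum C' + j"
        using hop_lead[OF assms(1,2,3) 1] by blast
      then show ?thesis
        using rD assms(1) unfolding has_lead_def by auto
    next
      case 2
      obtain C' where C': "f C' \<noteq> 0" "C = insert (Xi' i) (C' - {Theta j})" "Theta j \<in> C'" "Xi' i \<notin> C'"
        "index_sum C + j = index_sum C' + i"
        using hop_lead[OF assms(1,3,2) 2] by blast
      have "index_sum C' \<le> index_sum D" using C'(1) assms(1) by (auto simp: has_lead_def)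
      then have "index_sum C < index_sum ?D" using rD C'(5) assms(4) by linarith
      then show ?thesis
        using C' assms(1) unfolding has_lead_def by auto
    qed
  qed
  ultimately show ?thesis
    using mem by (simp add: has_lead_def)
qed

lemma sorted_list_of_set_Theta:
  "finite X \<Longrightarrow> sorted_list_of_set (Theta ` X) = map Theta (sorted_list_of_set X)"
proof (rule sorted_distinct_set_unique)
  assume "finite X"
  have "mono Theta" by (auto simp: mono_def less_eq_gen_def)
  then show "sorted (map Theta (sorted_list_of_set X))"
    by (simp add: sorted_map monoD sorted_wrt_mono_rel[of _ "(\<le>)"])
qed (simp_all add: distinct_map inj_on_def)

lemma ext_prod_Theta: "finite X \<Longrightarrow> ext_prod (map \<theta> (sorted_list_of_set X)) = ext_monom (Theta ` X)"
  using ext_image_gen[of "Theta ` X"] by (simp add: ext_image_def sorted_list_of_set_Theta o_def)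

text \<open>Leading monomials depend on the support alone, so the resulting sign is kept as an
  unspecified nonzero scalar c.\<close>

lemma foldr_ext_diff_gen_monom:
  assumes "distinct xs" "set xs \<subseteq> A"
  shows "\<exists>c. c \<noteq> 0 \<and> foldr ext_diff_gen xs (ext_monom A) = (\<lambda>C. c * ext_monom (A - set xs) C)"
  using assms
proof (induction xs)
  case Nil
  then show ?case by (intro exI[of _ 1]) simp
next
  case (Cons x xs)
  then obtain c where c: "c \<noteq> 0" "foldr ext_diff_gen xs (ext_monom A) = (\<lambda>C. c * ext_monom (A - set xs) C)"
    by auto
  define T where "T = A - set (x # xs)"
  have T: "x \<notin> T" "insert x C = A - set xs \<longleftrightarrow> C = T" if "x \<notin> C" for C
    using Cons.prems that by (auto simp: T_def)
  have "ext_diff_gen x (\<lambda>C. c * ext_monom (A - set xs) C) C = gen_sign x T * c * ext_monom T C" for C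
    unfolding ext_diff_gen_eq ext_monom_def using T by auto
  then have "foldr ext_diff_gen (x # xs) (ext_monom A) =
      (\<lambda>C. gen_sign x T * c * ext_monom T C)"
    unfolding foldr.simps o_apply c(2) by (rule ext)
  then show ?case
    using c(1) gen_sign_neq_0 unfolding T_def by (intro exI conjI) auto
qed

lemma Psi_partition:
  assumes "(P, l) \<in> Psi n"
  shows "finite P" "\<And>B. B \<in> P \<Longrightarrow> B \<subseteq> {1..n}" "\<Union>P = {1..n}"
    "\<And>B B' i. B \<in> P \<Longrightarrow> B' \<in> P \<Longrightarrow> i \<in> B \<Longrightarrow> i \<in> B' \<Longrightarrow> B = B'"
proof -
  have P: "partition_on {1..n} P" using assms by (simp add: Psi_def)
  then show "\<Union>P = {1..n}" by (simp add: partition_on_def)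
  then show "B \<in> P \<Longrightarrow> B \<subseteq> {1..n}" for B by blast
  show "B \<in> P \<Longrightarrow> B' \<in> P \<Longrightarrow> i \<in> B \<Longrightarrow> i \<in> B' \<Longrightarrow> B = B'" for B B' i
    using P by (auto simp: partition_on_def disjoint_def)
  show "finite P" using P by (metis finite_atLeastAtMost finite_elements)
qed

lemma Psi_block_cases:
  assumes "(P, l) \<in> Psi n" "B \<in> P" "n \<notin> B"
  obtains i where "B = {i}" | i j where "B = {i, j}" "i < j"
proof -
  have "card B = 1 \<or> card B = 2" using assms by (auto simp: Psi_def)
  then show ?thesis
    using that by (metis card_1_singletonE card_2_iff insert_commute nat_neq_iff)
qed

lemma G_has_lead:
  assumes "(P, l) \<in> Psi n" "n \<ge> 1"
  shows "has_lead n {} (G n (P, l)) (lead n P l {B \<in> P. n \<notin> B})"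
proof -
  note P = Psi_partition[OF assms(1)]
  note un = P(3) and uniq = P(4)
  obtain L where L: "L \<in> P" "n \<in> L"
  proof -
    have "n \<in> \<Union>P" unfolding un using assms(2) by simp
    then show ?thesis using that by blast
  qed
  then have L_uniq: "B = L" if "B \<in> P" "n \<in> B" for B
    using that uniq by blast
  have THE: "(THE B. B \<in> P \<and> n \<in> B) = L"
    by (rule the_equality) (simp add: L, simp add: L_uniq)
  define f0 where "f0 = block_op n l L (ext_prod (map \<theta> [1..<n]))"
  have finL: "finite L" using P(2) L(1) finite_subset by blast
  have base: "has_lead n ({1..<n} - L) f0 (lead n P l {})"
  proof -
    have "[1..<n] = sorted_list_of_set {1..<n}" by simp
    then have top: "ext_prod (map \<theta> [1..<n]) = ext_monom (Theta ` {1..<n})"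
      using ext_prod_Theta[of "{1..<n}"] by simp
    have sub: "L - {n} \<subseteq> {1..<n}" using P(2)[OF L(1)] by (auto simp: less_le)
    have "\<exists>c. c \<noteq> 0 \<and> foldr ext_diff_gen (sorted_list_of_set (Theta ` (L - {n}))) (ext_monom (Theta ` {1..<n})) =
        (\<lambda>C. c * ext_monom (Theta ` {1..<n} - set (sorted_list_of_set (Theta ` (L - {n})))) C)"
      using finL sub by (intro foldr_ext_diff_gen_monom) auto
    moreover have "set (sorted_list_of_set (Theta ` (L - {n}))) = Theta ` (L - {n})"
      using finL by simp
    moreover have "f0 = foldr ext_diff_gen (sorted_list_of_set (Theta ` (L - {n}))) (ext_monom (Theta ` {1..<n}))"
      unfolding f0_def block_op_def top using L(2) finL by (simp add: ext_prod_Theta ext_diff_monom)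
    ultimately obtain c where c: "c \<noteq> 0" "f0 = (\<lambda>C. c * ext_monom (Theta ` {1..<n} - Theta ` (L - {n})) C)"
      by metis
    have "(\<exists>B\<in>P. n \<notin> B \<and> i \<in> B) \<longleftrightarrow> i \<in> {1..<n} - L" for i
    proof
      assume "\<exists>B\<in>P. n \<notin> B \<and> i \<in> B"
      then obtain B where "B \<in> P" "n \<notin> B" "i \<in> B" by blast
      moreover from this have "i \<in> {1..n}" "i \<noteq> n" "i \<notin> L"
        using P(2)[of B] uniq[of B L i] L by auto
      ultimately show "i \<in> {1..<n} - L" by auto
    next
      assume i: "i \<in> {1..<n} - L"
      then have "i \<in> \<Union>P" unfolding un by simp
      then obtain B where B: "B \<in> P" "i \<in> B" by blast
      moreover have "n \<notin> B" using L_uniq[OF B(1)] B(2) i by blast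
      ultimately show "\<exists>B\<in>P. n \<notin> B \<and> i \<in> B" by blast
    qed
    then have eq': "lead n P l {} = Theta ` ({1..<n} - L)"
      unfolding lead_def by auto
    have eq: "Theta ` {1..<n} - Theta ` (L - {n}) = lead n P l {}"
      unfolding eq' by auto
    have "f0 C \<noteq> 0 \<longleftrightarrow> C = lead n P l {}" for C
      using c eq by (auto simp: ext_monom_def)
    moreover have "colefschetz n f0 = (\<lambda>C. 0)"
    proof
      fix C
      \<comment> \<open>After the operator of L the element is a multiple of a product of
        \<open>\<theta>\<close>'s, which every derivative by a \<open>\<xi>'\<close> kills.\<close>
      have "insert (Theta i) (insert (Xi' i) C) \<noteq> Theta ` ({1..<n} - L)" for i by blast
      then show "colefschetz n f0 C = 0"
        unfolding c(2) eq eq' colefschetz_def ext_diff_gen_eq ext_monom_def by (simp cong: if_cong)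
    qed
    ultimately show ?thesis
      unfolding has_lead_def ext_red_eq mem_carrier_exterior by (auto simp: eq' red_gens_def)
  qed
  interpret comp_fun_commute_on "{B. n \<notin> B}" "block_op n l" by (rule comp_fun_commute_on_block_op)
  \<comment> \<open>Q collects the blocks applied so far; the indices outside L and Q are the
    untouched ones required by \<open>has_lead\<close>.\<close>
  have "has_lead n ({1..<n} - L - \<Union>Q) (Finite_Set.fold (block_op n l) f0 Q) (lead n P l Q)"
    if "finite Q" "Q \<subseteq> {B \<in> P. n \<notin> B}" for Q
    using that
  proof (induction Q rule: finite_induct)
    case (insert B Q)
    define U where "U = {1..<n} - L - \<Union>Q"
    define f where "f = Finite_Set.fold (block_op n l) f0 Q"
    have IH: "has_lead n U f (lead n P l Q)" using insert by (simp add: f_def U_def)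
    have B: "B \<in> P" "n \<notin> B" using insert by auto
    have Q: "Q \<subseteq> P" "\<And>B'. B' \<in> Q \<Longrightarrow> n \<notin> B'" using insert by auto
    have fold: "Finite_Set.fold (block_op n l) f0 (insert B Q) = block_op n l B f"
      unfolding f_def by (rule fold_insert) (use insert.hyps insert.prems in auto)
    \<comment> \<open>Blocks of a partition are disjoint, so the next block consists of untouched
      indices.\<close>
    have BU: "B \<subseteq> U"
      unfolding U_def using P(2)[OF B(1)] B L uniq[OF B(1)] Q insert.hyps(2)
      by (force simp: less_le)
    have U: "{1..<n} - L - \<Union>(insert B Q) = U - B" by (auto simp: U_def)
    have Xi'_iff: "Xi' k \<in> lead n P l (insert B Q) \<longleftrightarrow>
        Xi' k \<in> lead n P l Q \<or> k \<in> B \<and> (if card B = 2 then k = Max B else l B = LXi')" for k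
      by (auto simp: lead_def)
    have Theta_iff: "Theta k \<in> lead n P l (insert B Q) \<longleftrightarrow>
        Theta k \<in> lead n P l Q \<and> (k \<in> B \<longrightarrow> (if card B = 2 then k = Max B else l B = LTheta))" for k
      using B uniq[OF B(1)] insert.hyps(2) Q(1) by (auto simp: lead_def)
    have no_Xi: "Xi i \<notin> lead n P l Q'" for i Q' by (auto simp: lead_def)
    have in_lead: "Theta k \<in> lead n P l Q" if "k \<in> B" for k
      using IH BU that by (auto simp: has_lead_def)
    have setI: "X = Y" if "\<And>k. Theta k \<in> X \<longleftrightarrow> Theta k \<in> Y" "\<And>k. Xi' k \<in> X \<longleftrightarrow> Xi' k \<in> Y"
      "\<And>k. Xi k \<in> X \<longleftrightarrow> Xi k \<in> Y" for X Y :: "gen set"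
    proof (rule Set.set_eqI)
      fix g show "g \<in> X \<longleftrightarrow> g \<in> Y" by (cases g) (use that in auto)
    qed
    show ?case
      using assms(1) B
    proof (cases rule: Psi_block_cases)
      case (1 i)
      show ?thesis
      proof (cases "l B")
        case LTheta
        have "lead n P l (insert B Q) = lead n P l Q"
          by (rule setI) (use LTheta 1 in_lead in \<open>auto simp: Xi'_iff[unfolded 1] Theta_iff[unfolded 1] no_Xi\<close>)
        then show ?thesis
          using IH LTheta 1 B unfolding fold U
          by (auto simp: block_op_single has_lead_def)
      next
        case LXi'
        have "lead n P l (insert B Q) = insert (Xi' i) (lead n P l Q - {Theta i})"
          by (rule setI) (use LXi' 1 in_lead in \<open>auto simp: Xi'_iff[unfolded 1] Theta_iff[unfolded 1] no_Xi\<close>)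
        then show ?thesis
          using has_lead_insert_single[OF IH, of i] LXi' 1 B BU unfolding fold U
          by (auto simp: block_op_single U_def)
      qed
    next
      case (2 i j)
      have "card B = 2" "Max B = j" using 2 by auto
      note iff = Xi'_iff[unfolded this, simplified] Theta_iff[unfolded this, simplified]
      have "lead n P l (insert B Q) = insert (Xi' j) (lead n P l Q - {Theta i})"
        by (rule setI) (use 2 in_lead in \<open>auto simp: iff[unfolded 2(1)] no_Xi\<close>)
      then show ?thesis
        using has_lead_insert_pair[OF IH, of i j] 2 B BU unfolding fold U
        by (auto simp: block_op_pair U_def)
    qed
  qed (use base in simp)
  moreover have "P - {L} = {B \<in> P. n \<notin> B}" using L(2) by (auto dest: L_uniq)
  ultimately show ?thesis
    using P(1) unfolding has_lead_def by (simp add: G_def THE f0_def)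
qed

subsection \<open>Noncrossing partitions and ballot monomials\<close>

text \<open>A two-element block containing n is no arc: its operator differentiates by
  \<open>\<theta>\<close> and pairs nothing.\<close>

definition arc :: "nat \<Rightarrow> nat set set \<Rightarrow> nat \<Rightarrow> nat \<Rightarrow> bool" where
  "arc n P i j \<longleftrightarrow> i < j \<and> {i, j} \<in> P \<and> n \<notin> {i, j}"

definition lead_monom :: "nat \<Rightarrow> lpart \<Rightarrow> gen set" where
  "lead_monom n \<pi> = (case \<pi> of (P, l) \<Rightarrow> lead n P l {B \<in> P. n \<notin> B})"

lemma arc_unique:
  assumes "(P, l) \<in> Psi n" "arc n P i j"
  shows "arc n P i j' \<Longrightarrow> j' = j" "arc n P i' j \<Longrightarrow> i' = i" "\<not> arc n P j k" "\<not> arc n P k i"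
proof -
  note uniq = Psi_partition(4)[OF assms(1)]
  show "j' = j" if "arc n P i j'"
    using uniq[of "{i, j}" "{i, j'}" i] that assms(2) by (auto simp: arc_def doubleton_eq_iff)
  show "i' = i" if "arc n P i' j"
    using uniq[of "{i, j}" "{i', j}" j] that assms(2) by (auto simp: arc_def doubleton_eq_iff)
  show "\<not> arc n P j k"
    using uniq[of "{i, j}" "{j, k}" j] assms(2) by (auto simp: arc_def doubleton_eq_iff)
  show "\<not> arc n P k i"
    using uniq[of "{i, j}" "{k, i}" i] assms(2) by (auto simp: arc_def doubleton_eq_iff)
qed

text \<open>A dictionary between the role of i in the partition and the generators of index i. Both
  occur at right ends, exactly one at labelled singletons; the pattern with neither is ambiguous
  between left ends and the block of n, and only noncrossingness resolves it.\<close>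

lemma lead_monom_cases:
  assumes "(P, l) \<in> Psi n" "i \<in> {1..n}"
  obtains (last) B where "B \<in> P" "i \<in> B" "n \<in> B" "Theta i \<notin> lead_monom n (P, l)" "Xi' i \<notin> lead_monom n (P, l)"
  | (left) j where "arc n P i j" "Theta i \<notin> lead_monom n (P, l)" "Xi' i \<notin> lead_monom n (P, l)"
  | (right) j where "arc n P j i" "Theta i \<in> lead_monom n (P, l)" "Xi' i \<in> lead_monom n (P, l)"
  | (theta) "{i} \<in> P" "i \<noteq> n" "l {i} = LTheta" "Theta i \<in> lead_monom n (P, l)" "Xi' i \<notin> lead_monom n (P, l)"
  | (xi) "{i} \<in> P" "i \<noteq> n" "l {i} = LXi'" "Theta i \<notin> lead_monom n (P, l)" "Xi' i \<in> lead_monom n (P, l)"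
proof -
  obtain B where B: "B \<in> P" "i \<in> B"
    using assms Psi_partition(3)[OF assms(1)] by blast
  then have uniq: "B' = B" if "B' \<in> P" "i \<in> B'" for B'
    using Psi_partition(4)[OF assms(1)] that by blast
  then have ex_iff: "(\<exists>B'\<in>P. i \<in> B' \<and> R B') \<longleftrightarrow> R B" for R
    using B by blast
  have "Theta i \<in> lead_monom n (P, l) \<longleftrightarrow>
      (\<exists>B'\<in>P. i \<in> B' \<and> (n \<notin> B' \<and> (if card B' = 2 then i = Max B' else l B' = LTheta)))"
    unfolding lead_monom_def lead_def by auto
  then have Theta: "Theta i \<in> lead_monom n (P, l) \<longleftrightarrow> n \<notin> B \<and> (if card B = 2 then i = Max B else l B = LTheta)"
    by (simp only: ex_iff)
  have "Xi' i \<in> lead_monom n (P, l) \<longleftrightarrow>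
      (\<exists>B'\<in>P. i \<in> B' \<and> (n \<notin> B' \<and> (if card B' = 2 then i = Max B' else l B' = LXi')))"
    unfolding lead_monom_def lead_def by auto
  then have Xi: "Xi' i \<in> lead_monom n (P, l) \<longleftrightarrow> n \<notin> B \<and> (if card B = 2 then i = Max B else l B = LXi')"
    by (simp only: ex_iff)
  show ?thesis
  proof (cases "n \<in> B")
    case True
    then show ?thesis using last B Theta Xi by blast
  next
    case False
    show ?thesis
      using assms(1) B(1) False
    proof (cases rule: Psi_block_cases)
      case (1 k)
      then show ?thesis
        using B theta xi Theta Xi False by (cases "l B") auto
    next
      case (2 j k)
      then have card: "card B = 2" "Max B = k" by auto
      have "arc n P j k" using 2 B False by (auto simp: arc_def)
      then show ?thesis
        using left[of k] right[of j] B(2) 2 Theta Xi False unfolding card by auto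
    qed
  qed
qed

lemma noncrossingD:
  assumes "noncrossing P" "B \<in> P" "B' \<in> P" "a \<in> B" "c \<in> B" "b \<in> B'" "d \<in> B'" "a < b" "b < c" "c < d"
  shows "B = B'"
  using assms unfolding noncrossing_def by blast

lemma arc_range: "(P, l) \<in> Psi n \<Longrightarrow> arc n P i j \<Longrightarrow> i \<in> {1..n} \<and> j \<in> {1..n} \<and> j < n \<and> i < n"
  using Psi_partition(2)[of P l n "{i, j}"] by (auto simp: arc_def)

lemma arc_left:
  assumes "(P, l) \<in> Psi n" "arc n P i j"
  shows "Theta i \<notin> lead_monom n (P, l) \<and> Xi' i \<notin> lead_monom n (P, l)"
proof -
  have i: "i \<in> {1..n}" using arc_range[OF assms] by simp
  have uniq: "B = {i, j}" if "B \<in> P" "i \<in> B" for B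
    using Psi_partition(4)[OF assms(1) that(1), of "{i, j}" i] that(2) assms(2) by (simp add: arc_def)
  from assms(1) i show ?thesis
  proof (cases rule: lead_monom_cases)
    case (last B)
    then show ?thesis using uniq[of B] assms(2) by (simp add: arc_def)
  next
    case (right k)
    then show ?thesis using arc_unique(4)[OF assms] by blast
  next
    case theta
    then show ?thesis using uniq[of "{i}"] assms(2) by (auto simp: arc_def)
  next
    case xi
    then show ?thesis using uniq[of "{i}"] assms(2) by (auto simp: arc_def)
  qed simp
qed

lemma arc_right:
  assumes "(P, l) \<in> Psi n" "arc n P i j"
  shows "Theta j \<in> lead_monom n (P, l) \<and> Xi' j \<in> lead_monom n (P, l)"
proof -
  have j: "j \<in> {1..n}" using arc_range[OF assms] by simp
  have uniq: "B = {i, j}" if "B \<in> P" "j \<in> B" for B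
    using Psi_partition(4)[OF assms(1) that(1), of "{i, j}" j] that(2) assms(2) by (simp add: arc_def)
  from assms(1) j show ?thesis
  proof (cases rule: lead_monom_cases)
    case (last B)
    then show ?thesis using uniq[of B] assms(2) by (simp add: arc_def)
  next
    case (left k)
    then show ?thesis using arc_unique(3)[OF assms] by blast
  next
    case theta
    then show ?thesis using uniq[of "{j}"] assms(2) by (auto simp: arc_def)
  next
    case xi
    then show ?thesis using uniq[of "{j}"] assms(2) by (auto simp: arc_def)
  qed simp
qed

text \<open>If i < i' < j, then i' has the empty pattern in P too. It cannot lie in the block of n,
  nor start an arc ending after j, since either would cross the arc from i to j. It cannot start an
  arc ending before j, as that arc would also be in P' by induction, nor one ending at j.\<close>

lemma arc_step:
  assumes "(P, l) \<in> Phi n" "(P', l') \<in> Phi n" "lead_monom n (P, l) = lead_monom n (P', l')"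
    and IH: "\<And>i k. k < j \<Longrightarrow> arc n P i k \<longleftrightarrow> arc n P' i k"
    and "arc n P i j" "arc n P' i' j"
  shows "\<not> i < i'"
proof
  assume "i < i'"
  have Psi: "(P, l) \<in> Psi n" "(P', l') \<in> Psi n" and nc: "noncrossing P"
    using assms by (auto simp: Phi_def)
  have i': "i' \<in> {1..n}" "i' < j" "j < n"
    using arc_range[OF Psi(2) assms(6)] assms(6) by (auto simp: arc_def)
  have ij: "{i, j} \<in> P" "n \<notin> {i, j}" using assms(5) by (auto simp: arc_def)
  have none: "Theta i' \<notin> lead_monom n (P, l)" "Xi' i' \<notin> lead_monom n (P, l)"
    unfolding assms(3) using arc_left[OF Psi(2) assms(6)] by simp_all
  from Psi(1) i'(1) show False
  proof (cases rule: lead_monom_cases)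
    case (last B)
    then have "{i, j} = B"
      using noncrossingD[OF nc ij(1), of B i j i' n] i' \<open>i < i'\<close> by simp
    then show False using last ij by blast
  next
    case (left k)
    consider "k < j" | "k = j" | "j < k" by linarith
    then show False
    proof cases
      case 1
      then have "arc n P' i' k" using IH left by blast
      then show False using arc_unique(1)[OF Psi(2) assms(6)] 1 by blast
    next
      case 2
      then show False using arc_unique(2)[OF Psi(1) assms(5)] left \<open>i < i'\<close> by blast
    next
      case 3
      then have "{i, j} = {i', k}"
        using noncrossingD[OF nc ij(1), of "{i', k}" i j i' k] left i' \<open>i < i'\<close> by (simp add: arc_def)
      then show False using 3 i' by (auto simp: doubleton_eq_iff)
    qed
  qed (use none in auto)
qed

lemma right_arc:
  assumes "(P, l) \<in> Psi n" "j \<in> {1..n}" "Theta j \<in> lead_monom n (P, l)" "Xi' j \<in> lead_monom n (P, l)"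
  obtains i where "arc n P i j"
  using assms(1,2) by (cases rule: lead_monom_cases) (use assms(3,4) that in auto)

text \<open>Right ends are visible in the monomial, so an arc ending at j in one partition forces an
  arc ending at j in the other; \<open>arc_step\<close>, used in both directions, makes their left
  ends agree.\<close>

lemma arcs_eq:
  assumes "(P, l) \<in> Phi n" "(P', l') \<in> Phi n" "lead_monom n (P, l) = lead_monom n (P', l')"
  shows "arc n P i j \<longleftrightarrow> arc n P' i j"
proof (induction j arbitrary: i rule: less_induct)
  case (less j)
  have Psi: "(P, l) \<in> Psi n" "(P', l') \<in> Psi n" using assms by (auto simp: Phi_def)
  have eq: "i = i'" if "arc n P i j" "arc n P' i' j" for i i'
    using arc_step[OF assms less.IH that] arc_step[OF assms(2,1) assms(3)[symmetric] less.IH[symmetric] that(2,1)]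
    by force
  show ?case
  proof
    assume a: "arc n P i j"
    obtain i' where "arc n P' i' j"
      using right_arc[OF Psi(2)] arc_right[OF Psi(1) a] arc_range[OF Psi(1) a] unfolding assms(3) by blast
    then show "arc n P' i j" using eq a by blast
  next
    assume a: "arc n P' i j"
    obtain i' where "arc n P i' j"
      using right_arc[OF Psi(1)] arc_right[OF Psi(2) a] arc_range[OF Psi(2) a] unfolding assms(3) by blast
    then show "arc n P i j" using eq a by blast
  qed
qed

lemma singles:
  assumes "(P, l) \<in> Psi n" "i \<in> {1..n}" "i \<noteq> n"
  shows "{i} \<in> P \<longleftrightarrow> (Theta i \<in> lead_monom n (P, l)) \<noteq> (Xi' i \<in> lead_monom n (P, l))"
    "{i} \<in> P \<Longrightarrow> l {i} = (if Theta i \<in> lead_monom n (P, l) then LTheta else LXi')"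
proof -
  have uniq: "B = {i}" if "{i} \<in> P" "B \<in> P" "i \<in> B" for B
    using Psi_partition(4)[OF assms(1) that(2,1,3)] by simp
  have pair: "{i} \<notin> P" if "arc n P i j \<or> arc n P j i" for j
    using uniq[of "{i, j}"] that by (auto simp: arc_def insert_commute)
  from assms(1,2) have "({i} \<in> P \<longleftrightarrow> (Theta i \<in> lead_monom n (P, l)) \<noteq> (Xi' i \<in> lead_monom n (P, l))) \<and>
    ({i} \<in> P \<longrightarrow> l {i} = (if Theta i \<in> lead_monom n (P, l) then LTheta else LXi'))"
  proof (cases rule: lead_monom_cases)
    case (last B)
    then have "{i} \<notin> P" using uniq[of B] assms(3) by auto
    then show ?thesis using last by simp
  next
    case (left j)
    then show ?thesis using pair[of j] by simp
  next
    case (right j)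
    then show ?thesis using pair[of j] by simp
  qed simp_all
  then show "{i} \<in> P \<longleftrightarrow> (Theta i \<in> lead_monom n (P, l)) \<noteq> (Xi' i \<in> lead_monom n (P, l))"
    "{i} \<in> P \<Longrightarrow> l {i} = (if Theta i \<in> lead_monom n (P, l) then LTheta else LXi')"
    by blast+
qed

lemma blocks_subset:
  assumes "(P, l) \<in> Phi n" "(P', l') \<in> Phi n" "lead_monom n (P, l) = lead_monom n (P', l')"
    and "B \<in> P" "n \<notin> B"
  shows "B \<in> P'"
proof -
  have Psi: "(P, l) \<in> Psi n" "(P', l') \<in> Psi n" using assms by (auto simp: Phi_def)
  from Psi(1) assms(4,5) show ?thesis
  proof (cases rule: Psi_block_cases)
    case (1 i)
    then have "i \<in> {1..n}" "i \<noteq> n" using assms(4,5) Psi_partition(2)[OF Psi(1), of B] by auto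
    then show ?thesis
      using singles(1)[OF Psi(1)] singles(1)[OF Psi(2)] assms(3,4) 1 by simp
  next
    case (2 i j)
    then have "arc n P i j" using assms by (auto simp: arc_def)
    then have "arc n P' i j" using arcs_eq[OF assms(1-3)] by blast
    then show ?thesis using 2 by (simp add: arc_def)
  qed
qed

text \<open>Arcs and labelled singletons are recovered from the monomial, and the block of n is the
  complement of all other blocks.\<close>

lemma inj_on_lead_monom:
  assumes "n \<ge> 1"
  shows "inj_on (lead_monom n) (Phi n)"
proof (rule inj_onI)
  fix \<pi> \<pi>' assume \<pi>: "\<pi> \<in> Phi n" "\<pi>' \<in> Phi n" "lead_monom n \<pi> = lead_monom n \<pi>'"
  obtain P l P' l' where pairs: "\<pi> = (P, l)" "\<pi>' = (P', l')" by fastforce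
  then have Phi: "(P, l) \<in> Phi n" "(P', l') \<in> Phi n" and eq: "lead_monom n (P, l) = lead_monom n (P', l')"
    using \<pi> by auto
  have Psi: "(P, l) \<in> Psi n" "(P', l') \<in> Psi n" using Phi by (auto simp: Phi_def)
  have others: "B \<in> P \<longleftrightarrow> B \<in> P'" if "n \<notin> B" for B
    using blocks_subset[OF Phi eq _ that] blocks_subset[OF Phi(2,1) eq[symmetric] _ that] by blast
  have last: "B = {1..n} - \<Union>{B \<in> P. n \<notin> B}" if "B \<in> P" "n \<in> B" "(P, l) \<in> Psi n" for P l B
  proof -
    have "B' = B" if "B' \<in> P" "n \<in> B'" for B'
      using Psi_partition(4)[OF \<open>(P, l) \<in> Psi n\<close>] that \<open>B \<in> P\<close> \<open>n \<in> B\<close> by blast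
    moreover have "B' \<inter> B = {}" if "B' \<in> P" "n \<notin> B'" for B'
      using Psi_partition(4)[OF \<open>(P, l) \<in> Psi n\<close>, of B' B] that \<open>B \<in> P\<close> \<open>n \<in> B\<close> by blast
    ultimately show ?thesis
      unfolding Psi_partition(3)[OF \<open>(P, l) \<in> Psi n\<close>, symmetric] using \<open>B \<in> P\<close> by auto
  qed
  have sub: "B \<in> P'" if "B \<in> P" "n \<in> B" "(P, l) \<in> Psi n" "(P', l') \<in> Psi n"
    and o: "\<And>B. n \<notin> B \<Longrightarrow> B \<in> P \<longleftrightarrow> B \<in> P'" for P P' l l' B
  proof -
    have "n \<in> \<Union>P'" using Psi_partition(3)[OF that(4)] assms by simp
    then obtain B' where B': "B' \<in> P'" "n \<in> B'" by blast
    have "{B \<in> P. n \<notin> B} = {B \<in> P'. n \<notin> B}" using o by blast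
    then have "B = B'"
      using last[OF that(1-3)] last[OF B' that(4)] by simp
    then show ?thesis using B' by simp
  qed
  have P: "P = P'"
    using others sub[OF _ _ Psi others] sub[OF _ _ Psi(2,1) others[symmetric]] by blast
  have "l B = l' B" for B
  proof (cases "B \<in> P \<and> n \<notin> B \<and> card B = 1")
    case True
    then obtain i where i: "B = {i}" by (metis card_1_singletonE)
    then have "i \<in> {1..n}" "i \<noteq> n" using True Psi_partition(2)[OF Psi(1), of B] by auto
    then show ?thesis
      using singles(2)[OF Psi(1), of i] singles(2)[OF Psi(2), of i] eq True i P by simp
  next
    \<comment> \<open>Outside the labelled singletons both labellings are \<open>undefined\<close>,
      by extensionality of the function space in \<open>Psi\<close>.\<close>
    case False
    then show ?thesis
      using Psi P by (auto simp: Psi_def PiE_def extensional_def)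
  qed
  then show "\<pi> = \<pi>'" using P pairs by blast
qed

section \<open>Ballot monomials as leading monomials, by bracket matching\<close>

text \<open>Greedy matching: each right end is joined to the last left end that is still free.\<close>

locale matching =
  fixes nei bo :: "nat \<Rightarrow> bool" and k :: nat and M :: "(nat \<times> nat) set"
  assumes M1: "(i, j) \<in> M \<Longrightarrow> 1 \<le> i \<and> i < j \<and> j \<le> k \<and> nei i \<and> bo j"
    and M2: "j \<in> {1..k} \<Longrightarrow> bo j \<Longrightarrow> \<exists>i. (i, j) \<in> M"
    and M3: "(i, j) \<in> M \<Longrightarrow> (i', j) \<in> M \<Longrightarrow> i = i'"
    and M4: "(i, j) \<in> M \<Longrightarrow> (i, j') \<in> M \<Longrightarrow> j = j'"
    and M5: "(a, c) \<in> M \<Longrightarrow> (b, d) \<in> M \<Longrightarrow> \<not> (a < b \<and> b < c \<and> c < d)"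
    and M6: "(a, c) \<in> M \<Longrightarrow> a < b \<Longrightarrow> b < c \<Longrightarrow> nei b \<Longrightarrow> \<exists>d. (b, d) \<in> M"

text \<open>\<open>nei\<close> and \<open>bo\<close> stand for neither and both generators present.
  Of the invariants, M5 forbids crossing arcs, and M6 forbids an unmatched \<open>nei\<close> index
  under an arc, so that unmatched indices can later join n without crossing.\<close>

lemma ballot_matching:
  fixes nei bo :: "nat \<Rightarrow> bool"
  assumes "\<And>k. card {i \<in> {1..k}. bo i} \<le> card {i \<in> {1..k}. nei i}" "\<And>i. \<not> (nei i \<and> bo i)"
  shows "\<exists>M. matching nei bo k M"
proof (induction k)
  case 0
  show ?case by (intro exI[of _ "{}"]) (unfold_locales, auto)
next
  case (Suc k)
  then obtain M where "matching nei bo k M" by blast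
  then interpret matching nei bo k M .
  show ?case
  proof (cases "bo (Suc k)")
    case False
    show ?thesis
    proof (intro exI[of _ M], unfold_locales)
      fix j assume "j \<in> {1..Suc k}" "bo j"
      then show "\<exists>i. (i, j) \<in> M" using M2[of j] False by (cases "j = Suc k") auto
    next
      fix i j assume "(i, j) \<in> M"
      then show "1 \<le> i \<and> i < j \<and> j \<le> Suc k \<and> nei i \<and> bo j" using M1[of i j] by simp
    qed (fact M3, fact M4, fact M5, fact M6)
  next
    case True
    define F where "F = {i \<in> {1..k}. nei i \<and> (\<forall>j. (i, j) \<notin> M)}"
    \<comment> \<open>Without a free index, partners would embed the \<open>nei\<close> indices up
      to k into the \<open>bo\<close> indices up to k. The new right end \<open>Suc k\<close> then
      makes \<open>bo\<close> outnumber \<open>nei\<close>, against the ballot inequality.\<close>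
    have "F \<noteq> {}"
    proof
      assume "F = {}"
      then have nei: "\<exists>j. (i, j) \<in> M" if "i \<in> {1..k}" "nei i" for i
        using that by (auto simp: F_def)
      define r where "r i = (SOME j. (i, j) \<in> M)" for i
      have r: "(i, r i) \<in> M" if "i \<in> {1..k}" "nei i" for i
        using nei[OF that] unfolding r_def by (rule someI_ex)
      have "card {i \<in> {1..k}. nei i} = card (r ` {i \<in> {1..k}. nei i})"
        using r M3 by (intro card_image[symmetric] inj_onI) (metis (mono_tags, lifting) mem_Collect_eq)
      also have "\<dots> \<le> card {i \<in> {1..k}. bo i}"
        using r M1 by (intro card_mono) fastforce+
      also have "\<dots> < card {i \<in> {1..Suc k}. bo i}"
      proof -
        have "{i \<in> {1..Suc k}. bo i} = insert (Suc k) {i \<in> {1..k}. bo i}"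
          using True by (auto simp: le_Suc_eq)
        then show ?thesis by simp
      qed
      also have "\<dots> \<le> card {i \<in> {1..Suc k}. nei i}" by (rule assms(1))
      also have "{i \<in> {1..Suc k}. nei i} = {i \<in> {1..k}. nei i}"
        using assms(2) True by (auto simp: le_Suc_eq)
      finally show False by simp
    qed
    \<comment> \<open>Maximality leaves no free index under the new arc, which keeps M6. As f was
      free, the old M6 puts it under no earlier arc, which keeps M5.\<close>
    define f where "f = Max F"
    have "finite F" by (simp add: F_def)
    then have "f \<in> F" unfolding f_def using \<open>F \<noteq> {}\<close> by simp
    then have f: "1 \<le> f" "f \<le> k" "nei f" "\<And>j. (f, j) \<notin> M" by (auto simp: F_def)
    have f_max: "\<exists>d. (b, d) \<in> M" if "f < b" "b \<le> k" "nei b" for b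
    proof (rule ccontr)
      assume "\<nexists>d. (b, d) \<in> M"
      then have "b \<in> F" using that f(1) by (auto simp: F_def)
      then show False using Max_ge[OF \<open>finite F\<close>, of b] that(1) by (simp add: f_def)
    qed
    let ?M = "insert (f, Suc k) M"
    show ?thesis
    proof (intro exI[of _ ?M], unfold_locales)
      fix j assume "j \<in> {1..Suc k}" "bo j"
      then show "\<exists>i. (i, j) \<in> ?M" using M2[of j] by (cases "j = Suc k") auto
    next
      fix a b c d assume ac: "(a, c) \<in> ?M" and bd: "(b, d) \<in> ?M"
      show "\<not> (a < b \<and> b < c \<and> c < d)"
      proof
        assume *: "a < b \<and> b < c \<and> c < d"
        show False
        proof (cases "(a, c) = (f, Suc k)")
          case T: True
          then have "d \<le> Suc k" using bd M1[of b d] by auto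
          then show False using * T by auto
        next
          case F: False
          then have ac': "(a, c) \<in> M" using ac by auto
          show False
          proof (cases "(b, d) = (f, Suc k)")
            case True
            then show False using M6[OF ac', of b] * f by auto
          next
            case False
            then show False using M5[OF ac', of b d] bd * by auto
          qed
        qed
      qed
    next
      fix a b c assume ac: "(a, c) \<in> ?M" "a < b" "b < c" "nei b"
      show "\<exists>d. (b, d) \<in> ?M"
      proof (cases "(a, c) = (f, Suc k)")
        case True
        then show ?thesis using f_max[of b] ac by auto
      next
        case False
        then show ?thesis using M6[of a c b] ac by auto
      qed
    next
      fix i i' j assume "(i, j) \<in> ?M" "(i', j) \<in> ?M"
      then show "i = i'" using M3[of i j i'] M1[of i j] M1[of i' j] by auto
    next
      fix i j j' assume "(i, j) \<in> ?M" "(i, j') \<in> ?M"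
      then show "j = j'" using M4[of i j j'] f(4)[of j] f(4)[of j'] by auto
    next
      fix i j assume "(i, j) \<in> ?M"
      then show "1 \<le> i \<and> i < j \<and> j \<le> Suc k \<and> nei i \<and> bo j" using M1[of i j] f True by auto
    qed
  qed
qed

text \<open>By inclusion and exclusion, the \<open>\<theta>\<close>- and
  \<open>\<xi>'\<close>-indices up to k number their union plus their intersection. A total of at
  most k bounds the intersection by the complement of the union.\<close>

lemma ballot_counts:
  assumes "C \<subseteq> red_gens n" "ballot C" "k < n"
  shows "card {i \<in> {1..k}. Theta i \<in> C \<and> Xi' i \<in> C} \<le> card {i \<in> {1..k}. Theta i \<notin> C \<and> Xi' i \<notin> C}"
proof -
  define T X where "T = {i \<in> {1..k}. Theta i \<in> C}" and "X = {i \<in> {1..k}. Xi' i \<in> C}"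
  have fin: "finite T" "finite X" "T \<subseteq> {1..k}" "X \<subseteq> {1..k}" by (auto simp: T_def X_def)
  have "{g \<in> C. gen_index g \<le> k} = Theta ` T \<union> Xi' ` X"
    using assms(1) by (auto simp: T_def X_def red_gens_def)
  then have "card {g \<in> C. gen_index g \<le> k} = card (Theta ` T) + card (Xi' ` X)"
    using fin by (simp, subst card_Un_disjoint) auto
  also have "\<dots> = card T + card X"
    by (simp add: card_image inj_on_def)
  finally have "card T + card X \<le> k"
    using assms(2) unfolding ballot_def by metis
  moreover have "card T + card X = card (T \<union> X) + card (T \<inter> X)"
    using fin by (rule_tac card_Un_Int) auto
  moreover have "card ({1..k} - (T \<union> X)) = k - card (T \<union> X)"
    using fin by (subst card_Diff_subset) auto
  moreover have "card (T \<union> X) \<le> k"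
    using card_mono[of "{1..k}" "T \<union> X"] fin by simp
  ultimately have "card (T \<inter> X) \<le> card ({1..k} - (T \<union> X))" by linarith
  moreover have "T \<inter> X = {i \<in> {1..k}. Theta i \<in> C \<and> Xi' i \<in> C}"
    "{1..k} - (T \<union> X) = {i \<in> {1..k}. Theta i \<notin> C \<and> Xi' i \<notin> C}"
    by (auto simp: T_def X_def)
  ultimately show ?thesis by simp
qed

text \<open>The partition is read off the matching: matched pairs are arcs, indices with a single
  generator are singletons labelled by it, and the unmatched indices with no generator join
  n.\<close>

lemma ballot_lead_monom:
  assumes "n \<ge> 1" "C \<subseteq> red_gens n" "ballot C"
  obtains \<pi> where "\<pi> \<in> Phi n" "lead_monom n \<pi> = C"
proof -
  define nei where "nei i \<longleftrightarrow> Theta i \<notin> C \<and> Xi' i \<notin> C" for i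
  define bo where "bo i \<longleftrightarrow> Theta i \<in> C \<and> Xi' i \<in> C" for i
  have range: "i \<in> {1..<n}" if "Theta i \<in> C \<or> Xi' i \<in> C" for i
    using that assms(2) by (auto simp: red_gens_def)
  have "card {i \<in> {1..k}. bo i} \<le> card {i \<in> {1..k}. nei i}" for k
  proof (cases "k < n")
    case True
    then show ?thesis using ballot_counts[OF assms(2,3) True] by (simp add: bo_def nei_def)
  next
    case False
    \<comment> \<open>Beyond n - 1 no further index is \<open>bo\<close>, while the number of
      \<open>nei\<close> indices can only grow.\<close>
    have "{i \<in> {1..k}. bo i} = {i \<in> {1..n-1}. bo i}"
      using range False by (fastforce simp: bo_def)
    also have "card \<dots> \<le> card {i \<in> {1..n-1}. nei i}"
      using ballot_counts[OF assms(2,3), of "n - 1"] assms(1) by (simp add: bo_def nei_def)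
    also have "\<dots> \<le> card {i \<in> {1..k}. nei i}"
      using False by (intro card_mono) auto
    finally show ?thesis .
  qed
  then have "\<exists>M. matching nei bo (n - 1) M"
    by (rule ballot_matching) (auto simp: nei_def bo_def)
  then obtain M where "matching nei bo (n - 1) M" by blast
  then interpret matching nei bo "n - 1" M .
  have Mn: "i < n" "j < n" "i < j" "1 \<le> i" "nei i" "bo j" "i \<noteq> n" "j \<noteq> n" if "(i, j) \<in> M" for i j
    using M1[OF that] assms(1) by auto
  have disj: "\<not> (nei i \<and> bo i)" for i by (auto simp: nei_def bo_def)
  define L where "L = insert n {i \<in> {1..<n}. nei i \<and> (\<forall>j. (i, j) \<notin> M)}"
  define P2 where "P2 = {{i, j} |i j. (i, j) \<in> M}"
  define P1 where "P1 = {{i} |i. i \<in> {1..<n} \<and> \<not> nei i \<and> \<not> bo i}"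
  define P where "P = insert L (P1 \<union> P2)"
  \<comment> \<open>\<open>undefined\<close> off the labelled singletons is what \<open>Psi\<close>
    demands of a labelling.\<close>
  define l where "l = (\<lambda>B. if B \<in> P1 then (if Theta (the_elem B) \<in> C then LTheta else LXi') else undefined)"
  have card_P1: "card B = 1" "n \<notin> B" if "B \<in> P1" for B using that by (auto simp: P1_def)
  have card_P2: "card B = 2" "n \<notin> B" if "B \<in> P2" for B
    using that Mn by (auto simp: P2_def card_2_iff) (metis less_irrefl)
  have nL: "n \<in> L" by (simp add: L_def)
  have uniq: "B = B'" if BP: "B \<in> P" "B' \<in> P" and iB: "i \<in> B" "i \<in> B'" for B B' i
  proof -
    have 1: "i \<in> B \<Longrightarrow> \<not> nei i \<and> \<not> bo i \<and> i \<noteq> n \<and> B = {i}" if "B \<in> P1" for B i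
      using that by (auto simp: P1_def)
    have 2: "\<exists>a b. (a, b) \<in> M \<and> B = {a, b} \<and> (i = a \<and> nei i \<or> i = b \<and> bo i) \<and> i \<noteq> n"
      if "B \<in> P2" "i \<in> B" for B i
      using that Mn by (fastforce simp: P2_def)
    have L: "i = n \<or> nei i \<and> (\<forall>j. (i, j) \<notin> M)" if "i \<in> L" for i
      using that by (auto simp: L_def)
    consider "B = L" | "B \<in> P1" | "B \<in> P2" using BP(1) unfolding P_def by blast
    then show ?thesis
    proof cases
      case A: 1
      consider "B' = L" | "B' \<in> P1" | "B' \<in> P2" using BP(2) unfolding P_def by blast
      then show ?thesis
        using A iB L[of i] 1[of B' i] 2[of B' i] disj[of i] by cases auto
    next
      case A: 2
      consider "B' = L" | "B' \<in> P1" | "B' \<in> P2" using BP(2) unfolding P_def by blast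
      then show ?thesis
        using 1[OF A iB(1)] iB L[of i] 1[of B' i] 2[of B' i] by cases auto
    next
      case A: 3
      obtain a b where ab: "(a, b) \<in> M" "B = {a, b}" "i = a \<and> nei i \<or> i = b \<and> bo i" "i \<noteq> n"
        using 2[OF A iB(1)] by blast
      consider "B' = L" | "B' \<in> P1" | "B' \<in> P2" using BP(2) unfolding P_def by blast
      then show ?thesis
      proof cases
        case C: 3
        obtain c d where "(c, d) \<in> M" "B' = {c, d}" "i = c \<and> nei i \<or> i = d \<and> bo i"
          using 2[OF C iB(2)] by blast
        then show ?thesis using ab disj[of i] M3[of a b c] M4[of a b d] by auto
      qed (use ab iB(2) L[of i] 1[of B' i] disj[of i] in auto)
    qed
  qed
  have sub: "B \<subseteq> {1..n}" if "B \<in> P" for B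
    using that assms(1) Mn by (fastforce simp: P_def L_def P1_def P2_def)
  have cover: "\<exists>B\<in>P. i \<in> B" if i: "i \<in> {1..n}" for i
  proof -
    consider "i = n \<or> i \<in> {1..<n} \<and> nei i \<and> (\<forall>j. (i, j) \<notin> M)" | j where "(i, j) \<in> M"
      | "i \<in> {1..<n}" "bo i" | "i \<in> {1..<n}" "\<not> nei i" "\<not> bo i"
      using i by force
    then show ?thesis
    proof cases
      case 1
      then have "i \<in> L" by (auto simp: L_def)
      then show ?thesis by (auto simp: P_def)
    next
      case (2 j)
      then show ?thesis by (auto simp: P_def P2_def)
    next
      case 3
      then have "i \<in> {1..n - 1}" by auto
      then obtain k where "(k, i) \<in> M" using M2 3(2) by blast
      then show ?thesis by (auto simp: P_def P2_def)
    next
      case 4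
      then show ?thesis by (auto simp: P_def P1_def)
    qed
  qed
  have ne: "{} \<notin> P" by (auto simp: P_def L_def P1_def P2_def)
  have "partition_on {1..n} P"
  proof (rule partition_onI)
    show "\<Union>P = {1..n}" using sub cover by blast
    show "{} \<notin> P" by (rule ne)
    show "disjnt p q" if "p \<in> P" "q \<in> P" "p \<noteq> q" for p q
      using uniq[OF that(1,2)] that(3) unfolding disjnt_iff by blast
  qed
  moreover have others: "B \<in> P1 \<or> B \<in> P2" if "B \<in> P" "n \<notin> B" for B
    using that nL by (auto simp: P_def)
  moreover have "{B \<in> P. n \<notin> B \<and> card B = 1} = P1"
    using nL card_P1 card_P2(1) by (fastforce simp: P_def)
  ultimately have Psi: "(P, l) \<in> Psi n"
    unfolding Psi_def using card_P1 card_P2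
    by (auto simp: l_def PiE_def extensional_def)
  have pair: "(a, c) \<in> M" if "B \<in> P" "n \<notin> B" "a \<in> B" "c \<in> B" "a < c" for a c B
    using others[OF that(1,2)] that(3-5) Mn(3) by (fastforce simp: P1_def P2_def)
  \<comment> \<open>Two crossing blocks have at least two elements each. Two arcs are excluded by
    M5; if one of the blocks contains n, its middle element is an unmatched index under the other
    arc, excluded by M6.\<close>
  have "noncrossing P"
    unfolding noncrossing_def
  proof (rule notI, elim exE conjE bexE)
    fix a b c d B B'
    assume ord: "a < b" "b < c" "c < d"
      and B: "B \<in> P" "a \<in> B" "c \<in> B" and B': "B' \<in> P" "b \<in> B'" "d \<in> B'" and "B \<noteq> B'"
    have L: "X = L" if "X \<in> P" "n \<in> X" for X
      using uniq[of X L n] that nL by (auto simp: P_def)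
    have dn: "d \<le> n" using sub[OF B'(1)] B'(3) by auto
    show False
    proof (cases "n \<in> B")
      case True
      then have "n \<notin> B'" using L B B' \<open>B \<noteq> B'\<close> by blast
      then have "(b, d) \<in> M" using pair[OF B'(1) _ B'(2,3)] ord by simp
      moreover have "nei c \<and> (\<forall>j. (c, j) \<notin> M)"
        using L[OF B(1) True] B(3) ord dn by (auto simp: L_def)
      ultimately show False using M6[of b d c] ord by blast
    next
      case False
      then have ac: "(a, c) \<in> M" using pair[OF B(1) _ B(2,3)] ord by simp
      show False
      proof (cases "n \<in> B'")
        case True
        have "nei b \<and> (\<forall>j. (b, j) \<notin> M)"
          using L[OF B'(1) True] B'(2) ord dn by (auto simp: L_def)
        then show False using M6[OF ac] ord by blast
      next
        case False
        then have "(b, d) \<in> M" using pair[OF B'(1) _ B'(2,3)] ord by simp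
        then show False using M5[OF ac] ord by blast
      qed
    qed
  qed
  then have Phi: "(P, l) \<in> Phi n" using Psi by (simp add: Phi_def)
  have arc: "arc n P i j \<longleftrightarrow> (i, j) \<in> M" for i j
  proof
    assume "arc n P i j"
    then show "(i, j) \<in> M" using pair[of "{i, j}" i j] by (auto simp: arc_def)
  next
    assume "(i, j) \<in> M"
    then show "arc n P i j" using Mn[of i j] by (auto simp: arc_def P_def P2_def)
  qed
  have single: "\<not> nei i \<and> \<not> bo i \<and> l {i} = (if Theta i \<in> C then LTheta else LXi')" if "{i} \<in> P" "i \<noteq> n" for i
    using others[of "{i}"] that card_P2(1)[of "{i}"] by (auto simp: l_def P1_def)
  have "(Theta i \<in> lead_monom n (P, l) \<longleftrightarrow> Theta i \<in> C) \<and> (Xi' i \<in> lead_monom n (P, l) \<longleftrightarrow> Xi' i \<in> C)" for i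
  proof (cases "i \<in> {1..n}")
    case True
    from Psi True show ?thesis
    proof (cases rule: lead_monom_cases)
      case (last B)
      then have "i \<in> L" using uniq[of B L n] nL by (auto simp: P_def)
      then have "nei i" using range[of n] range[of i] by (auto simp: L_def nei_def)
      then show ?thesis using last by (simp add: nei_def)
    next
      case (left j)
      then show ?thesis using Mn(5)[of i j] by (simp add: arc nei_def)
    next
      case (right j)
      then show ?thesis using Mn(6)[of j i] by (simp add: arc bo_def)
    next
      case theta
      then show ?thesis using single[of i] by (auto simp: nei_def bo_def split: if_splits)
    next
      case xi
      then show ?thesis using single[of i] by (auto simp: nei_def bo_def split: if_splits)
    qed
  next
    case False
    have "Theta i \<notin> lead_monom n (P, l) \<and> Xi' i \<notin> lead_monom n (P, l)"
    proof -
      have "i \<notin> B" if "B \<in> P" for B using sub[OF that] False by blast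
      then show ?thesis unfolding lead_monom_def lead_def by auto
    qed
    then show ?thesis using range[of i] False by auto
  qed
  moreover have "Xi i \<notin> lead_monom n (P, l)" "Xi i \<notin> C" for i
    using assms(2) by (auto simp: lead_monom_def lead_def red_gens_def)
  ultimately have "g \<in> lead_monom n (P, l) \<longleftrightarrow> g \<in> C" for g
    by (cases g) auto
  then show ?thesis using that Phi by blast
qed

subsection \<open>Homomorphisms and ideals of exterior algebras\<close>

lemma homogeneous_sum:
  assumes "\<And>i. i \<in> I \<Longrightarrow> homogeneous d (f i)"
  shows "homogeneous d (\<lambda>A. \<Sum>i\<in>I. c i * f i A)"
proof -
  have "(\<Sum>i\<in>I. c i * f i A) = 0" if "card A \<noteq> d" for A
    using assms that by (intro sum.neutral) (auto simp: homogeneous_def)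
  then show ?thesis unfolding homogeneous_def by blast
qed

lemma homogeneous_diff:
  assumes "homogeneous d f" "homogeneous d g"
  shows "homogeneous d (\<lambda>A. f A - g A)"
  using assms unfolding homogeneous_def by (metis diff_self)

lemma homogeneous_scale: "homogeneous d f \<Longrightarrow> homogeneous d (\<lambda>A. c * f A)"
  by (simp add: homogeneous_def)

lemma ext_mult_diff_left: "ext_mult (\<lambda>A. f A - g A) h = (\<lambda>C. ext_mult f h C - ext_mult g h C)"
  by (simp add: ext_mult_def algebra_simps sum_subtractf)

lemma ext_mult_diff_right: "ext_mult h (\<lambda>A. f A - g A) = (\<lambda>C. ext_mult h f C - ext_mult h g C)"
  by (simp add: ext_mult_def algebra_simps sum_subtractf)

lemma ext_one_closed: "ext_one \<in> carrier (exterior S)"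
  by (simp add: exterior_def ext_one_def)

lemma ext_monom_closed: "A \<subseteq> S \<Longrightarrow> ext_monom A \<in> carrier (exterior S)"
  by (simp add: exterior_def ext_monom_def)

lemma ext_zero_closed: "(\<lambda>A. 0) \<in> carrier (exterior S)"
  by (simp add: exterior_def)

lemma ext_diff_closed:
  assumes "f \<in> carrier (exterior S)" "g \<in> carrier (exterior S)"
  shows "(\<lambda>A. f A - g A) \<in> carrier (exterior S)"
  using assms unfolding mem_carrier_exterior by (metis diff_self)

lemma ext_scale_closed: "f \<in> carrier (exterior S) \<Longrightarrow> (\<lambda>A. c * f A) \<in> carrier (exterior S)"
  by (simp add: mem_carrier_exterior)

lemma ext_image_closed:
  assumes "finite T" "finite A" "\<And>a. a \<in> A \<Longrightarrow> \<phi> a \<in> carrier (exterior T)"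
  shows "ext_image \<phi> A \<in> carrier (exterior T)"
  using assms(2,3)
proof (induction A rule: finite_linorder_min_induct)
  case (insert a A)
  then show ?case
    using assms(1) by (simp add: ext_image_insert_less ext_mult_closed)
qed (simp add: ext_image_empty ext_one_closed)

lemma ext_hom_fun_eq:
  assumes "finite S" "f \<in> carrier (exterior S)"
  shows "ext_hom \<phi> f = (\<lambda>C. \<Sum>A\<in>Pow S. f A * ext_image \<phi> A C)"
  using ext_hom_eq[OF assms] by blast

lemma ext_hom_closed:
  assumes "finite S" "finite T" "f \<in> carrier (exterior S)"
    and "\<And>a. a \<in> S \<Longrightarrow> \<phi> a \<in> carrier (exterior T)"
  shows "ext_hom \<phi> f \<in> carrier (exterior T)"
  unfolding ext_hom_fun_eq[OF assms(1,3)]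
  using assms by (intro ext_sum_closed ext_image_closed) (auto intro: finite_subset)

lemma ext_image_cong:
  assumes "finite A" "\<And>a. a \<in> A \<Longrightarrow> \<phi> a = \<psi> a"
  shows "ext_image \<phi> A = ext_image \<psi> A"
proof -
  have "map \<phi> (sorted_list_of_set A) = map \<psi> (sorted_list_of_set A)"
    using assms by simp
  then show ?thesis by (simp only: ext_image_def)
qed

lemma ext_hom_cong:
  assumes "finite S" "f \<in> carrier (exterior S)" "\<And>a. a \<in> S \<Longrightarrow> \<phi> a = \<psi> a"
  shows "ext_hom \<phi> f = ext_hom \<psi> f"
proof -
  have "ext_image \<phi> A = ext_image \<psi> A" if "A \<subseteq> S" for A
    using assms(1,3) that by (intro ext_image_cong) (auto intro: finite_subset)
  then show ?thesis
    by (simp add: ext_hom_fun_eq[OF assms(1,2)])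
qed

lemma ext_hom_ext_gen:
  assumes "finite S" "f \<in> carrier (exterior S)"
  shows "ext_hom ext_gen f = f"
proof
  fix C
  have "ext_hom ext_gen f C = (\<Sum>A\<in>Pow S. if A = C then f C else 0)"
    unfolding ext_hom_eq[OF assms]
    using finite_subset[OF _ assms(1)] by (intro sum.cong) (auto simp: ext_image_gen ext_monom_def)
  then show "ext_hom ext_gen f C = f C"
    using assms by (auto simp: mem_carrier_exterior)
qed

lemma ext_hom_image:
  assumes "finite A" "finite T" "\<And>a. a \<in> A \<Longrightarrow> \<psi> a \<in> carrier (exterior T)"
    and "\<And>b. b \<in> T \<Longrightarrow> homogeneous 1 (\<phi> b)"
  shows "ext_hom \<phi> (ext_image \<psi> A) = ext_image (\<lambda>a. ext_hom \<phi> (\<psi> a)) A"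
  using assms(1,3)
proof (induction A rule: finite_linorder_min_induct)
  case empty
  then show ?case
    by (simp add: ext_image_empty ext_one_eq_monom ext_hom_monom)
next
  case (insert a A)
  then have "ext_image \<psi> A \<in> carrier (exterior T)"
    using assms(2) by (intro ext_image_closed) auto
  then show ?case
    using insert assms by (simp add: ext_image_insert_less ext_hom_mult[of T])
qed

lemma ext_hom_ext_hom:
  assumes "finite S" "finite T" "f \<in> carrier (exterior S)"
    and "\<And>a. a \<in> S \<Longrightarrow> \<psi> a \<in> carrier (exterior T)"
    and "\<And>b. b \<in> T \<Longrightarrow> homogeneous 1 (\<phi> b)"
  shows "ext_hom \<phi> (ext_hom \<psi> f) = ext_hom (\<lambda>a. ext_hom \<phi> (\<psi> a)) f"
proof -
  have sub: "finite A" "\<And>a. a \<in> A \<Longrightarrow> \<psi> a \<in> carrier (exterior T)" if "A \<in> Pow S" for A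
    using that assms finite_subset by auto
  have "ext_hom \<phi> (ext_hom \<psi> f) = (\<lambda>C. \<Sum>A\<in>Pow S. f A * ext_hom \<phi> (ext_image \<psi> A) C)"
    unfolding ext_hom_fun_eq[OF assms(1,3)]
    using sub assms(2) by (intro ext_hom_sum[of T] ext_image_closed) auto
  also have "\<dots> = (\<lambda>C. \<Sum>A\<in>Pow S. f A * ext_image (\<lambda>a. ext_hom \<phi> (\<psi> a)) A C)"
  proof -
    have "ext_hom \<phi> (ext_image \<psi> A) = ext_image (\<lambda>a. ext_hom \<phi> (\<psi> a)) A" if "A \<in> Pow S" for A
      using sub[OF that] assms(2,5) by (intro ext_hom_image)
    then show ?thesis by simp
  qed
  finally show ?thesis
    unfolding ext_hom_fun_eq[OF assms(1,3)] .
qed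

lemma ext_hom_diff:
  assumes "finite S" "f \<in> carrier (exterior S)" "g \<in> carrier (exterior S)"
  shows "ext_hom \<phi> (\<lambda>A. f A - g A) = (\<lambda>C. ext_hom \<phi> f C - ext_hom \<phi> g C)"
  using assms by (simp add: ext_hom_fun_eq[of S] ext_diff_closed left_diff_distrib sum_subtractf)

lemma ext_hom_add:
  assumes "finite S" "f \<in> carrier (exterior S)" "g \<in> carrier (exterior S)"
  shows "ext_hom \<phi> (\<lambda>A. f A + g A) = (\<lambda>C. ext_hom \<phi> f C + ext_hom \<phi> g C)"
proof -
  have "(\<lambda>A. f A + g A) \<in> carrier (exterior S)"
    using assms unfolding mem_carrier_exterior by (metis add.left_neutral)
  then show ?thesis
    using assms by (simp add: ext_hom_fun_eq[of S] distrib_right sum.distrib)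
qed

text \<open>Scalars act as multiples of \<open>ext_one\<close>, so ring ideals are closed under
  negation and scaling and are therefore subspaces.\<close>

lemma ext_mult_const:
  assumes "finite S" "f \<in> carrier (exterior S)"
  shows "ext_mult (\<lambda>A. c * ext_one A) f = (\<lambda>C. c * f C)"
proof -
  have "finite A" if "f A \<noteq> 0" for A
    by (rule finite_subset[OF _ assms(1)]) (use assms(2) that in \<open>simp add: mem_carrier_exterior\<close>)
  then show ?thesis by (simp add: ext_mult_scale_left ext_one_mult)
qed

lemma ext_const_closed: "(\<lambda>A. c * ext_one A) \<in> carrier (exterior S)"
  by (simp add: exterior_def ext_one_def)

lemma exterior_idealI:
  assumes "finite S" "I \<subseteq> carrier (exterior S)" "(\<lambda>A. 0) \<in> I"
    and add: "\<And>f g. f \<in> I \<Longrightarrow> g \<in> I \<Longrightarrow> (\<lambda>A. f A + g A) \<in> I"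
    and left: "\<And>a f. a \<in> carrier (exterior S) \<Longrightarrow> f \<in> I \<Longrightarrow> ext_mult a f \<in> I"
    and right: "\<And>a f. a \<in> carrier (exterior S) \<Longrightarrow> f \<in> I \<Longrightarrow> ext_mult f a \<in> I"
  shows "ideal I (exterior S)"
proof (rule idealI)
  interpret ring "exterior S" using assms(1) by (rule ring_exterior)
  show "ring (exterior S)" by (rule ring_axioms)
  show "subgroup I (add_monoid (exterior S))"
  proof (rule add.subgroupI)
    show "I \<subseteq> carrier (exterior S)" "I \<noteq> {}" using assms by auto
    show "f \<oplus>\<^bsub>exterior S\<^esub> g \<in> I" if "f \<in> I" "g \<in> I" for f g
      using add that by (simp add: exterior_def)
    show "\<ominus>\<^bsub>exterior S\<^esub> f \<in> I" if "f \<in> I" for f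
    proof -
      have f: "f \<in> carrier (exterior S)" using that assms(2) by blast
      have "ext_mult (\<lambda>A. - 1 * ext_one A) f \<in> I"
        using left[OF ext_const_closed that] .
      then have "(\<lambda>C. - f C) \<in> I"
        using ext_mult_const[OF assms(1) f, of "-1"] by simp
      moreover have "\<ominus>\<^bsub>exterior S\<^esub> f = (\<lambda>C. - f C)"
        using f by (intro minus_equality) (auto simp: exterior_def)
      ultimately show ?thesis by simp
    qed
  qed
qed (use left right in \<open>auto simp: exterior_def\<close>)

context
  fixes S :: "'g::linorder set" and I
  assumes fin: "finite S" and ideal: "ideal I (exterior S)"
begin

lemma ideal_carrier: "f \<in> I \<Longrightarrow> f \<in> carrier (exterior S)"
  by (rule additive_subgroup.a_Hcarr[OF ideal.axioms(1)[OF ideal]])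

lemma ideal_zero: "(\<lambda>A. 0) \<in> I"
  using additive_subgroup.zero_closed[OF ideal.axioms(1)[OF ideal]] by (simp add: exterior_def)

lemma ideal_add: "f \<in> I \<Longrightarrow> g \<in> I \<Longrightarrow> (\<lambda>A. f A + g A) \<in> I"
  using additive_subgroup.a_closed[OF ideal.axioms(1)[OF ideal], of f g] by (simp add: exterior_def)

lemma ideal_left: "f \<in> I \<Longrightarrow> a \<in> carrier (exterior S) \<Longrightarrow> ext_mult a f \<in> I"
  using ideal.I_l_closed[OF ideal, of f a] by (simp add: exterior_def)

lemma ideal_right: "f \<in> I \<Longrightarrow> a \<in> carrier (exterior S) \<Longrightarrow> ext_mult f a \<in> I"
  using ideal.I_r_closed[OF ideal, of f a] by (simp add: exterior_def)

lemma ideal_scale: "f \<in> I \<Longrightarrow> (\<lambda>A. c * f A) \<in> I"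
  using ideal_left[OF _ ext_const_closed] ext_mult_const[OF fin ideal_carrier] by metis

lemma ideal_diff: "f \<in> I \<Longrightarrow> g \<in> I \<Longrightarrow> (\<lambda>A. f A - g A) \<in> I"
  using ideal_add[OF _ ideal_scale[of g "-1"], of f] by simp

lemma ideal_sum: "(\<And>i. i \<in> J \<Longrightarrow> f i \<in> I) \<Longrightarrow> (\<lambda>A. \<Sum>i\<in>J. c i * f i A) \<in> I"
proof (induction J rule: infinite_finite_induct)
  case (insert i J)
  then show ?case
    using ideal_add[OF ideal_scale[of "f i" "c i"], of "\<lambda>A. \<Sum>i\<in>J. c i * f i A"] by simp
qed (simp_all add: ideal_zero)

text \<open>Telescoping: a difference of products is the difference of the first factors times one
  tail, plus a first factor times the difference of the tails.\<close>

lemma ext_image_congruent: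
  assumes "finite A" "\<And>a. a \<in> A \<Longrightarrow> \<phi> a \<in> carrier (exterior S) \<and> \<psi> a \<in> carrier (exterior S)"
    and "\<And>a. a \<in> A \<Longrightarrow> (\<lambda>C. \<phi> a C - \<psi> a C) \<in> I"
  shows "(\<lambda>C. ext_image \<phi> A C - ext_image \<psi> A C) \<in> I"
  using assms
proof (induction A rule: finite_linorder_min_induct)
  case empty
  then show ?case by (simp add: ext_image_empty ideal_zero)
next
  case (insert a A)
  have "ext_mult (\<lambda>C. \<phi> a C - \<psi> a C) (ext_image \<phi> A) \<in> I"
    using insert fin by (intro ideal_right ext_image_closed) auto
  moreover have "ext_mult (\<psi> a) (\<lambda>C. ext_image \<phi> A C - ext_image \<psi> A C) \<in> I"
    using insert by (intro ideal_left) auto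
  ultimately have "(\<lambda>C. ext_mult (\<phi> a) (ext_image \<phi> A) C - ext_mult (\<psi> a) (ext_image \<phi> A) C +
      (ext_mult (\<psi> a) (ext_image \<phi> A) C - ext_mult (\<psi> a) (ext_image \<psi> A) C)) \<in> I"
    unfolding ext_mult_diff_left ext_mult_diff_right by (rule ideal_add)
  then show ?case
    using insert by (simp add: ext_image_insert_less)
qed

lemma ext_hom_congruent:
  assumes "finite T" "f \<in> carrier (exterior T)"
    and "\<And>a. a \<in> T \<Longrightarrow> \<phi> a \<in> carrier (exterior S) \<and> \<psi> a \<in> carrier (exterior S)"
    and "\<And>a. a \<in> T \<Longrightarrow> (\<lambda>C. \<phi> a C - \<psi> a C) \<in> I"
  shows "(\<lambda>C. ext_hom \<phi> f C - ext_hom \<psi> f C) \<in> I"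
proof -
  have "(\<lambda>C. \<Sum>A\<in>Pow T. f A * (ext_image \<phi> A C - ext_image \<psi> A C)) \<in> I"
  proof (intro ideal_sum ext_image_congruent)
    fix A assume "A \<in> Pow T"
    then show "finite A" "\<And>a. a \<in> A \<Longrightarrow> \<phi> a \<in> carrier (exterior S) \<and> \<psi> a \<in> carrier (exterior S)"
      "\<And>a. a \<in> A \<Longrightarrow> (\<lambda>C. \<phi> a C - \<psi> a C) \<in> I"
      using assms finite_subset by blast+
  qed
  then show ?thesis
    by (simp add: ext_hom_fun_eq[OF assms(1,2)] right_diff_distrib sum_subtractf)
qed

end

text \<open>With this, inclusions between generated ideals are checked on generators alone: the
  preimage is an ideal, and a generated ideal is the least one.\<close>

lemma ideal_vimage:
  assumes "finite S" "finite T" "ideal I (exterior T)"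
    and \<phi>: "\<And>a. a \<in> S \<Longrightarrow> homogeneous 1 (\<phi> a) \<and> \<phi> a \<in> carrier (exterior T)"
  shows "ideal {f \<in> carrier (exterior S). ext_hom \<phi> f \<in> I} (exterior S)" (is "ideal ?K _")
proof (rule exterior_idealI[OF assms(1)])
  have closed: "ext_hom \<phi> f \<in> carrier (exterior T)" if "f \<in> carrier (exterior S)" for f
    using ext_hom_closed[OF assms(1,2) that] \<phi> by blast
  have mult: "ext_hom \<phi> (ext_mult f g) = ext_mult (ext_hom \<phi> f) (ext_hom \<phi> g)"
    if "f \<in> carrier (exterior S)" "g \<in> carrier (exterior S)" for f g
    using ext_hom_mult[OF assms(1) that] \<phi> by blast
  show "(\<lambda>A. 0) \<in> ?K"
    using ideal_zero[OF assms(2,3)] by (simp add: ext_hom_def ext_zero_closed)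
  fix f g assume f: "f \<in> ?K"
  show "(\<lambda>A. f A + g A) \<in> ?K"
    if "g \<in> ?K"
  proof -
    have "(\<lambda>A. f A + g A) \<in> carrier (exterior S)"
      using f that ext_sum_closed unfolding mem_carrier_exterior by (metis (mono_tags, lifting) add.left_neutral mem_Collect_eq mem_carrier_exterior)
    then show ?thesis
      using f that ideal_add[OF assms(2,3)] by (simp add: ext_hom_add[OF assms(1)])
  qed
  assume g: "g \<in> carrier (exterior S)"
  show "ext_mult g f \<in> ?K"
    "ext_mult f g \<in> ?K"
    using f g ideal_left[OF assms(2,3) _ closed[OF g]] ideal_right[OF assms(2,3) _ closed[OF g]]
    by (auto simp: mult intro: ext_mult_closed[OF assms(1)])
qed auto

subsection \<open>Invariants\<close>

definition full_gens :: "nat \<Rightarrow> gen set" where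
  "full_gens n = Theta ` {1..n} \<union> Xi ` {1..n}"

lemma finite_full_gens: "finite (full_gens n)"
  by (simp add: full_gens_def)

lemma ext_full_eq: "ext_full n = exterior (full_gens n)"
  by (simp add: ext_full_def full_gens_def)

definition perm_gen :: "(nat \<Rightarrow> nat) \<Rightarrow> gen \<Rightarrow> ext" where
  "perm_gen w g = (case g of Theta i \<Rightarrow> \<theta> (w i) | Xi i \<Rightarrow> \<xi> (w i) | Xi' i \<Rightarrow> \<xi>' i)"

lemma perm_act_eq: "perm_act w = ext_hom (perm_gen w)"
  unfolding perm_act_def perm_gen_def by simp

lemma homogeneous_perm_gen: "homogeneous 1 (perm_gen w g)"
  unfolding perm_gen_def using homogeneous_gen by (auto split: gen.split)

lemma perm_gen_closed:
  assumes "w permutes {1..n}" "g \<in> full_gens n"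
  shows "perm_gen w g \<in> carrier (ext_full n)"
proof -
  obtain i where "g = Theta i \<or> g = Xi i" "i \<in> {1..n}"
    using assms(2) by (auto simp: full_gens_def)
  moreover have "w i \<in> {1..n}"
    using permutes_in_image[OF assms(1)] calculation(2) by blast
  ultimately have "\<exists>h\<in>full_gens n. perm_gen w g = ext_gen h"
    by (auto simp: perm_gen_def full_gens_def)
  then show ?thesis
    unfolding ext_full_eq using ext_gen_closed by fastforce
qed

lemma perm_act_closed:
  assumes "w permutes {1..n}" "f \<in> carrier (ext_full n)"
  shows "perm_act w f \<in> carrier (ext_full n)"
  using assms perm_gen_closed unfolding perm_act_eq ext_full_eq
  by (intro ext_hom_closed[of "full_gens n"] finite_full_gens) auto

lemma perm_act_mult:
  assumes "f \<in> carrier (ext_full n)" "g \<in> carrier (ext_full n)"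
  shows "perm_act w (ext_mult f g) = ext_mult (perm_act w f) (perm_act w g)"
  using assms homogeneous_perm_gen unfolding perm_act_eq ext_full_eq
  by (intro ext_hom_mult[of "full_gens n"] finite_full_gens)

lemma perm_act_compose:
  assumes "v permutes {1..n}" "f \<in> carrier (ext_full n)"
  shows "perm_act w (perm_act v f) = perm_act (w \<circ> v) f"
proof -
  have "perm_act w (perm_act v f) = ext_hom (\<lambda>a. ext_hom (perm_gen w) (perm_gen v a)) f"
    unfolding perm_act_eq using assms perm_gen_closed homogeneous_perm_gen
    by (intro ext_hom_ext_hom[of "full_gens n" "full_gens n"] finite_full_gens) (auto simp: ext_full_eq)
  moreover have gen: "ext_hom (perm_gen w) (ext_gen h) = perm_gen w h" for h
    by (rule ext_hom_gen[OF homogeneous_perm_gen])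
  moreover have "ext_hom (\<lambda>a. ext_hom (perm_gen w) (perm_gen v a)) f = perm_act (w \<circ> v) f"
    unfolding perm_act_eq using assms(2) homogeneous_perm_gen
    by (intro ext_hom_cong[of "full_gens n"] finite_full_gens)
      (auto simp: ext_full_eq full_gens_def perm_gen_def[of v] perm_gen_def[of "w \<circ> v"] gen, auto simp: perm_gen_def)
  ultimately show ?thesis by simp
qed

text \<open>The factor of a monomial that involves index \<open>k\<close>: one of \<open>\<theta>\<^sub>k, \<xi>\<^sub>k, \<theta>\<^sub>k \<xi>\<^sub>k\<close>.\<close>

definition loc :: "bool \<times> bool \<Rightarrow> nat \<Rightarrow> gen set" where
  "loc tx k = (if fst tx then {Theta k} else {}) \<union> (if snd tx then {Xi k} else {})"

text \<open>The polarized power sums. The pair \<open>(False, False)\<close> gives the constant n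
  and is therefore excluded where elements without constant term are meant.\<close>

definition power_sum :: "nat \<Rightarrow> bool \<times> bool \<Rightarrow> ext" where
  "power_sum n tx = (\<lambda>C. \<Sum>k\<in>{1..n}. ext_monom (loc tx k) C)"

lemma Xi_gt_Theta: "Theta i < Xi j"
  by (simp add: less_gen_def)

lemma theta_xi_monom: "ext_mult (\<theta> k) (\<xi> j) = ext_monom {Theta k, Xi j}"
  using gen_sign_minimal[of "{Xi j}" "Theta k"] Xi_gt_Theta
  by (simp add: ext_gen_eq_monom[of "Xi j"] ext_gen_mult_monom)

lemma perm_act_loc: "perm_act w (ext_monom (loc tx k)) = ext_monom (loc tx (w k))"
proof -
  have "perm_act w (ext_monom {Theta k, Xi k}) = ext_monom {Theta (w k), Xi (w k)}"
    using ext_image_insert_less[of "{Xi k}" "Theta k" "perm_gen w"] Xi_gt_Theta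
      ext_image_singleton[of "perm_gen w" "Xi k", OF homogeneous_perm_gen]
    by (simp add: perm_act_eq ext_hom_monom) (simp add: perm_gen_def theta_xi_monom)
  moreover have "perm_act w (ext_monom {g}) = perm_gen w g" for g
    using homogeneous_perm_gen by (simp add: perm_act_eq ext_hom_monom ext_image_singleton)
  moreover have "perm_act w (ext_monom {}) = ext_monom {}"
    by (simp add: perm_act_eq ext_hom_monom ext_image_empty ext_one_eq_monom)
  ultimately show ?thesis
    by (auto simp: loc_def perm_gen_def ext_gen_eq_monom insert_commute)
qed

lemma loc_closed: "k \<in> {1..n} \<Longrightarrow> ext_monom (loc tx k) \<in> carrier (ext_full n)"
  unfolding ext_full_eq by (intro ext_monom_closed) (auto simp: loc_def full_gens_def)

lemma power_sum_closed: "power_sum n tx \<in> carrier (ext_full n)"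
  using ext_sum_closed[of "{1..n}" "\<lambda>k. ext_monom (loc tx k)" "full_gens n" "\<lambda>_. 1"] loc_closed
  by (simp add: power_sum_def ext_full_eq)

lemma perm_act_power_sum:
  assumes "w permutes {1..n}"
  shows "perm_act w (power_sum n tx) = power_sum n tx"
proof -
  have "perm_act w (power_sum n tx) = (\<lambda>C. \<Sum>k\<in>{1..n}. 1 * perm_act w (ext_monom (loc tx k)) C)"
    using ext_hom_sum[OF finite_full_gens, of "{1..n}" "\<lambda>k. ext_monom (loc tx k)" n "perm_gen w" "\<lambda>_. 1"] loc_closed
    by (simp add: power_sum_def perm_act_eq ext_full_eq)
  also have "\<dots> = (\<lambda>C. \<Sum>k\<in>{1..n}. ext_monom (loc tx (w k)) C)"
    by (simp add: perm_act_loc)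
  also have "\<dots> = power_sum n tx"
    unfolding power_sum_def using sum.permute[OF assms, of "\<lambda>k. ext_monom (loc tx k) C" for C]
    by (simp add: o_def)
  finally show ?thesis .
qed

lemma power_sum_invariant:
  assumes "tx \<noteq> (False, False)" shows "power_sum n tx \<in> pos_invariants n"
proof -
  have "loc tx k \<noteq> {}" for k using assms by (cases tx) (auto simp: loc_def)
  then have "power_sum n tx {} = 0" by (simp add: power_sum_def ext_monom_def eq_commute[of "{}"])
  then show ?thesis
    using power_sum_closed perm_act_power_sum by (simp add: pos_invariants_def)
qed

lemma ext_monom_mult:
  assumes "finite A" "finite B"
  shows "ext_mult (ext_monom A) (ext_monom B) =
    (if A \<inter> B = {} then (\<lambda>C. ext_sign A B * ext_monom (A \<union> B) C) else (\<lambda>C. 0))"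
  using ext_mult_image[of A B ext_gen, OF assms homogeneous_gen] assms by (simp add: ext_image_gen)

section \<open>Averaging over the symmetric group\<close>

definition symmetrize :: "nat \<Rightarrow> ext \<Rightarrow> ext" where
  "symmetrize n f = (\<lambda>C. \<Sum>w | w permutes {1..n}. perm_act w f C)"

lemma symmetrize_closed:
  assumes "f \<in> carrier (ext_full n)" shows "symmetrize n f \<in> carrier (ext_full n)"
  using ext_sum_closed[of "{w. w permutes {1..n}}" "\<lambda>w. perm_act w f" "full_gens n" "\<lambda>_. 1"]
    perm_act_closed assms by (simp add: symmetrize_def ext_full_eq)

lemma symmetrize_sum:
  assumes "\<And>i. i \<in> I \<Longrightarrow> f i \<in> carrier (ext_full n)"
  shows "symmetrize n (\<lambda>A. \<Sum>i\<in>I. c i * f i A) = (\<lambda>C. \<Sum>i\<in>I. c i * symmetrize n (f i) C)"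
proof
  fix C
  have "perm_act w (\<lambda>A. \<Sum>i\<in>I. c i * f i A) = (\<lambda>C. \<Sum>i\<in>I. c i * perm_act w (f i) C)" for w
    unfolding perm_act_eq by (rule ext_hom_sum[OF finite_full_gens]) (use assms in \<open>simp add: ext_full_eq\<close>)
  then have "symmetrize n (\<lambda>A. \<Sum>i\<in>I. c i * f i A) C = (\<Sum>w | w permutes {1..n}. \<Sum>i\<in>I. c i * perm_act w (f i) C)"
    by (simp add: symmetrize_def)
  then show "symmetrize n (\<lambda>A. \<Sum>i\<in>I. c i * f i A) C = (\<Sum>i\<in>I. c i * symmetrize n (f i) C)"
    by (subst (asm) sum.swap) (simp add: symmetrize_def sum_distrib_left)
qed

lemma symmetrize_perm_act:
  assumes "v permutes {1..n}" "f \<in> carrier (ext_full n)"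
  shows "symmetrize n (perm_act v f) = symmetrize n f"
proof
  fix C
  have "symmetrize n (perm_act v f) C = (\<Sum>w | w permutes {1..n}. perm_act (w \<circ> v) f C)"
    unfolding symmetrize_def perm_act_compose[OF assms] ..
  also have "\<dots> = symmetrize n f C"
    unfolding symmetrize_def
    by (rule sum.reindex_bij_witness[where j = "\<lambda>w. w \<circ> v" and i = "\<lambda>w. w \<circ> inv_into UNIV v"])
      (use assms(1) in \<open>auto simp: permutes_compose permutes_inv permutes_inv_o o_assoc[symmetric]\<close>)
  finally show "symmetrize n (perm_act v f) C = symmetrize n f C" .
qed

lemma symmetrize_power_sum_mult:
  assumes "f \<in> carrier (ext_full n)"
  shows "symmetrize n (ext_mult (power_sum n tx) f) = ext_mult (power_sum n tx) (symmetrize n f)"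
proof
  fix C
  have "symmetrize n (ext_mult (power_sum n tx) f) C =
      (\<Sum>w | w permutes {1..n}. 1 * ext_mult (power_sum n tx) (perm_act w f) C)"
    unfolding symmetrize_def
    by (intro sum.cong refl) (simp add: perm_act_mult[OF power_sum_closed assms] perm_act_power_sum)
  then show "symmetrize n (ext_mult (power_sum n tx) f) C = ext_mult (power_sum n tx) (symmetrize n f) C"
    unfolding ext_mult_sum_right[symmetric] by (simp add: symmetrize_def)
qed

text \<open>
  Multiplying the symmetrization of \<open>u\<close> by a power sum yields the symmetrization of \<open>a\<^sub>i u\<close>, for
  an index \<open>i\<close> that does not occur in \<open>u\<close>, up to monomials that involve only the indices of \<open>u\<close>.
\<close>

lemma symmetrize_monom_mem:
  assumes K: "ideal K (ext_full n)" and ps: "\<And>tx. tx \<noteq> (False, False) \<Longrightarrow> power_sum n tx \<in> K"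
    and "A \<subseteq> full_gens n" "A \<noteq> {}"
  shows "symmetrize n (ext_monom A) \<in> K"
  using assms(3,4)
proof (induction "card (gen_index ` A)" arbitrary: A rule: less_induct)
  case less
  note K' = finite_full_gens K[unfolded ext_full_eq]
  have fin: "finite B" if "B \<subseteq> full_gens n" for B
    using that finite_full_gens finite_subset by blast
  obtain g where g: "g \<in> A" using less by blast
  define i where "i = gen_index g"
  \<comment> \<open>The shape of the factor at index i selects the power sum by which the rest of
    the monomial is multiplied.\<close>
  define tx where "tx = (Theta i \<in> A, Xi i \<in> A)"
  define A' where "A' = {h \<in> A. gen_index h \<noteq> i}"
  have i: "i \<in> {1..n}" using g less.prems by (auto simp: i_def full_gens_def)
  have A: "A = loc tx i \<union> A'" "loc tx i \<inter> A' = {}"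
    using less.prems by (auto simp: loc_def tx_def A'_def full_gens_def)
  have tx: "tx \<noteq> (False, False)"
    using g less.prems by (auto simp: tx_def i_def full_gens_def)
  have A'_sub: "A' \<subseteq> full_gens n" using less.prems by (auto simp: A'_def)
  have loc_sub: "loc tx k \<subseteq> full_gens n" if "k \<in> {1..n}" for k
    using that by (auto simp: loc_def full_gens_def)
  have finloc: "finite (loc tx k)" for k by (simp add: loc_def)
  let ?u = "ext_monom A'"
  define a where "a k = ext_mult (ext_monom (loc tx k)) ?u" for k
  have u: "?u \<in> carrier (ext_full n)" unfolding ext_full_eq using A'_sub by (rule ext_monom_closed)
  have a_closed: "a k \<in> carrier (ext_full n)" if "k \<in> {1..n}" for k
    using u loc_closed[OF that] unfolding a_def ext_full_eq by (intro ext_mult_closed finite_full_gens)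
  have "ext_mult (power_sum n tx) ?u = (\<lambda>C. \<Sum>k\<in>{1..n}. 1 * a k C)"
    using ext_mult_sum_left[of "\<lambda>_. 1" "\<lambda>k. ext_monom (loc tx k)" "{1..n}" ?u]
    by (simp add: power_sum_def a_def fun_eq_iff)
  then have "symmetrize n (\<lambda>C. \<Sum>k\<in>{1..n}. 1 * a k C) \<in> K"
    using symmetrize_power_sum_mult[OF u] ideal_right[OF K' ps[OF tx]] symmetrize_closed[OF u]
    by (metis ext_full_eq)
  then have total: "(\<lambda>C. \<Sum>k\<in>{1..n}. symmetrize n (a k) C) \<in> K"
    using symmetrize_sum[of "{1..n}" a n "\<lambda>_. 1"] a_closed by simp
  define J where "J = gen_index ` A'"
  have J: "J \<subseteq> {1..n}" "i \<notin> J" "finite J"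
    using A'_sub by (auto simp: J_def full_gens_def A'_def intro: finite_subset)
  \<comment> \<open>Placing the factor at an index already in use either gives 0 or a monomial on
    fewer indices, as i has disappeared; the latter is covered by induction.\<close>
  have in_J: "symmetrize n (a k) \<in> K" if "k \<in> J" for k
  proof (cases "loc tx k \<inter> A' = {}")
    case True
    have k: "k \<in> {1..n}" using that J by blast
    have "gen_index ` (loc tx k \<union> A') \<subseteq> J" using that by (auto simp: loc_def J_def)
    moreover have "gen_index ` A = insert i J"
      using g by (auto simp: J_def A'_def i_def)
    ultimately have "card (gen_index ` (loc tx k \<union> A')) < card (gen_index ` A)"
      using J by (simp add: card_insert_if) (meson card_mono le_imp_less_Suc)
    moreover have "loc tx k \<union> A' \<noteq> {}" using tx by (cases tx) (auto simp: loc_def)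
    ultimately have "symmetrize n (ext_monom (loc tx k \<union> A')) \<in> K"
      using less.hyps loc_sub[OF k] A'_sub by simp
    then have "(\<lambda>C. ext_sign (loc tx k) A' * symmetrize n (ext_monom (loc tx k \<union> A')) C) \<in> K"
      by (rule ideal_scale[OF K'])
    moreover have "a k = (\<lambda>C. \<Sum>j\<in>{k}. ext_sign (loc tx k) A' * ext_monom (loc tx k \<union> A') C)"
      using True finloc fin[OF A'_sub] by (simp add: a_def ext_monom_mult)
    moreover have "ext_monom (loc tx k \<union> A') \<in> carrier (ext_full n)"
      unfolding ext_full_eq using loc_sub[OF k] A'_sub by (intro ext_monom_closed) auto
    ultimately show ?thesis
      using symmetrize_sum[of "{k}" "\<lambda>_. ext_monom (loc tx k \<union> A')" n "\<lambda>_. ext_sign (loc tx k) A'"] by simp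
  next
    case False
    then have "a k = (\<lambda>C. 0)"
      using finloc fin[OF A'_sub] by (simp add: a_def ext_monom_mult)
    then show ?thesis
      using ideal_zero[OF K'] by (simp add: symmetrize_def perm_act_eq ext_hom_def)
  qed
  have out_J: "symmetrize n (a k) = symmetrize n (a i)" if "k \<in> {1..n} - J" for k
  proof -
    \<comment> \<open>The transposition fixes the rest of the monomial, which involves neither i nor
      k, and moves the factor from i to k.\<close>
    define v where "v = transpose i k"
    have v: "v permutes {1..n}" unfolding v_def using i that by (intro permutes_swap_id) auto
    have "perm_act v ?u = ?u"
    proof -
      have "v j = j" if "j \<in> J" for j
        using that \<open>k \<in> {1..n} - J\<close> J(2) by (auto simp: v_def transpose_def)
      then have "perm_gen v h = ext_gen h" if "h \<in> A'" for h
      proof -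
        have "gen_index h \<in> J" using that by (simp add: J_def)
        then show ?thesis
          using \<open>\<And>j. j \<in> J \<Longrightarrow> v j = j\<close>[of "gen_index h"] by (cases h) (simp_all add: perm_gen_def)
      qed
      then have "ext_image (perm_gen v) A' = ext_image ext_gen A'"
        by (intro ext_image_cong fin A'_sub)
      then show ?thesis
        using fin[OF A'_sub] by (simp add: perm_act_eq ext_hom_monom ext_image_gen)
    qed
    then have "perm_act v (a i) = a k"
      unfolding a_def by (simp add: perm_act_mult[OF loc_closed[OF i] u] perm_act_loc v_def)
    then show ?thesis
      using symmetrize_perm_act[OF v a_closed[OF i]] by simp
  qed
  have "(\<Sum>k\<in>{1..n}. symmetrize n (a k) C) =
      of_nat (card ({1..n} - J)) * symmetrize n (a i) C + (\<Sum>k\<in>J. 1 * symmetrize n (a k) C)" for C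
    using J by (subst sum.subset_diff[of J]) (auto simp: out_J)
  then have eq: "(\<lambda>C. of_nat (card ({1..n} - J)) * symmetrize n (a i) C) =
      (\<lambda>C. (\<Sum>k\<in>{1..n}. symmetrize n (a k) C) - (\<Sum>k\<in>J. 1 * symmetrize n (a k) C))"
    by simp
  have "(\<lambda>C. of_nat (card ({1..n} - J)) * symmetrize n (a i) C) \<in> K"
    unfolding eq by (intro ideal_diff[OF K'] total ideal_sum[OF K'] in_J)
  then have "(\<lambda>C. (ext_sign (loc tx i) A' / of_nat (card ({1..n} - J))) *
      (of_nat (card ({1..n} - J)) * symmetrize n (a i) C)) \<in> K"
    by (rule ideal_scale[OF K'])
  moreover have "card ({1..n} - J) \<noteq> 0" using i J by auto
  ultimately have "(\<lambda>C. ext_sign (loc tx i) A' * symmetrize n (a i) C) \<in> K"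
    by simp
  \<comment> \<open>The sign is its own inverse; the one-element sum only fits the shape of
    \<open>symmetrize_sum\<close>.\<close>
  moreover have "ext_monom A = (\<lambda>C. \<Sum>j\<in>{i}. ext_sign (loc tx i) A' * a j C)"
    unfolding a_def ext_monom_mult[OF finloc fin[OF A'_sub]] using A
    by (auto simp: ext_sign_def fun_eq_iff simp flip: power_add mult_2)
  ultimately show ?case
    using symmetrize_sum[of "{i}" a n "\<lambda>_. ext_sign (loc tx i) A'"] a_closed[OF i] by simp
qed

text \<open>An invariant is, up to the order of the group, its own symmetrization, hence a
  combination of symmetrized monomials. The empty monomial drops out because the constant term is
  0.\<close>

lemma pos_invariants_subset:
  assumes K: "ideal K (ext_full n)" and ps: "\<And>tx. tx \<noteq> (False, False) \<Longrightarrow> power_sum n tx \<in> K"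
  shows "pos_invariants n \<subseteq> K"
proof
  fix f assume f: "f \<in> pos_invariants n"
  note K' = finite_full_gens K[unfolded ext_full_eq]
  define N where "N = card {w. w permutes {1..n}}"
  have "N \<noteq> 0" by (simp add: N_def card_permutations)
  have "symmetrize n f = (\<lambda>C. of_nat N * f C)"
    using f by (simp add: symmetrize_def pos_invariants_def N_def)
  moreover have "f = (\<lambda>C. \<Sum>A\<in>Pow (full_gens n). f A * ext_monom A C)"
  proof
    fix C
    have "(\<Sum>A\<in>Pow (full_gens n). f A * ext_monom A C) = (\<Sum>A\<in>Pow (full_gens n). if A = C then f C else 0)"
      by (intro sum.cong) (auto simp: ext_monom_def)
    then show "f C = (\<Sum>A\<in>Pow (full_gens n). f A * ext_monom A C)"
      using f finite_full_gens[of n] by (auto simp: pos_invariants_def ext_full_eq mem_carrier_exterior)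
  qed
  moreover have "symmetrize n (\<lambda>C. \<Sum>A\<in>Pow (full_gens n). f A * ext_monom A C) =
      (\<lambda>C. \<Sum>A\<in>Pow (full_gens n). f A * symmetrize n (ext_monom A) C)"
    by (rule symmetrize_sum) (simp add: ext_full_eq ext_monom_closed)
  ultimately have "(\<lambda>C. of_nat N * f C) = (\<lambda>C. \<Sum>A\<in>Pow (full_gens n). f A * symmetrize n (ext_monom A) C)"
    by metis
  also have "\<dots> = (\<lambda>C. \<Sum>A\<in>Pow (full_gens n) - {{}}. f A * symmetrize n (ext_monom A) C)"
    using f finite_full_gens by (intro ext sum.mono_neutral_right) (auto simp: pos_invariants_def)
  also have "\<dots> \<in> K"
    using symmetrize_monom_mem[OF K ps] by (intro ideal_sum[OF K']) auto
  finally have "(\<lambda>C. (1 / of_nat N) * (of_nat N * f C)) \<in> K"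
    by (rule ideal_scale[OF K'])
  then show "f \<in> K" using \<open>N \<noteq> 0\<close> by simp
qed

subsection \<open>Cosets in exterior algebras\<close>

context
  fixes S :: "'g::linorder set" and I
  assumes fin: "finite S" and ideal: "ideal I (exterior S)"
begin

lemma ext_coset: "I +>\<^bsub>exterior S\<^esub> f = {g. (\<lambda>A. g A - f A) \<in> I}"
proof (intro Set.set_eqI iffI)
  fix g assume "g \<in> I +>\<^bsub>exterior S\<^esub> f"
  then obtain i where "i \<in> I" "g = (\<lambda>A. i A + f A)"
    by (auto simp: a_r_coset_def' exterior_def)
  then show "g \<in> {g. (\<lambda>A. g A - f A) \<in> I}" by simp
next
  fix g assume "g \<in> {g. (\<lambda>A. g A - f A) \<in> I}"
  then show "g \<in> I +>\<^bsub>exterior S\<^esub> f"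
    by (auto simp: a_r_coset_def' exterior_def intro!: bexI[of _ "\<lambda>A. g A - f A"])
qed

lemma ext_coset_eq:
  "I +>\<^bsub>exterior S\<^esub> f = I +>\<^bsub>exterior S\<^esub> g \<longleftrightarrow> (\<lambda>A. f A - g A) \<in> I"
proof
  assume "I +>\<^bsub>exterior S\<^esub> f = I +>\<^bsub>exterior S\<^esub> g"
  moreover have "f \<in> I +>\<^bsub>exterior S\<^esub> f" using ideal_zero[OF fin ideal] by (simp add: ext_coset)
  ultimately show "(\<lambda>A. f A - g A) \<in> I" by (simp add: ext_coset)
next
  assume *: "(\<lambda>A. f A - g A) \<in> I"
  have "(\<lambda>A. h A - f A) \<in> I \<longleftrightarrow> (\<lambda>A. h A - g A) \<in> I" for h
    using ideal_add[OF fin ideal _ *, of "\<lambda>A. h A - f A"] ideal_diff[OF fin ideal _ *, of "\<lambda>A. h A - g A"]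
    by auto
  then show "I +>\<^bsub>exterior S\<^esub> f = I +>\<^bsub>exterior S\<^esub> g" by (simp add: ext_coset)
qed

lemma ext_coset_carrier:
  assumes "f \<in> carrier (exterior S)" "g \<in> I +>\<^bsub>exterior S\<^esub> f"
  shows "g \<in> carrier (exterior S)"
proof -
  have "(\<lambda>A. g A - f A) \<in> carrier (exterior S)"
    using assms(2) ideal_carrier[OF fin ideal] by (simp add: ext_coset)
  then show ?thesis
    using assms(1) unfolding mem_carrier_exterior by (metis diff_0_right)
qed

abbreviation (input) "ext_quot \<equiv> quot_algebra (exterior S) I"

lemma quot_algebra_carrier: "carrier ext_quot = (\<lambda>f. I +>\<^bsub>exterior S\<^esub> f) ` carrier (exterior S)"
  by (auto simp: quot_algebra_def ring.defs FactRing_def A_RCOSETS_def')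

lemma quot_algebra_zero: "\<zero>\<^bsub>ext_quot\<^esub> = I +>\<^bsub>exterior S\<^esub> (\<lambda>A. 0)"
  by (simp add: quot_algebra_def ring.defs FactRing_def ext_coset)

lemma quot_algebra_add:
  assumes "f \<in> carrier (exterior S)" "g \<in> carrier (exterior S)"
  shows "(I +>\<^bsub>exterior S\<^esub> f) \<oplus>\<^bsub>ext_quot\<^esub> (I +>\<^bsub>exterior S\<^esub> g) = I +>\<^bsub>exterior S\<^esub> (\<lambda>A. f A + g A)"
  using abelian_subgroup.a_rcos_sum[OF abelian_subgroupI3[OF ideal.axioms(1)[OF ideal]
      ring.is_abelian_group[OF ring_exterior[OF fin]]] assms]
  by (simp add: quot_algebra_def ring.defs FactRing_def) (simp add: exterior_def)

text \<open>Scaling respects congruence modulo I, so the union that defines the scalar action is a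
  union of copies of one coset.\<close>

lemma quot_algebra_smult:
  assumes "f \<in> carrier (exterior S)"
  shows "c \<odot>\<^bsub>ext_quot\<^esub> (I +>\<^bsub>exterior S\<^esub> f) = I +>\<^bsub>exterior S\<^esub> (\<lambda>A. c * f A)"
proof -
  have "I +>\<^bsub>exterior S\<^esub> (\<lambda>A. c * x A) = I +>\<^bsub>exterior S\<^esub> (\<lambda>A. c * f A)"
    if "x \<in> I +>\<^bsub>exterior S\<^esub> f" for x
    using ideal_scale[OF fin ideal, of "\<lambda>A. x A - f A" c] that
    unfolding ext_coset_eq by (simp add: ext_coset right_diff_distrib)
  moreover have "f \<in> I +>\<^bsub>exterior S\<^esub> f" using ideal_zero[OF fin ideal] by (simp add: ext_coset)
  moreover have "c \<odot>\<^bsub>ext_quot\<^esub> X = (\<Union>x\<in>X. I +>\<^bsub>exterior S\<^esub> (\<lambda>A. c * x A))" for X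
    by (simp add: quot_algebra_def ring.defs) (simp add: exterior_def)
  ultimately show ?thesis by blast
qed

lemma abelian_monoid_quot_algebra: "abelian_monoid ext_quot"
proof -
  interpret R: ring "exterior S Quot I" by (rule ideal.quotient_is_ring[OF ideal])
  show ?thesis
    by (rule abelian_monoidI) (auto simp: quot_algebra_def ring.defs R.add.m_ac)
qed

lemma quot_algebra_finsum:
  assumes "\<And>i. i \<in> J \<Longrightarrow> f i \<in> carrier (exterior S)" "finite J"
  shows "(\<Oplus>\<^bsub>ext_quot\<^esub>i\<in>J. I +>\<^bsub>exterior S\<^esub> f i) = I +>\<^bsub>exterior S\<^esub> (\<lambda>A. \<Sum>i\<in>J. f i A)"
  using assms(2,1)
proof (induction J rule: finite_induct)
  case empty
  then show ?case
    using abelian_monoid.finsum_empty[OF abelian_monoid_quot_algebra] by (simp add: quot_algebra_zero)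
next
  case (insert i J)
  have "(\<lambda>A. \<Sum>i\<in>J. f i A) \<in> carrier (exterior S)"
    using ext_sum_closed[of J f S "\<lambda>_. 1"] insert.prems by simp
  then show ?case
    using insert abelian_monoid.finsum_insert[OF abelian_monoid_quot_algebra, of J i "\<lambda>i. I +>\<^bsub>exterior S\<^esub> f i"]
    by (simp add: quot_algebra_carrier quot_algebra_add)
qed

end

subsection \<open>The isomorphism onto the reduced quotient\<close>

definition red_gen :: "nat \<Rightarrow> gen \<Rightarrow> ext" where
  "red_gen n g = (case g of
       Theta i \<Rightarrow> if i < n then \<theta> i else (\<lambda>A. - (\<Sum>j\<in>{1..<n}. \<theta> j A))
     | Xi i \<Rightarrow>
         if i < n then (\<lambda>A. \<xi>' i A - 1 / of_nat n * (\<Sum>j\<in>{1..<n}. \<xi>' j A))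
         else (\<lambda>A. - (1 / of_nat n) * (\<Sum>j\<in>{1..<n}. \<xi>' j A))
     | Xi' i \<Rightarrow> \<xi>' i)"

lemma red_map_eq: "red_map n = ext_hom (red_gen n)"
  unfolding red_map_def red_gen_def by simp

definition lift_gen :: "nat \<Rightarrow> gen \<Rightarrow> ext" where
  "lift_gen n g = (case g of Theta i \<Rightarrow> \<theta> i | Xi i \<Rightarrow> \<xi> i | Xi' i \<Rightarrow> (\<lambda>A. \<xi> i A - \<xi> n A))"

definition lift :: "nat \<Rightarrow> ext \<Rightarrow> ext" where
  "lift n = ext_hom (lift_gen n)"

lemma homogeneous_red_gen: "homogeneous 1 (red_gen n g)"
proof -
  have "homogeneous 1 (\<lambda>A. \<Sum>j\<in>{1..<n}. 1 * \<theta> j A)" "homogeneous 1 (\<lambda>A. \<Sum>j\<in>{1..<n}. 1 * \<xi>' j A)"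
    by (intro homogeneous_sum homogeneous_gen)+
  from homogeneous_scale[OF this(1), of "-1"] homogeneous_scale[OF this(2), of "1 / of_nat n"]
    homogeneous_scale[OF this(2), of "- (1 / of_nat n)"] show ?thesis
    unfolding red_gen_def using homogeneous_gen
    by (auto split: gen.split intro!: homogeneous_diff simp del: One_nat_def)
qed

lemma homogeneous_lift_gen: "homogeneous 1 (lift_gen n g)"
  unfolding lift_gen_def using homogeneous_gen
  by (auto split: gen.split intro!: homogeneous_diff simp del: One_nat_def)

lemma red_gen_closed:
  assumes "g \<in> full_gens n"
  shows "red_gen n g \<in> carrier (ext_red n)"
proof -
  have th: "\<theta> i \<in> carrier (exterior (red_gens n))" "\<xi>' i \<in> carrier (exterior (red_gens n))" if "i \<in> {1..<n}" for i
    using that by (auto intro!: ext_gen_closed simp: red_gens_def)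
  have "(\<lambda>A. \<Sum>j\<in>{1..<n}. 1 * \<theta> j A) \<in> carrier (exterior (red_gens n))"
    "(\<lambda>A. \<Sum>j\<in>{1..<n}. 1 * \<xi>' j A) \<in> carrier (exterior (red_gens n))"
    using th by (intro ext_sum_closed; blast)+
  from ext_scale_closed[OF this(1), of "-1"] ext_scale_closed[OF this(2), of "1 / of_nat n"]
    ext_scale_closed[OF this(2), of "- (1 / of_nat n)"] show ?thesis
    using assms th unfolding ext_red_eq
    by (auto simp: red_gen_def full_gens_def intro!: ext_diff_closed)
qed

lemma lift_gen_closed:
  assumes "n \<ge> 1" "g \<in> red_gens n"
  shows "lift_gen n g \<in> carrier (ext_full n)"
  using assms unfolding ext_full_eq
  by (auto simp: lift_gen_def red_gens_def full_gens_def intro!: ext_diff_closed ext_gen_closed)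

lemma red_map_closed: "f \<in> carrier (ext_full n) \<Longrightarrow> red_map n f \<in> carrier (ext_red n)"
  unfolding red_map_eq ext_red_eq ext_full_eq
  using red_gen_closed by (intro ext_hom_closed[of "full_gens n" "red_gens n"] finite_full_gens finite_red_gens) (auto simp: ext_red_eq)

lemma lift_closed: "n \<ge> 1 \<Longrightarrow> f \<in> carrier (ext_red n) \<Longrightarrow> lift n f \<in> carrier (ext_full n)"
  unfolding lift_def ext_red_eq ext_full_eq
  using lift_gen_closed by (intro ext_hom_closed[of "red_gens n" "full_gens n"] finite_full_gens finite_red_gens) (auto simp: ext_full_eq)

lemma red_map_gen: "red_map n (ext_gen g) = red_gen n g"
  unfolding red_map_eq by (rule ext_hom_gen[OF homogeneous_red_gen])

lemma lift_ext_gen: "lift n (ext_gen g) = lift_gen n g"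
  unfolding lift_def by (rule ext_hom_gen[OF homogeneous_lift_gen])

text \<open>The terms with 1/n cancel in the difference of the images of
  \<open>\<xi>\<^sub>i\<close> and \<open>\<xi>\<^sub>n\<close>, so this composite is the identity
  already before passing to quotients; the opposite one is so only modulo
  \<open>FDR_ideal n\<close>.\<close>

lemma red_map_lift:
  assumes "n \<ge> 1" "h \<in> carrier (ext_red n)"
  shows "red_map n (lift n h) = h"
proof -
  have gen: "red_map n (lift_gen n g) = ext_gen g" if g: "g \<in> red_gens n" for g
  proof -
    obtain i where i: "i \<in> {1..<n}" "g = Theta i \<or> g = Xi' i" using g by (auto simp: red_gens_def)
    have "\<xi> i \<in> carrier (exterior (full_gens n))" "\<xi> n \<in> carrier (exterior (full_gens n))"
      using i assms by (auto intro!: ext_gen_closed simp: full_gens_def)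
    then have "red_map n (\<lambda>A. \<xi> i A - \<xi> n A) = (\<lambda>A. red_gen n (Xi i) A - red_gen n (Xi n) A)"
      unfolding red_map_gen[symmetric] by (simp add: red_map_eq ext_hom_diff[OF finite_full_gens])
    then show ?thesis
      using i by (auto simp: lift_gen_def red_map_gen) (auto simp: red_gen_def)
  qed
  have "red_map n (lift n h) = ext_hom (\<lambda>g. red_map n (lift_gen n g)) h"
    using assms lift_gen_closed homogeneous_red_gen unfolding red_map_eq lift_def ext_red_eq
    by (intro ext_hom_ext_hom[of "red_gens n" "full_gens n"] finite_red_gens finite_full_gens) (auto simp: ext_full_eq)
  also have "\<dots> = ext_hom ext_gen h"
    using assms(2) gen unfolding ext_red_eq by (intro ext_hom_cong[of "red_gens n"] finite_red_gens)
  also have "\<dots> = h"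
    using assms(2) unfolding ext_red_eq by (rule ext_hom_ext_gen[OF finite_red_gens])
  finally show ?thesis .
qed

definition lef_elt :: "nat \<Rightarrow> ext" where
  "lef_elt n = (\<lambda>A. \<Sum>i\<in>{1..<n}. ext_mult (\<theta> i) (\<xi>' i) A)"

lemma red_ideal_eq: "red_ideal n = Idl\<^bsub>ext_red n\<^esub> {lef_elt n}"
  by (simp add: red_ideal_def lef_elt_def)

lemma lef_elt_mult: "ext_mult (lef_elt n) f = lefschetz n f"
  using ext_mult_sum_left[of "\<lambda>_. 1" "\<lambda>i. ext_mult (\<theta> i) (\<xi>' i)" "{1..<n}" f]
  by (simp add: lef_elt_def lefschetz_def ext_mult_assoc fun_eq_iff)

lemma theta_xi'_monom: "ext_mult (\<theta> k) (\<xi>' j) = ext_monom {Theta k, Xi' j}"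
  using gen_sign_minimal[of "{Xi' j}" "Theta k"]
  by (simp add: ext_gen_eq_monom[of "Xi' j"] ext_gen_mult_monom less_gen_def)

lemma homogeneous_lef_elt: "homogeneous 2 (lef_elt n)"
proof -
  have "homogeneous 2 (ext_mult (\<theta> i) (\<xi>' i))" for i
    unfolding theta_xi'_monom by (simp add: homogeneous_def ext_monom_def)
  then have "homogeneous 2 (\<lambda>A. \<Sum>i\<in>{1..<n}. 1 * ext_mult (\<theta> i) (\<xi>' i) A)"
    by (rule homogeneous_sum)
  then show ?thesis by (simp only: lef_elt_def mult_1)
qed

lemma lef_elt_closed: "lef_elt n \<in> carrier (ext_red n)"
proof -
  have "ext_mult (\<theta> i) (\<xi>' i) \<in> carrier (exterior (red_gens n))" if "i \<in> {1..<n}" for i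
    using that by (intro ext_mult_closed finite_red_gens ext_gen_closed) (auto simp: red_gens_def)
  then show ?thesis
    using ext_sum_closed[of "{1..<n}" "\<lambda>i. ext_mult (\<theta> i) (\<xi>' i)" "red_gens n" "\<lambda>_. 1"]
    by (simp add: lef_elt_def ext_red_eq)
qed

lemma ring_red: "ring (ext_red n)" and ring_full: "ring (ext_full n)"
  unfolding ext_red_eq ext_full_eq by (simp_all add: ring_exterior finite_red_gens finite_full_gens)

lemma ideal_red: "ideal (red_ideal n) (exterior (red_gens n))"
  using ring.genideal_ideal[OF ring_red, of "{lef_elt n}" n] lef_elt_closed
  by (simp add: red_ideal_eq flip: ext_red_eq)

lemma ideal_FDR: "ideal (FDR_ideal n) (exterior (full_gens n))"
  using ring.genideal_ideal[OF ring_full, of "pos_invariants n" n]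
  by (auto simp: FDR_ideal_def pos_invariants_def simp flip: ext_full_eq)

text \<open>The generator has even degree and is therefore central, so its multiples from one side
  already form a two-sided ideal. This links the quotient to the operator.\<close>

lemma red_ideal_eq_lefschetz: "red_ideal n = lefschetz n ` carrier (ext_red n)" (is "_ = ?L")
proof
  have lin: "lefschetz n (\<lambda>A. u A + v A) = (\<lambda>A. lefschetz n u A + lefschetz n v A)" for u v
    unfolding lef_elt_mult[symmetric] by (rule ext_mult_add_right)
  have "ideal ?L (exterior (red_gens n))"
  proof (rule exterior_idealI[OF finite_red_gens])
    show "?L \<subseteq> carrier (exterior (red_gens n))"
      using lefschetz_closed by (auto simp: ext_red_eq)
    have "lefschetz n (\<lambda>A. 0) = (\<lambda>A. 0)" by (simp add: ext_mult_zero flip: lef_elt_mult)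
    then show "(\<lambda>A. 0) \<in> ?L"
      using ext_zero_closed by (metis ext_red_eq image_eqI)
  next
    fix f g assume "f \<in> ?L" "g \<in> ?L"
    then obtain u v where uv: "u \<in> carrier (ext_red n)" "v \<in> carrier (ext_red n)" "f = lefschetz n u" "g = lefschetz n v"
      by blast
    have "(\<lambda>A. u A + v A) \<in> carrier (ext_red n)"
      using uv unfolding ext_red_eq mem_carrier_exterior by (metis add.left_neutral)
    then show "(\<lambda>A. f A + g A) \<in> ?L"
      unfolding uv lin[symmetric] by blast
  next
    fix a f assume a: "a \<in> carrier (exterior (red_gens n))" and "f \<in> ?L"
    then obtain u where u: "u \<in> carrier (ext_red n)" "f = ext_mult (lef_elt n) u"
      by (auto simp: lef_elt_mult)
    have "ext_mult a f = lefschetz n (ext_mult a u)"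
      unfolding u lef_elt_mult[symmetric]
      by (metis ext_mult_assoc ext_mult_even_comm homogeneous_lef_elt)
    moreover have "ext_mult f a = lefschetz n (ext_mult u a)"
      unfolding u lef_elt_mult[symmetric] by (rule ext_mult_assoc)
    moreover have "ext_mult a u \<in> carrier (ext_red n)" "ext_mult u a \<in> carrier (ext_red n)"
      using a u unfolding ext_red_eq by (auto intro: ext_mult_closed finite_red_gens)
    ultimately show "ext_mult a f \<in> ?L"
      "ext_mult f a \<in> ?L" by auto
  qed
  moreover have "lef_elt n \<in> ?L"
  proof -
    have "finite A" if "lef_elt n A \<noteq> 0" for A
      using homogeneous_lef_elt[of n] that by (metis card.infinite homogeneous_def zero_neq_numeral)
    then have "lef_elt n = lefschetz n ext_one"
      by (simp add: ext_mult_one flip: lef_elt_mult)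
    then show ?thesis using ext_one_closed by (auto simp: ext_red_eq)
  qed
  ultimately show "red_ideal n \<subseteq> ?L"
    unfolding red_ideal_eq using ring.genideal_minimal[OF ring_red] by (simp add: ext_red_eq)
  have "lef_elt n \<in> red_ideal n"
    using ring.genideal_self[OF ring_red, of "{lef_elt n}" n] lef_elt_closed by (simp add: red_ideal_eq)
  then show "?L \<subseteq> red_ideal n"
    using ideal_right[OF finite_red_gens ideal_red] by (auto simp: ext_red_eq simp flip: lef_elt_mult)
qed

lemma power_sum_mem:
  assumes "tx \<noteq> (False, False)" shows "power_sum n tx \<in> FDR_ideal n"
  using ring.genideal_self[OF ring_full, of "pos_invariants n" n] power_sum_invariant[OF assms]
  by (auto simp: FDR_ideal_def pos_invariants_def)

lemma power_sum_eqs: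
  "power_sum n (True, False) = (\<lambda>A. \<Sum>k\<in>{1..n}. \<theta> k A)"
  "power_sum n (False, True) = (\<lambda>A. \<Sum>k\<in>{1..n}. \<xi> k A)"
  "power_sum n (True, True) = (\<lambda>A. \<Sum>k\<in>{1..n}. ext_mult (\<theta> k) (\<xi> k) A)"
  unfolding theta_xi_monom by (simp_all add: power_sum_def loc_def ext_gen_eq_monom insert_commute)

lemma sum_upto_n: "(n :: nat) \<ge> 1 \<Longrightarrow> (\<Sum>k\<in>{1..n}. f k) = (\<Sum>k\<in>{1..<n}. f k) + (f n :: complex)"
  by (cases n) (simp_all add: atLeastLessThanSuc_atLeastAtMost)

lemma red_map_sum:
  assumes "\<And>i. i \<in> I \<Longrightarrow> f i \<in> carrier (ext_full n)"
  shows "red_map n (\<lambda>A. \<Sum>i\<in>I. c i * f i A) = (\<lambda>C. \<Sum>i\<in>I. c i * red_map n (f i) C)"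
  unfolding red_map_eq using assms by (intro ext_hom_sum[OF finite_full_gens]) (simp add: ext_full_eq)

lemma lift_sum:
  assumes "\<And>i. i \<in> I \<Longrightarrow> f i \<in> carrier (ext_red n)"
  shows "lift n (\<lambda>A. \<Sum>i\<in>I. c i * f i A) = (\<lambda>C. \<Sum>i\<in>I. c i * lift n (f i) C)"
  unfolding lift_def using assms by (intro ext_hom_sum[OF finite_red_gens]) (simp add: ext_red_eq)

lemma full_gen_closed: "k \<in> {1..n} \<Longrightarrow> \<theta> k \<in> carrier (ext_full n)" "k \<in> {1..n} \<Longrightarrow> \<xi> k \<in> carrier (ext_full n)"
  unfolding ext_full_eq by (auto intro!: ext_gen_closed simp: full_gens_def)

lemma red_gen_closed': "k \<in> {1..<n} \<Longrightarrow> \<theta> k \<in> carrier (ext_red n)" "k \<in> {1..<n} \<Longrightarrow> \<xi>' k \<in> carrier (ext_red n)"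
  unfolding ext_red_eq by (auto intro!: ext_gen_closed simp: red_gens_def)

text \<open>Let t and s be the sums of the reduced \<open>\<theta>\<close>'s and
  \<open>\<xi>'\<close>'s. The linear power sums go to t - t and to s - (n-1)s/n - s/n, both 0. In
  the quadratic one the two terms with ts/n cancel and leave the generator of
  \<open>red_ideal n\<close>.\<close>

lemma red_map_power_sum:
  assumes "n \<ge> 1" "tx \<noteq> (False, False)"
  shows "red_map n (power_sum n tx) \<in> red_ideal n"
proof -
  note zero = ideal_zero[OF finite_red_gens ideal_red]
  define t where "t = (\<lambda>A. \<Sum>j\<in>{1..<n}. \<theta> j A)"
  define s where "s = (\<lambda>A. \<Sum>j\<in>{1..<n}. \<xi>' j A)"
  have Theta: "red_gen n (Theta k) = \<theta> k" "red_gen n (Xi k) = (\<lambda>A. \<xi>' k A - 1 / of_nat n * s A)"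
    if "k \<in> {1..<n}" for k using that by (auto simp: red_gen_def s_def)
  have n: "red_gen n (Theta n) = (\<lambda>A. - t A)" "red_gen n (Xi n) = (\<lambda>A. - (1 / of_nat n) * s A)"
    by (auto simp: red_gen_def t_def s_def)
  consider "tx = (True, False)" | "tx = (False, True)" | "tx = (True, True)"
    using assms(2) by (cases tx) auto
  then show ?thesis
  proof cases
    case 1
    have "red_map n (power_sum n tx) = (\<lambda>C. \<Sum>k\<in>{1..n}. red_gen n (Theta k) C)"
      using red_map_sum[of "{1..n}" \<theta> n "\<lambda>_. 1"] full_gen_closed by (simp add: 1 power_sum_eqs red_map_gen)
    also have "\<dots> = (\<lambda>C. 0)"
      unfolding sum_upto_n[OF assms(1)] n by (simp add: Theta t_def)
    finally show ?thesis using zero by simp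
  next
    case 2
    have "red_map n (power_sum n tx) = (\<lambda>C. \<Sum>k\<in>{1..n}. red_gen n (Xi k) C)"
      using red_map_sum[of "{1..n}" \<xi> n "\<lambda>_. 1"] full_gen_closed by (simp add: 2 power_sum_eqs red_map_gen)
    also have "\<dots> = (\<lambda>C. 0)"
    proof
      fix C
      have "(\<Sum>k\<in>{1..n}. red_gen n (Xi k) C) = s C - of_nat (n - 1) * (1 / of_nat n * s C) - 1 / of_nat n * s C"
        unfolding sum_upto_n[OF assms(1)] n by (simp add: Theta sum_subtractf) (simp add: s_def)
      also have "\<dots> = 0"
        using assms(1) by (simp add: of_nat_diff field_simps)
      finally show "(\<Sum>k\<in>{1..n}. red_gen n (Xi k) C) = 0" .
    qed
    finally show ?thesis using zero by simp
  next
    case 3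
    have "red_map n (ext_mult (\<theta> k) (\<xi> k)) = ext_mult (red_gen n (Theta k)) (red_gen n (Xi k))" if "k \<in> {1..n}" for k
      using ext_hom_mult[of "full_gens n" "\<theta> k" "\<xi> k" "red_gen n", OF finite_full_gens
          full_gen_closed[OF that, unfolded ext_full_eq] homogeneous_red_gen]
      by (simp add: red_map_gen flip: red_map_eq)
    moreover have "ext_mult (\<theta> k) (\<xi> k) \<in> carrier (ext_full n)" if "k \<in> {1..n}" for k
      using full_gen_closed[OF that] unfolding ext_full_eq by (intro ext_mult_closed finite_full_gens)
    ultimately have "red_map n (power_sum n tx) = (\<lambda>C. \<Sum>k\<in>{1..n}. ext_mult (red_gen n (Theta k)) (red_gen n (Xi k)) C)"
      using red_map_sum[of "{1..n}" "\<lambda>k. ext_mult (\<theta> k) (\<xi> k)" n "\<lambda>_. 1"] by (simp add: 3 power_sum_eqs)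
    also have "\<dots> = lef_elt n"
    proof
      fix C
      have "ext_mult t s C = (\<Sum>k\<in>{1..<n}. ext_mult (\<theta> k) s C)"
        using ext_mult_sum_left[of "\<lambda>_. 1" \<theta> "{1..<n}" s C] by (simp add: t_def)
      then show "(\<Sum>k\<in>{1..n}. ext_mult (red_gen n (Theta k)) (red_gen n (Xi k)) C) = lef_elt n C"
        unfolding sum_upto_n[OF assms(1)] n ext_mult_minus_left ext_mult_scale_right
        by (simp add: Theta ext_mult_diff_right ext_mult_scale_right[of _ "1 / of_nat n", simplified] sum_subtractf
            lef_elt_def flip: sum_divide_distrib)
    qed
    also have "\<dots> \<in> red_ideal n"
      using ring.genideal_self[OF ring_red, of "{lef_elt n}" n] lef_elt_closed by (simp add: red_ideal_eq)
    finally show ?thesis .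
  qed
qed

text \<open>On generators the error is 0 or a multiple of a linear power sum: minus the sum of the
  \<open>\<theta>\<close>'s for \<open>\<theta>\<^sub>n\<close>, and -1/n times the sum of the
  \<open>\<xi>\<close>'s for every \<open>\<xi>\<^sub>i\<close>. \<open>ext_hom_congruent\<close>
  extends this to all elements.\<close>

lemma lift_red_map:
  assumes "n \<ge> 1" "f \<in> carrier (ext_full n)"
  shows "(\<lambda>C. lift n (red_map n f) C - f C) \<in> FDR_ideal n"
proof -
  note I = finite_full_gens ideal_FDR
  have "lift n (\<lambda>A. \<Sum>j\<in>{1..<n}. c * \<theta> j A) = (\<lambda>A. \<Sum>j\<in>{1..<n}. c * \<theta> j A)" for c
    using lift_sum[of "{1..<n}" \<theta> n "\<lambda>_. c"] red_gen_closed' by (simp add: lift_ext_gen lift_gen_def)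
  from this[of "-1"] have lt: "lift n (\<lambda>A. - (\<Sum>j\<in>{1..<n}. \<theta> j A)) = (\<lambda>A. - (\<Sum>j\<in>{1..<n}. \<theta> j A))"
    by (simp add: sum_negf)
  have "lift n (\<lambda>A. \<Sum>j\<in>{1..<n}. c * \<xi>' j A) = (\<lambda>A. \<Sum>j\<in>{1..<n}. c * (\<xi> j A - \<xi> n A))" for c
    using lift_sum[of "{1..<n}" \<xi>' n "\<lambda>_. c"] red_gen_closed' by (simp add: lift_ext_gen lift_gen_def)
  then have "lift n (\<lambda>A. c * (\<Sum>j\<in>{1..<n}. \<xi>' j A)) = (\<lambda>A. c * ((\<Sum>j\<in>{1..n}. \<xi> j A) - of_nat n * \<xi> n A))" for c
    unfolding sum_upto_n[OF assms(1)] using assms(1)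
    by (simp add: sum_subtractf of_nat_diff algebra_simps flip: sum_distrib_left)
  then have lx: "lift n (\<lambda>A. c * (\<Sum>j\<in>{1..<n}. \<xi>' j A)) = (\<lambda>A. c * (power_sum n (False, True) A - of_nat n * \<xi> n A))" for c
    by (simp add: power_sum_eqs)
  have s_closed: "(\<lambda>A. c * (\<Sum>j\<in>{1..<n}. \<xi>' j A)) \<in> carrier (exterior (red_gens n))" for c
    using ext_sum_closed[of "{1..<n}" \<xi>' "red_gens n" "\<lambda>_. 1"] red_gen_closed'
    by (intro ext_scale_closed) (simp add: ext_red_eq)
  have gen: "(\<lambda>C. lift n (red_gen n g) C - ext_gen g C) \<in> FDR_ideal n" if g: "g \<in> full_gens n" for g
  proof -
    obtain i where i: "i \<in> {1..n}" "g = Theta i \<or> g = Xi i" using g by (auto simp: full_gens_def)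
    consider "g = Theta i" "i < n" | "g = Theta n" | "g = Xi i" "i < n" | "g = Xi n" using i by force
    then show ?thesis
    proof cases
      case 1
      then show ?thesis using ideal_zero[OF I] by (simp add: red_gen_def lift_ext_gen lift_gen_def)
    next
      case 2
      have "(\<lambda>C. lift n (red_gen n g) C - ext_gen g C) = (\<lambda>C. -1 * power_sum n (True, False) C)"
      proof -
        have "red_gen n (Theta n) = (\<lambda>A. - (\<Sum>j\<in>{1..<n}. \<theta> j A))" by (simp add: red_gen_def)
        then show ?thesis
          by (simp only: 2 lt power_sum_eqs sum_upto_n[OF assms(1)]) (simp add: fun_eq_iff)
      qed
      then show ?thesis using ideal_scale[OF I power_sum_mem[of "(True, False)"], of "-1"] by simp
    next
      case 3
      have "lift n (red_gen n g) = (\<lambda>C. lift n (\<xi>' i) C - lift n (\<lambda>A. 1 / of_nat n * (\<Sum>j\<in>{1..<n}. \<xi>' j A)) C)"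
      proof -
        have "\<xi>' i \<in> carrier (exterior (red_gens n))"
          using 3 i red_gen_closed'(2)[of i n] by (simp add: ext_red_eq)
        then have "lift n (\<lambda>A. \<xi>' i A - 1 / of_nat n * (\<Sum>j\<in>{1..<n}. \<xi>' j A)) =
            (\<lambda>C. lift n (\<xi>' i) C - lift n (\<lambda>A. 1 / of_nat n * (\<Sum>j\<in>{1..<n}. \<xi>' j A)) C)"
          unfolding lift_def by (rule ext_hom_diff[OF finite_red_gens _ s_closed])
        moreover have "red_gen n g = (\<lambda>A. \<xi>' i A - 1 / of_nat n * (\<Sum>j\<in>{1..<n}. \<xi>' j A))"
          using 3 by (simp add: red_gen_def)
        ultimately show ?thesis by simp
      qed
      then have "(\<lambda>C. lift n (red_gen n g) C - ext_gen g C) = (\<lambda>C. (- 1 / of_nat n) * power_sum n (False, True) C)"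
        unfolding lx using assms(1) by (simp add: 3 lift_ext_gen lift_gen_def field_simps fun_eq_iff)
      then show ?thesis using ideal_scale[OF I power_sum_mem[of "(False, True)"], of "- 1 / of_nat n"] by simp
    next
      case 4
      have "(\<lambda>C. lift n (red_gen n g) C - ext_gen g C) = (\<lambda>C. (- 1 / of_nat n) * power_sum n (False, True) C)"
        using assms(1) lx[of "- (1 / of_nat n)"] by (simp add: 4 red_gen_def field_simps fun_eq_iff)
      then show ?thesis using ideal_scale[OF I power_sum_mem[of "(False, True)"], of "- 1 / of_nat n"] by simp
    qed
  qed
  have "lift n (red_map n f) = ext_hom (\<lambda>g. lift n (red_gen n g)) f"
    using assms red_gen_closed homogeneous_lift_gen unfolding red_map_eq lift_def ext_full_eq
    by (intro ext_hom_ext_hom[of "full_gens n" "red_gens n"] finite_red_gens finite_full_gens) (auto simp: ext_red_eq)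
  moreover have "f = ext_hom ext_gen f"
    using assms(2) ext_hom_ext_gen[OF finite_full_gens] by (simp add: ext_full_eq)
  moreover have "(\<lambda>C. ext_hom (\<lambda>g. lift n (red_gen n g)) f C - ext_hom ext_gen f C) \<in> FDR_ideal n"
    using assms(2) gen lift_closed[OF assms(1) red_gen_closed] ext_gen_closed unfolding ext_full_eq
    by (intro ext_hom_congruent[OF I finite_full_gens]) auto
  ultimately show ?thesis by simp
qed

text \<open>The image equals the quadratic power sum minus the sum of all \<open>\<theta>\<close>'s
  times \<open>\<xi>\<^sub>n\<close>.\<close>

lemma lift_lef_elt:
  assumes "n \<ge> 1" shows "lift n (lef_elt n) \<in> FDR_ideal n"
proof -
  note I = finite_full_gens ideal_FDR
  have "lift n (ext_mult (\<theta> k) (\<xi>' k)) = ext_mult (\<theta> k) (\<lambda>A. \<xi> k A - \<xi> n A)" if "k \<in> {1..<n}" for k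
    using ext_hom_mult[of "red_gens n" "\<theta> k" "\<xi>' k" "lift_gen n", OF finite_red_gens
        red_gen_closed'[OF that, unfolded ext_red_eq] homogeneous_lift_gen]
    by (simp add: lift_ext_gen lift_gen_def[of n "Theta k"] lift_gen_def[of n "Xi' k"] flip: lift_def)
  moreover have "ext_mult (\<theta> k) (\<xi>' k) \<in> carrier (ext_red n)" if "k \<in> {1..<n}" for k
    using red_gen_closed'[OF that] unfolding ext_red_eq by (intro ext_mult_closed finite_red_gens)
  ultimately have "lift n (lef_elt n) = (\<lambda>C. \<Sum>k\<in>{1..<n}. ext_mult (\<theta> k) (\<lambda>A. \<xi> k A - \<xi> n A) C)"
    using lift_sum[of "{1..<n}" "\<lambda>k. ext_mult (\<theta> k) (\<xi>' k)" n "\<lambda>_. 1"] by (simp add: lef_elt_def)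
  \<comment> \<open>The term for k = n is 0; adding it produces full power sums.\<close>
  also have "\<dots> = (\<lambda>C. \<Sum>k\<in>{1..n}. ext_mult (\<theta> k) (\<lambda>A. \<xi> k A - \<xi> n A) C)"
    unfolding sum_upto_n[OF assms] by (simp add: ext_mult_zero)
  also have "\<dots> = (\<lambda>C. power_sum n (True, True) C - ext_mult (power_sum n (True, False)) (\<xi> n) C)"
    using ext_mult_sum_left[of "\<lambda>_. 1" \<theta> "{1..n}" "\<xi> n"]
    by (simp add: power_sum_eqs ext_mult_diff_right sum_subtractf)
  also have "\<dots> \<in> FDR_ideal n"
    using assms full_gen_closed(2)[of n n]
    by (intro ideal_diff[OF I] ideal_right[OF I] power_sum_mem) (auto simp: ext_full_eq)
  finally show ?thesis .
qed

text \<open>Each direction places a generated ideal inside the preimage of the other one. Backwards,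
  the lifted element is in the ideal and differs from f by an element of it. This gives
  well-definedness and injectivity of \<open>FDR_iso\<close> at once.\<close>

lemma mem_FDR_ideal_iff:
  assumes "n \<ge> 1" "f \<in> carrier (ext_full n)"
  shows "f \<in> FDR_ideal n \<longleftrightarrow> red_map n f \<in> red_ideal n"
proof
  let ?K = "{f \<in> carrier (exterior (full_gens n)). ext_hom (red_gen n) f \<in> red_ideal n}"
  have K: "ideal ?K (ext_full n)"
    unfolding ext_full_eq using homogeneous_red_gen red_gen_closed
    by (intro ideal_vimage[of "full_gens n" "red_gens n"] finite_full_gens finite_red_gens ideal_red) (auto simp: ext_red_eq)
  have "pos_invariants n \<subseteq> ?K"
    using red_map_power_sum[OF assms(1)] power_sum_closed
    by (intro pos_invariants_subset[OF K]) (auto simp: ext_full_eq red_map_eq)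
  then have "FDR_ideal n \<subseteq> ?K"
    unfolding FDR_ideal_def by (rule ring.genideal_minimal[OF ring_full K])
  then show "f \<in> FDR_ideal n \<Longrightarrow> red_map n f \<in> red_ideal n"
    by (auto simp: red_map_eq)
next
  note I = finite_full_gens ideal_FDR
  let ?K = "{f \<in> carrier (exterior (red_gens n)). ext_hom (lift_gen n) f \<in> FDR_ideal n}"
  have K: "ideal ?K (ext_red n)"
    unfolding ext_red_eq using homogeneous_lift_gen lift_gen_closed[OF assms(1)]
    by (intro ideal_vimage[of "red_gens n" "full_gens n"] finite_full_gens finite_red_gens ideal_FDR) (auto simp: ext_full_eq)
  have "{lef_elt n} \<subseteq> ?K"
    using lift_lef_elt[OF assms(1)] lef_elt_closed by (auto simp: ext_red_eq lift_def)
  then have "red_ideal n \<subseteq> ?K"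
    unfolding red_ideal_eq by (rule ring.genideal_minimal[OF ring_red K])
  moreover assume "red_map n f \<in> red_ideal n"
  ultimately have "lift n (red_map n f) \<in> FDR_ideal n" by (auto simp: lift_def)
  then have "(\<lambda>C. lift n (red_map n f) C - (lift n (red_map n f) C - f C)) \<in> FDR_ideal n"
    by (rule ideal_diff[OF I _ lift_red_map[OF assms]])
  then show "f \<in> FDR_ideal n" by simp
qed

section \<open>Computing in \<open>FDR n\<close> with representatives\<close>

abbreviation FDR_coset :: "nat \<Rightarrow> ext \<Rightarrow> ext set" where
  "FDR_coset n f \<equiv> FDR_ideal n +>\<^bsub>ext_full n\<^esub> f"

lemma FDR_eq: "FDR n = quot_algebra (exterior (full_gens n)) (FDR_ideal n)"
  by (simp add: FDR_def ext_full_eq)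

lemma FDR_coset_eq_iff:
  assumes "n \<ge> 1" "f \<in> carrier (ext_full n)" "g \<in> carrier (ext_full n)"
  shows "FDR_coset n f = FDR_coset n g \<longleftrightarrow> (\<lambda>A. red_map n f A - red_map n g A) \<in> red_ideal n"
proof -
  have "(\<lambda>A. f A - g A) \<in> carrier (ext_full n)"
    using assms(2,3) unfolding ext_full_eq by (rule ext_diff_closed)
  moreover have "red_map n (\<lambda>A. f A - g A) = (\<lambda>A. red_map n f A - red_map n g A)"
    using assms(2,3) unfolding red_map_eq ext_full_eq by (rule ext_hom_diff[OF finite_full_gens])
  ultimately show ?thesis
    using ext_coset_eq[OF finite_full_gens ideal_FDR] mem_FDR_ideal_iff[OF assms(1)]
    by (simp add: ext_full_eq)
qed

lemma FDR_iso_coset: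
  assumes "n \<ge> 1" "f \<in> carrier (ext_full n)"
  shows "FDR_iso n (FDR_coset n f) = red_ideal n +>\<^bsub>ext_red n\<^esub> red_map n f"
proof -
  note I = finite_full_gens ideal_FDR
  have "red_ideal n +>\<^bsub>ext_red n\<^esub> red_map n g = red_ideal n +>\<^bsub>ext_red n\<^esub> red_map n f"
    if "g \<in> FDR_coset n f" for g
  proof -
    have g: "g \<in> carrier (ext_full n)"
      using ext_coset_carrier[OF I] assms(2) that by (simp add: ext_full_eq)
    have "FDR_coset n g = FDR_coset n f"
      using that unfolding ext_full_eq ext_coset_eq[OF I] by (simp add: ext_coset[OF I])
    then show ?thesis
      using FDR_coset_eq_iff[OF assms(1) g assms(2)] ext_coset_eq[OF finite_red_gens ideal_red]
      by (simp add: ext_red_eq)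
  qed
  moreover have "f \<in> FDR_coset n f"
    unfolding ext_full_eq ext_coset[OF I] using ideal_zero[OF I] by simp
  ultimately show ?thesis unfolding FDR_iso_def by blast
qed

lemma FDR_carrier: "carrier (FDR n) = FDR_coset n ` carrier (ext_full n)"
  unfolding FDR_eq ext_full_eq by (rule quot_algebra_carrier[OF finite_full_gens ideal_FDR])

text \<open>Replaces the inverse of \<open>FDR_iso\<close> by an explicit representative, so that
  linear combinations of classes become elementwise sums.\<close>

lemma FDR_class_eq:
  assumes "n \<ge> 1" "h \<in> carrier (ext_red n)"
  shows "FDR_class n h = FDR_coset n (lift n h)"
proof -
  have "inj_on (FDR_iso n) (carrier (FDR n))"
    unfolding FDR_carrier
    by (rule inj_onI, elim imageE) (simp add: FDR_iso_coset[OF assms(1)] FDR_coset_eq_iff[OF assms(1)]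
        ext_red_eq ext_coset_eq[OF finite_red_gens ideal_red])
  moreover have "FDR_iso n (FDR_coset n (lift n h)) = red_ideal n +>\<^bsub>ext_red n\<^esub> h"
    using assms by (simp add: FDR_iso_coset lift_closed red_map_lift)
  moreover have "FDR_coset n (lift n h) \<in> carrier (FDR n)"
    unfolding FDR_carrier using lift_closed[OF assms] by blast
  ultimately show ?thesis
    unfolding FDR_class_def by (metis the_inv_into_f_f)
qed

lemma FDR_linear_combination:
  assumes "n \<ge> 1" "finite J" "\<And>i. i \<in> J \<Longrightarrow> h i \<in> carrier (ext_red n)"
  shows "(\<Oplus>\<^bsub>FDR n\<^esub>i\<in>J. c i \<odot>\<^bsub>FDR n\<^esub> FDR_class n (h i)) = FDR_coset n (\<lambda>A. \<Sum>i\<in>J. c i * lift n (h i) A)"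
proof -
  note I = finite_full_gens ideal_FDR
  interpret abelian_monoid "FDR n"
    unfolding FDR_eq by (rule abelian_monoid_quot_algebra[OF I])
  have mem: "lift n (h i) \<in> carrier (exterior (full_gens n))" if "i \<in> J" for i
    using lift_closed[OF assms(1)] assms(3)[OF that] by (simp add: ext_full_eq)
  have "c i \<odot>\<^bsub>FDR n\<^esub> FDR_class n (h i) = FDR_coset n (\<lambda>A. c i * lift n (h i) A)" if "i \<in> J" for i
    using quot_algebra_smult[OF I mem[OF that]] assms(1,3) that by (simp add: FDR_class_eq FDR_eq ext_full_eq)
  moreover have "FDR_coset n (\<lambda>A. c i * lift n (h i) A) \<in> carrier (FDR n)" if "i \<in> J" for i
    using ext_scale_closed[OF mem[OF that]] by (simp add: FDR_carrier ext_full_eq)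
  ultimately have "(\<Oplus>\<^bsub>FDR n\<^esub>i\<in>J. c i \<odot>\<^bsub>FDR n\<^esub> FDR_class n (h i)) =
      (\<Oplus>\<^bsub>FDR n\<^esub>i\<in>J. FDR_coset n (\<lambda>A. c i * lift n (h i) A))"
    by (intro finsum_cong') auto
  also have "\<dots> = FDR_coset n (\<lambda>A. \<Sum>i\<in>J. c i * lift n (h i) A)"
    unfolding FDR_eq ext_full_eq
    using ext_scale_closed[OF mem] by (intro quot_algebra_finsum[OF I _ assms(2)])
  finally show ?thesis .
qed

subsection \<open>The basis\<close>

text \<open>Among the members with nonzero coefficient take one whose leading point has maximal
  rank. At that point only this member is nonzero, so its coefficient must vanish.\<close>

lemma triangular_independent:
  fixes g :: "'i \<Rightarrow> 'x \<Rightarrow> complex" and r :: "'x \<Rightarrow> nat"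
  assumes "finite J" "inj_on m J" "\<And>i. i \<in> J \<Longrightarrow> g i (m i) \<noteq> 0"
    and "\<And>i x. i \<in> J \<Longrightarrow> g i x \<noteq> 0 \<Longrightarrow> x = m i \<or> r x < r (m i)"
    and "\<And>x. (\<Sum>i\<in>J. c i * g i x) = 0"
  shows "\<forall>i\<in>J. c i = 0"
proof (rule ccontr)
  define K where "K = {i \<in> J. c i \<noteq> 0}"
  assume "\<not> (\<forall>i\<in>J. c i = 0)"
  then have "K \<noteq> {}" "finite K" using assms(1) by (auto simp: K_def)
  then obtain k where k: "k \<in> K" "\<And>i. i \<in> K \<Longrightarrow> r (m i) \<le> r (m k)"
    using obtains_MAX[of K "\<lambda>i. r (m i)"] by (metis Max_ge finite_imageI image_eqI)
  have "c i * g i (m k) = 0" if "i \<in> J - {k}" for i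
  proof (rule ccontr)
    assume "c i * g i (m k) \<noteq> 0"
    then have "i \<in> K" "g i (m k) \<noteq> 0" using that by (auto simp: K_def)
    then have "m k = m i"
      using assms(4)[of i "m k"] k(2)[of i] that by fastforce
    then show False using assms(2) that k(1) by (auto simp: K_def inj_on_def)
  qed
  then have "(\<Sum>i\<in>J - {k}. c i * g i (m k)) = 0"
    by (intro sum.neutral) blast
  then have "(\<Sum>i\<in>J. c i * g i (m k)) = c k * g k (m k)"
    using assms(1) k(1) by (simp add: K_def sum.remove[of J k])
  then show False using assms(3,5) k(1) by (auto simp: K_def)
qed

text \<open>Elimination from the top: a point z of maximal rank is met by \<open>g z\<close> alone,
  so its coefficient is forced, and after subtraction the remaining points are handled by
  induction.\<close>

lemma triangular_span:
  fixes g :: "'x \<Rightarrow> 'x \<Rightarrow> complex" and r :: "'x \<Rightarrow> nat"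
  assumes "finite X" "\<And>x. x \<in> X \<Longrightarrow> g x x \<noteq> 0"
    and "\<And>x y. x \<in> X \<Longrightarrow> y \<in> X \<Longrightarrow> g x y \<noteq> 0 \<Longrightarrow> y = x \<or> r y < r x"
  shows "\<exists>c. \<forall>y\<in>X. v y = (\<Sum>x\<in>X. c x * g x y)"
  using assms
proof (induction X arbitrary: v rule: finite_ranking_induct[where f = r])
  case (insert z X)
  show ?case
  proof (cases "z \<in> X")
    case True
    then show ?thesis using insert.IH[of v] insert.prems by (simp add: insert_absorb)
  next
    case False
    define a where "a = v z / g z z"
    have "\<exists>c. \<forall>y\<in>X. v y - a * g z y = (\<Sum>x\<in>X. c x * g x y)"
      using insert.prems by (intro insert.IH) auto
    then obtain c where c: "\<And>y. y \<in> X \<Longrightarrow> v y - a * g z y = (\<Sum>x\<in>X. c x * g x y)" by blast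
    have "g x z = 0" if "x \<in> X" for x
    proof (rule ccontr)
      assume "g x z \<noteq> 0"
      then have "z = x \<or> r z < r x" using insert.prems(2)[of x z] that by blast
      then show False using insert.hyps(2)[OF that] that False by auto
    qed
    then have z: "(\<Sum>x\<in>X. d x * g x z) = 0" for d by simp
    have "(\<Sum>x\<in>insert z X. (c(z := a)) x * g x y) = a * g z y + (\<Sum>x\<in>X. c x * g x y)" for y
      using insert.hyps(1) False by (simp, intro sum.cong) auto
    then have "\<forall>y\<in>insert z X. v y = (\<Sum>x\<in>insert z X. (c(z := a)) x * g x y)"
      using c z insert.prems(1)[of z] by (auto simp: a_def algebra_simps)
    then show ?thesis by blast
  qed
qed simp

theorem theorem4p1:
  fixes n :: nat
  assumes "n \<ge> 1"
  shows "is_basis_family (FDR n) (Phi n) (\<lambda>\<pi>. FDR_class n (G n \<pi>))"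
proof -
  have lead: "has_lead n {} (G n \<pi>) (lead_monom n \<pi>)" if "\<pi> \<in> Phi n" for \<pi>
    using G_has_lead[OF _ assms] that by (cases \<pi>) (auto simp: Phi_def lead_monom_def)
  then have G: "G n \<pi> \<in> carrier (ext_red n)" "colefschetz n (G n \<pi>) = (\<lambda>C. 0)" "G n \<pi> (lead_monom n \<pi>) \<noteq> 0"
    "\<And>C. G n \<pi> C \<noteq> 0 \<Longrightarrow> C = lead_monom n \<pi> \<or> index_sum C < index_sum (lead_monom n \<pi>)"
    if "\<pi> \<in> Phi n" for \<pi>
    using that unfolding has_lead_def by blast+
  have red_lift: "red_map n (\<lambda>A. \<Sum>\<pi>\<in>J. c \<pi> * lift n (G n \<pi>) A) = (\<lambda>A. \<Sum>\<pi>\<in>J. c \<pi> * G n \<pi> A)"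
    "(\<lambda>A. \<Sum>\<pi>\<in>J. c \<pi> * lift n (G n \<pi>) A) \<in> carrier (ext_full n)"
    if "J \<subseteq> Phi n" for J c
  proof -
    have closed: "lift n (G n \<pi>) \<in> carrier (ext_full n)" if "\<pi> \<in> J" for \<pi>
      using lift_closed[OF assms G(1)] that \<open>J \<subseteq> Phi n\<close> by blast
    then show "(\<lambda>A. \<Sum>\<pi>\<in>J. c \<pi> * lift n (G n \<pi>) A) \<in> carrier (ext_full n)"
      unfolding ext_full_eq by (intro ext_sum_closed)
    have "red_map n (lift n (G n \<pi>)) = G n \<pi>" if "\<pi> \<in> J" for \<pi>
      using red_map_lift[OF assms G(1)] that \<open>J \<subseteq> Phi n\<close> by blast
    then show "red_map n (\<lambda>A. \<Sum>\<pi>\<in>J. c \<pi> * lift n (G n \<pi>) A) = (\<lambda>A. \<Sum>\<pi>\<in>J. c \<pi> * G n \<pi> A)"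
      by (simp add: red_map_sum closed)
  qed
  show ?thesis
    unfolding is_basis_family_def
  proof (intro conjI allI impI ballI)
    show "(\<lambda>\<pi>. FDR_class n (G n \<pi>)) \<in> Phi n \<rightarrow> carrier (FDR n)"
      using G(1) lift_closed[OF assms] by (auto simp: FDR_class_eq[OF assms] FDR_carrier)
  next
    fix J c \<pi>
    assume J: "finite J \<and> J \<subseteq> Phi n \<and>
      (\<Oplus>\<^bsub>FDR n\<^esub>i\<in>J. c i \<odot>\<^bsub>FDR n\<^esub> FDR_class n (G n i)) = \<zero>\<^bsub>FDR n\<^esub>" and "\<pi> \<in> J"
    define v where "v = (\<lambda>A. \<Sum>\<pi>\<in>J. c \<pi> * G n \<pi> A)"
    have "FDR_coset n (\<lambda>A. \<Sum>\<pi>\<in>J. c \<pi> * lift n (G n \<pi>) A) = FDR_coset n (\<lambda>A. 0)"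
      using J FDR_linear_combination[OF assms, of J "G n" c] G(1)
        quot_algebra_zero[OF finite_full_gens ideal_FDR, of n]
      by (auto simp: ext_full_eq simp flip: FDR_eq)
    then have "(\<lambda>A. v A - red_map n (\<lambda>A. 0) A) \<in> red_ideal n"
      using FDR_coset_eq_iff[OF assms red_lift(2), of J "\<lambda>A. 0" c] J ext_zero_closed[of "full_gens n"]
      by (simp add: v_def ext_full_eq red_lift(1))
    then have "v \<in> red_ideal n"
      by (simp add: red_map_eq ext_hom_def)
    then obtain u where u: "u \<in> carrier (ext_red n)" "v = lefschetz n u"
      unfolding red_ideal_eq_lefschetz by blast
    \<comment> \<open>v lies both in the image of \<open>lefschetz\<close> and in the kernel of its
      adjoint, hence is 0.\<close>
    have "colefschetz n v C = 0" for C
      unfolding v_def colefschetz_sum using J G(2) by (intro sum.neutral) (auto simp: subset_iff)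
    then have "v C = 0" if "C \<subseteq> red_gens n" for C
      using lefschetz_kernel_disjoint[of n u C] that u by (auto simp: fun_eq_iff)
    moreover have "v \<in> carrier (exterior (red_gens n))"
      using lefschetz_closed[OF u(1)] u(2) by (simp add: ext_red_eq)
    ultimately have "v C = 0" for C by (auto simp: mem_carrier_exterior)
    then have zero: "(\<Sum>\<pi>\<in>J. c \<pi> * G n \<pi> C) = 0" for C by (simp add: v_def)
    have "\<forall>i\<in>J. c i = 0"
    proof (rule triangular_independent[of J "lead_monom n" "G n" index_sum c])
      show "inj_on (lead_monom n) J"
        using J inj_on_subset[OF inj_on_lead_monom[OF assms]] by blast
    qed (use J G(3,4) zero in blast)+
    then show "c \<pi> = 0" using \<open>\<pi> \<in> J\<close> by blast
  next
    fix x assume "x \<in> carrier (FDR n)"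
    then obtain f where f: "f \<in> carrier (ext_full n)" "x = FDR_coset n f"
      unfolding FDR_carrier by blast
    define X where "X = {C. C \<subseteq> red_gens n \<and> ballot C}"
    have X: "finite X" by (simp add: X_def finite_red_gens)
    have "\<exists>\<pi>. \<pi> \<in> Phi n \<and> lead_monom n \<pi> = C" if "C \<in> X" for C
      using ballot_lead_monom[OF assms, of C] that unfolding X_def by blast
    \<comment> \<open>One partition is chosen for each ballot monomial; only these members of the
      family are used to represent x.\<close>
    then obtain p where p: "\<And>C. C \<in> X \<Longrightarrow> p C \<in> Phi n \<and> lead_monom n (p C) = C" by metis
    obtain u where u: "u \<in> carrier (ext_red n)"
      "colefschetz n (\<lambda>C. red_map n f C - lefschetz n u C) = (\<lambda>C. 0)"
      using lefschetz_decomposition[OF red_map_closed[OF f(1)]] by blast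
    define v where "v = (\<lambda>C. red_map n f C - lefschetz n u C)"
    have v: "v \<in> carrier (ext_red n)"
      using red_map_closed[OF f(1)] lefschetz_closed[OF u(1)] unfolding v_def ext_red_eq
      by (rule ext_diff_closed)
    have "\<exists>c. \<forall>C\<in>X. v C = (\<Sum>D\<in>X. c D * G n (p D) C)"
    proof (rule triangular_span[where r = index_sum])
      fix D C assume D: "D \<in> X"
      show "G n (p D) D \<noteq> 0" using G(3)[of "p D"] p[OF D] by simp
      show "C = D \<or> index_sum C < index_sum D" if "G n (p D) C \<noteq> 0"
        using G(4)[of "p D" C] p[OF D] that by simp
    qed (rule X)
    then obtain c where c: "\<And>C. C \<in> X \<Longrightarrow> v C = (\<Sum>D\<in>X. c D * G n (p D) C)" by blast
    \<comment> \<open>The coefficients were fitted on ballot monomials only. Since w stays in the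
      kernel, the ballot criterion extends the equality to all monomials.\<close>
    define w where "w = (\<lambda>C. v C - (\<Sum>D\<in>X. c D * G n (p D) C))"
    have "w = (\<lambda>C. 0)"
    proof (rule kernel_ballot[OF assms])
      have "(\<lambda>C. \<Sum>D\<in>X. c D * G n (p D) C) \<in> carrier (exterior (red_gens n))"
        using p G(1) by (intro ext_sum_closed) (simp add: ext_red_eq)
      then show "w \<in> carrier (ext_red n)"
        using v unfolding w_def ext_red_eq by (intro ext_diff_closed)
      have "colefschetz n w C = colefschetz n v C - colefschetz n (\<lambda>C. \<Sum>D\<in>X. c D * G n (p D) C) C" for C
        unfolding w_def colefschetz_def sum_subtractf[symmetric]
        by (intro sum.cong refl) (simp add: ext_diff_gen_eq algebra_simps)
      then show "colefschetz n w = (\<lambda>C. 0)"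
        using u(2) p G(2) unfolding colefschetz_sum by (simp add: fun_eq_iff flip: v_def)
    qed (use c in \<open>simp add: w_def X_def\<close>)
    then have v_eq: "v C = (\<Sum>D\<in>X. c D * G n (p D) C)" for C
      by (simp add: w_def fun_eq_iff)
    define J where "J = p ` X"
    have J: "finite J" "J \<subseteq> Phi n" using X p by (auto simp: J_def)
    \<comment> \<open>Transports the coefficients from monomials to partitions;
      \<open>lead_monom n\<close> inverts p.\<close>
    define d where "d \<pi> = c (lead_monom n \<pi>)" for \<pi>
    have "inj_on p X" using p by (metis inj_onI)
    then have "(\<Sum>\<pi>\<in>J. d \<pi> * G n \<pi> C) = v C" for C
      unfolding J_def v_eq d_def using p by (simp add: sum.reindex)
    then have "(\<lambda>A. red_map n f A - red_map n (\<lambda>A. \<Sum>\<pi>\<in>J. d \<pi> * lift n (G n \<pi>) A) A) = lefschetz n u"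
      unfolding red_lift(1)[OF J(2)] by (simp add: v_def)
    then have "x = FDR_coset n (\<lambda>A. \<Sum>\<pi>\<in>J. d \<pi> * lift n (G n \<pi>) A)"
      unfolding f(2) FDR_coset_eq_iff[OF assms f(1) red_lift(2)[OF J(2)]]
      using u(1) by (simp add: red_ideal_eq_lefschetz)
    also have "\<dots> = (\<Oplus>\<^bsub>FDR n\<^esub>i\<in>J. d i \<odot>\<^bsub>FDR n\<^esub> FDR_class n (G n i))"
      using J G(1) by (intro FDR_linear_combination[OF assms, symmetric]) auto
    finally show "\<exists>J c. finite J \<and> J \<subseteq> Phi n \<and>
        x = (\<Oplus>\<^bsub>FDR n\<^esub>i\<in>J. c i \<odot>\<^bsub>FDR n\<^esub> FDR_class n (G n i))"
      using J by blast
  qed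
qed

end
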